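(* Let $n\ge1$, let $\psi\in L^\infty(\mathbb{T}^n)$ with $|\psi|=1$ a.e. on $\mathbb{T}^n$, and let $$\mathscr{A}_\psi=\{T_\phi+A:\ \phi\in L^\infty(\mathbb{T}^n),\ A\in\mathscr{B}(\psi,\mathbf{0})\}.$$ Then: (1) If $T\in\mathscr{A}_\psi$, then $\widetilde{T}\to\phi$ radially for some $\phi\in L^\infty(\mathbb{T}^n)$. (2) $\mathscr{A}_\psi$ is a $C^*$-algebra. (3) The map $\Sigma_\psi:\mathscr{A}_\psi\to L^\infty(\mathbb{T}^n)$ defined by $\Sigma_\psi(T)=\phi$, where $\phi$ is the radial limit of $\widetilde{T}$ as in (1), is a $C^*$-algebra homomorphism from $\mathscr{A}_\psi$ onto $L^\infty(\mathbb{T}^n)$ such that $\Sigma_\psi(T_\phi)=\phi$ for all $\phi\in L^\infty(\mathbb{T}^n)$.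
   Context: Let $\mathbb{D}$ be the open unit disc, $\mathbb{T}$ the unit circle, $\mathfrak{m}_n$ the normalized Lebesgue measure on $\mathbb{T}^n$, and $L^p(\mathbb{T}^n)=L^p(\mathbb{T}^n,\mathfrak{m}_n)$. The Hardy space $H^2(\mathbb{D}^n)$ is identified, via radial boundary values, with the closed subspace of $L^2(\mathbb{T}^n)$ consisting of the functions whose Fourier coefficients with index in $\mathbb{Z}^n\setminus\mathbb{Z}_+^n$ vanish. $P_{H^2(\mathbb{D}^n)}$ is the orthogonal projection of $L^2(\mathbb{T}^n)$ onto $H^2(\mathbb{D}^n)$. For $\xi\in\mathbb{D}^n$, the normalized reproducing kernel is $k_\xi(z)=\prod_{j=1}^n\frac{\sqrt{1-|\xi_j|^2}}{1-\overline{\xi_j}z_j}$. The Berezin transform of a bounded operator $T$ on $H^2(\mathbb{D}^n)$ is $\widetilde{T}(\xi)=\langle Tk_\xi,k_\xi\rangle$, $\xi\in\mathbb{D}^n$. For $\phi\in L^\infty(\mathbb{T}^n)$ the Toeplitz operator is $T_\phi f=P_{H^2(\mathbb{D}^n)}(\phi f)$, $f\in H^2(\mathbb{D}^n)$. For $\psi\in L^\infty(\mathbb{T}^n)$, $\mathscr{B}(\psi,\mathbf{0})$ is the set of all bounded operators $A$ on $H^2(\mathbb{D}^n)$ such that $\|AT_\psi k_\xi\|\to0$ radially and $\|A^*T_\psi k_\xi\|\to0$ radially. For functions $\Phi:\mathbb{D}^n\to\mathbb{C}$ and $\phi:\mathbb{T}^n\to\mathbb{C}$, "$\Phi\to\phi$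 radially" (or "$\Phi(\xi)\to\phi$ radially") means $\lim_{r\to1^-}\Phi(r\zeta)=\phi(\zeta)$ for a.e. $\zeta\in\mathbb{T}^n$. *)

theory Defs
  imports "HOL-Probability.Probability"
begin

section \<open>Complex inner product spaces and their operators\<close>

text \<open>The complex inner product is linear in the first argument.  The underlying real
  structure supplies the norm, the topology and the type of bounded operators.\<close>

class complex_inner = real_inner +
  fixes scaleC :: "complex \<Rightarrow> 'a \<Rightarrow> 'a" (infixr "*\<^sub>C" 75)
    and cinner :: "'a \<Rightarrow> 'a \<Rightarrow> complex"
  assumes scaleC_add_right: "c *\<^sub>C (x + y) = c *\<^sub>C x + c *\<^sub>C y"
    and scaleC_add_left: "(c + d) *\<^sub>C x = c *\<^sub>C x + d *\<^sub>C x"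
    and scaleC_scaleC: "c *\<^sub>C d *\<^sub>C x = (c * d) *\<^sub>C x"
    and scaleC_of_real: "complex_of_real r *\<^sub>C x = r *\<^sub>R x"
    and cinner_commute: "cinner x y = cnj (cinner y x)"
    and cinner_add_left: "cinner (x + y) z = cinner x z + cinner y z"
    and cinner_scaleC_left: "cinner (c *\<^sub>C x) y = c * cinner x y"
    and inner_eq_Re_cinner: "inner x y = Re (cinner x y)"

text \<open>The type of bounded linear functions is that of the real-linear ones; the bounded
  operators on a complex space are the complex-linear ones among them.\<close>

definition bounded_operators :: "('a::complex_inner \<Rightarrow>\<^sub>L 'a) set" where
  "bounded_operators =
     {T. \<forall>c x. blinfun_apply T (c *\<^sub>C x) = c *\<^sub>C blinfun_apply T x}"

definition scale_op :: "complex \<Rightarrow> ('a::complex_inner \<Rightarrow>\<^sub>L 'a) \<Rightarrow> ('a \<Rightarrow>\<^sub>L 'a)" where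
  "scale_op c T = Blinfun (\<lambda>x. c *\<^sub>C blinfun_apply T x)"

definition adjoint_op :: "('a::complex_inner \<Rightarrow>\<^sub>L 'a) \<Rightarrow> ('a \<Rightarrow>\<^sub>L 'a)" where
  "adjoint_op T =
     (THE S. \<forall>x y. cinner (blinfun_apply T x) y = cinner x (blinfun_apply S y))"

text \<open>A C*-algebra of operators: a self-adjoint subalgebra of the bounded operators that is
  closed in the operator norm.\<close>

definition operator_cstar_algebra :: "('a::complex_inner \<Rightarrow>\<^sub>L 'a) set \<Rightarrow> bool" where
  "operator_cstar_algebra \<A> \<longleftrightarrow>
     \<A> \<subseteq> bounded_operators \<and> 0 \<in> \<A> \<and>
     (\<forall>S\<in>\<A>. \<forall>T\<in>\<A>. S + T \<in> \<A>) \<and>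
     (\<forall>c. \<forall>T\<in>\<A>. scale_op c T \<in> \<A>) \<and>
     (\<forall>S\<in>\<A>. \<forall>T\<in>\<A>. S o\<^sub>L T \<in> \<A>) \<and>
     (\<forall>T\<in>\<A>. adjoint_op T \<in> \<A>) \<and>
     closed \<A>"


section \<open>The torus\<close>

definition circle_measure :: "complex measure" where
  "circle_measure =
     distr (uniform_measure lborel {0..<2 * pi}) (restrict_space borel (sphere 0 1)) cis"

text \<open>The dimension is the cardinality of the finite (and nonempty) index type.\<close>

definition torus_measure :: "('n::finite \<Rightarrow> complex) measure" where
  "torus_measure = PiM UNIV (\<lambda>_. circle_measure)"

lemma prob_space_circle: "prob_space circle_measure"
proof -
  have "prob_space (uniform_measure lborel {0..<2 * pi})"
    by (rule prob_space_uniform_measure) auto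
  moreover have "cis \<in> measurable (uniform_measure lborel {0..<2 * pi}) (restrict_space borel (sphere 0 1))"
    by (intro measurable_restrict_space2)
      (auto simp: uniform_measure_def intro!: borel_measurable_continuous_onI continuous_on_cis continuous_on_id)
  ultimately show ?thesis
    unfolding circle_measure_def by (rule prob_space.prob_space_distr)
qed

lemma prob_space_torus: "prob_space (torus_measure :: ('n::finite \<Rightarrow> complex) measure)"
  unfolding torus_measure_def by (intro prob_space_PiM prob_space_circle)

definition radially_tendsto ::
    "(('n::finite \<Rightarrow> complex) \<Rightarrow> 'b::topological_space) \<Rightarrow> (('n \<Rightarrow> complex) \<Rightarrow> 'b) \<Rightarrow> bool" where
  "radially_tendsto \<Phi> \<phi> \<longleftrightarrow>
     (AE \<zeta> in torus_measure.
        ((\<lambda>r::real. \<Phi> (\<lambda>j. complex_of_real r * \<zeta> j)) \<longlongrightarrow> \<phi> \<zeta>) (at_left 1))"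


section \<open>The algebra of essentially bounded functions\<close>

definition essentially_bounded :: "(('n::finite \<Rightarrow> complex) \<Rightarrow> complex) \<Rightarrow> bool" where
  "essentially_bounded f \<longleftrightarrow>
     f \<in> borel_measurable torus_measure \<and> (\<exists>C. AE z in torus_measure. norm (f z) \<le> C)"

definition linf_eq ::
    "(('n::finite \<Rightarrow> complex) \<Rightarrow> complex) \<Rightarrow> (('n \<Rightarrow> complex) \<Rightarrow> complex) \<Rightarrow> bool" where
  "linf_eq f g \<longleftrightarrow>
     essentially_bounded f \<and> essentially_bounded g \<and> (AE z in torus_measure. f z = g z)"

lemma essentially_bounded_const: "essentially_bounded (\<lambda>_. c)"
  by (auto simp: essentially_bounded_def)

lemma part_equivp_linf_eq: "part_equivp linf_eq"
proof (rule part_equivpI)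
  show "\<exists>f. linf_eq f f"
    using essentially_bounded_const by (auto simp: linf_eq_def)
  show "symp linf_eq"
    by (auto simp: symp_def linf_eq_def elim: eventually_mono)
  show "transp linf_eq"
    unfolding transp_def linf_eq_def by (auto elim: eventually_elim2)
qed

quotient_type 'n linf = "('n::finite \<Rightarrow> complex) \<Rightarrow> complex" / partial: linf_eq
  by (rule part_equivp_linf_eq)

lemma essentially_bounded_add:
  assumes "essentially_bounded f" "essentially_bounded g"
  shows "essentially_bounded (\<lambda>z. f z + g z)"
proof -
  obtain C D where "AE z in torus_measure. norm (f z) \<le> C" "AE z in torus_measure. norm (g z) \<le> D"
    using assms by (auto simp: essentially_bounded_def)
  then have "AE z in torus_measure. norm (f z + g z) \<le> C + D"
    by eventually_elim (rule norm_triangle_mono)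
  then show ?thesis using assms by (auto simp: essentially_bounded_def)
qed

lemma essentially_bounded_mult:
  assumes "essentially_bounded f" "essentially_bounded g"
  shows "essentially_bounded (\<lambda>z. f z * g z)"
proof -
  obtain C D where "AE z in torus_measure. norm (f z) \<le> C" "AE z in torus_measure. norm (g z) \<le> D"
    using assms by (auto simp: essentially_bounded_def)
  then have "AE z in torus_measure. norm (f z * g z) \<le> \<bar>C\<bar> * \<bar>D\<bar>"
    by eventually_elim (auto simp: norm_mult intro!: mult_mono)
  then show ?thesis using assms by (auto simp: essentially_bounded_def)
qed

lemma essentially_bounded_uminus: "essentially_bounded f \<Longrightarrow> essentially_bounded (\<lambda>z. - f z)"
  by (auto simp: essentially_bounded_def)

lemma borel_measurable_cnj [measurable]:
  "f \<in> borel_measurable M \<Longrightarrow> (\<lambda>z. cnj (f z)) \<in> borel_measurable M"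
  by (rule measurable_compose[OF _ borel_measurable_continuous_onI[OF continuous_on_cnj[OF continuous_on_id]]])

lemma essentially_bounded_cnj: "essentially_bounded f \<Longrightarrow> essentially_bounded (\<lambda>z. cnj (f z))"
  by (auto simp: essentially_bounded_def borel_measurable_cnj)

instantiation linf :: (finite) comm_ring_1
begin

lift_definition zero_linf :: "'a linf" is "\<lambda>_. 0"
  by (simp add: linf_eq_def essentially_bounded_const)

lift_definition one_linf :: "'a linf" is "\<lambda>_. 1"
  by (simp add: linf_eq_def essentially_bounded_const)

lift_definition plus_linf :: "'a linf \<Rightarrow> 'a linf \<Rightarrow> 'a linf" is "\<lambda>f g z. f z + g z"
  unfolding linf_eq_def by (auto intro: essentially_bounded_add elim: eventually_elim2)

lift_definition times_linf :: "'a linf \<Rightarrow> 'a linf \<Rightarrow> 'a linf" is "\<lambda>f g z. f z * g z"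
  unfolding linf_eq_def by (auto intro: essentially_bounded_mult elim: eventually_elim2)

lift_definition uminus_linf :: "'a linf \<Rightarrow> 'a linf" is "\<lambda>f z. - f z"
  unfolding linf_eq_def by (auto intro: essentially_bounded_uminus)

definition minus_linf :: "'a linf \<Rightarrow> 'a linf \<Rightarrow> 'a linf" where
  "minus_linf f g = f + - g"

instance
proof
  fix f g h :: "'a linf"
  show "f + g + h = f + (g + h)"
    by transfer (auto simp: linf_eq_def algebra_simps intro!: essentially_bounded_add)
  show "f + g = g + f"
    by transfer (auto simp: linf_eq_def algebra_simps intro!: essentially_bounded_add)
  show "0 + f = f"
    by transfer (auto simp: linf_eq_def)
  show "- f + f = 0"
    by transfer (auto simp: linf_eq_def essentially_bounded_const)
  show "f - g = f + - g"
    by (simp add: minus_linf_def)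
  show "f * g * h = f * (g * h)"
    by transfer (auto simp: linf_eq_def algebra_simps intro!: essentially_bounded_mult)
  show "f * g = g * f"
    by transfer (auto simp: linf_eq_def algebra_simps intro!: essentially_bounded_mult)
  show "1 * f = f"
    by transfer (auto simp: linf_eq_def)
  show "(f + g) * h = f * h + g * h"
    by transfer (auto simp: linf_eq_def algebra_simps
        intro!: essentially_bounded_mult essentially_bounded_add)
  show "(0::'a linf) \<noteq> 1"
  proof
    assume "(0::'a linf) = 1"
    then have "AE z in (torus_measure :: ('a \<Rightarrow> complex) measure). False"
      by transfer (auto simp: linf_eq_def)
    then show False
      using prob_space.AE_False[OF prob_space_torus] by blast
  qed
qed

end

lift_definition cnj_linf :: "'n::finite linf \<Rightarrow> 'n linf" is "\<lambda>f z. cnj (f z)"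
  unfolding linf_eq_def by (auto intro: essentially_bounded_cnj)

lift_definition const_linf :: "complex \<Rightarrow> 'n::finite linf" is "\<lambda>c _. c"
  by (simp add: linf_eq_def essentially_bounded_const)


section \<open>Square-integrable functions\<close>

definition square_integrable :: "(('n::finite \<Rightarrow> complex) \<Rightarrow> complex) \<Rightarrow> bool" where
  "square_integrable f \<longleftrightarrow>
     f \<in> borel_measurable torus_measure \<and> integrable torus_measure (\<lambda>z. (norm (f z))\<^sup>2)"

definition l2_eq ::
    "(('n::finite \<Rightarrow> complex) \<Rightarrow> complex) \<Rightarrow> (('n \<Rightarrow> complex) \<Rightarrow> complex) \<Rightarrow> bool" where
  "l2_eq f g \<longleftrightarrow>
     square_integrable f \<and> square_integrable g \<and> (AE z in torus_measure. f z = g z)"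

lemma square_integrable_zero: "square_integrable (\<lambda>_. 0)"
  by (auto simp: square_integrable_def)

lemma part_equivp_l2_eq: "part_equivp l2_eq"
proof (rule part_equivpI)
  show "\<exists>f. l2_eq f f"
    using square_integrable_zero by (auto simp: l2_eq_def)
  show "symp l2_eq"
    by (auto simp: symp_def l2_eq_def elim: eventually_mono)
  show "transp l2_eq"
    unfolding transp_def l2_eq_def by (auto elim: eventually_elim2)
qed

quotient_type 'n l2 = "('n::finite \<Rightarrow> complex) \<Rightarrow> complex" / partial: l2_eq
  by (rule part_equivp_l2_eq)

lemma square_integrable_measurable:
  "square_integrable f \<Longrightarrow> f \<in> borel_measurable torus_measure"
  by (simp add: square_integrable_def)

lemma square_integrable_add:
  assumes "square_integrable f" "square_integrable g"
  shows "square_integrable (\<lambda>z. f z + g z)"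
  unfolding square_integrable_def
proof
  note [measurable] = assms[THEN square_integrable_measurable]
  show "(\<lambda>z. f z + g z) \<in> borel_measurable torus_measure" by measurable
  have "(norm (f z + g z))\<^sup>2 \<le> 2 * (norm (f z))\<^sup>2 + 2 * (norm (g z))\<^sup>2" for z
  proof -
    have "(norm (f z + g z))\<^sup>2 \<le> (norm (f z) + norm (g z))\<^sup>2"
      by (intro power_mono norm_triangle_ineq) auto
    also have "\<dots> \<le> 2 * (norm (f z))\<^sup>2 + 2 * (norm (g z))\<^sup>2"
      using sum_squares_bound[of "norm (f z)" "norm (g z)"] by (simp add: power2_sum)
    finally show ?thesis .
  qed
  then have ineq: "AE z in torus_measure.
      norm ((norm (f z + g z))\<^sup>2) \<le> norm (2 * (norm (f z))\<^sup>2 + 2 * (norm (g z))\<^sup>2)"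
    by simp
  have int: "integrable torus_measure (\<lambda>z. 2 * (norm (f z))\<^sup>2 + 2 * (norm (g z))\<^sup>2)"
    using assms by (auto simp: square_integrable_def)
  show "integrable torus_measure (\<lambda>z. (norm (f z + g z))\<^sup>2)"
    by (rule Bochner_Integration.integrable_bound[OF int _ ineq]) measurable
qed

lemma square_integrable_bounded_mult:
  assumes "essentially_bounded h" "square_integrable f"
  shows "square_integrable (\<lambda>z. h z * f z)"
  unfolding square_integrable_def
proof
  have [measurable]: "h \<in> borel_measurable torus_measure"
    using assms by (simp add: essentially_bounded_def)
  note [measurable] = assms(2)[THEN square_integrable_measurable]
  show "(\<lambda>z. h z * f z) \<in> borel_measurable torus_measure" by measurable
  obtain C where "AE z in torus_measure. norm (h z) \<le> C"
    using assms by (auto simp: essentially_bounded_def)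
  then have "AE z in torus_measure. (norm (h z * f z))\<^sup>2 \<le> C\<^sup>2 * (norm (f z))\<^sup>2"
  proof eventually_elim
    case (elim z)
    then have "(norm (h z))\<^sup>2 \<le> C\<^sup>2" by (intro power_mono) auto
    then show ?case by (simp add: norm_mult power_mult_distrib mult_right_mono)
  qed
  then have ineq: "AE z in torus_measure. norm ((norm (h z * f z))\<^sup>2) \<le> norm (C\<^sup>2 * (norm (f z))\<^sup>2)"
    by eventually_elim simp
  have int: "integrable torus_measure (\<lambda>z. C\<^sup>2 * (norm (f z))\<^sup>2)"
    using assms(2) by (auto simp: square_integrable_def)
  show "integrable torus_measure (\<lambda>z. (norm (h z * f z))\<^sup>2)"
    by (rule Bochner_Integration.integrable_bound[OF int _ ineq]) measurable
qed

lemma square_integrable_scale: "square_integrable f \<Longrightarrow> square_integrable (\<lambda>z. c * f z)"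
  by (rule square_integrable_bounded_mult[OF essentially_bounded_const])

lemma integrable_mult_cnj:
  assumes "square_integrable f" "square_integrable g"
  shows "integrable torus_measure (\<lambda>z. f z * cnj (g z))"
proof (rule Bochner_Integration.integrable_bound)
  note [measurable] = assms[THEN square_integrable_measurable]
  show "integrable torus_measure (\<lambda>z. (norm (f z))\<^sup>2 + (norm (g z))\<^sup>2)"
    using assms by (auto simp: square_integrable_def)
  show "(\<lambda>z. f z * cnj (g z)) \<in> borel_measurable torus_measure"
    by measurable
  have "norm (f z) * norm (g z) \<le> (norm (f z))\<^sup>2 + (norm (g z))\<^sup>2" for z
    using sum_squares_bound[of "norm (f z)" "norm (g z)"]
      mult_nonneg_nonneg[OF norm_ge_zero norm_ge_zero, of "f z" "g z"] by linarith
  then show "AE z in torus_measure.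
      norm (f z * cnj (g z)) \<le> norm ((norm (f z))\<^sup>2 + (norm (g z))\<^sup>2)"
    by (simp add: norm_mult)
qed

instantiation l2 :: (finite) complex_inner
begin

lift_definition zero_l2 :: "'a l2" is "\<lambda>_. 0"
  by (simp add: l2_eq_def square_integrable_zero)

lift_definition plus_l2 :: "'a l2 \<Rightarrow> 'a l2 \<Rightarrow> 'a l2" is "\<lambda>f g z. f z + g z"
  unfolding l2_eq_def by (auto intro: square_integrable_add elim: eventually_elim2)

lift_definition scaleC_l2 :: "complex \<Rightarrow> 'a l2 \<Rightarrow> 'a l2" is "\<lambda>c f z. c * f z"
  unfolding l2_eq_def by (auto intro: square_integrable_scale)

lift_definition cinner_l2 :: "'a l2 \<Rightarrow> 'a l2 \<Rightarrow> complex" is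
  "\<lambda>f g. LINT z|torus_measure. f z * cnj (g z)"
proof -
  fix f f' g g' :: "('a \<Rightarrow> complex) \<Rightarrow> complex"
  assume "l2_eq f f'" "l2_eq g g'"
  then have "square_integrable f" "square_integrable f'" "square_integrable g" "square_integrable g'"
    and ae: "AE z in torus_measure. f z = f' z" "AE z in torus_measure. g z = g' z"
    by (auto simp: l2_eq_def)
  note [measurable] = this(1-4)[THEN square_integrable_measurable]
  show "(LINT z|torus_measure. f z * cnj (g z)) = (LINT z|torus_measure. f' z * cnj (g' z))"
    using ae by (intro integral_cong_AE) (auto elim: eventually_elim2)
qed

definition uminus_l2 :: "'a l2 \<Rightarrow> 'a l2" where
  "uminus_l2 f = (- 1) *\<^sub>C f"

definition minus_l2 :: "'a l2 \<Rightarrow> 'a l2 \<Rightarrow> 'a l2" where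
  "minus_l2 f g = f + - g"

definition scaleR_l2 :: "real \<Rightarrow> 'a l2 \<Rightarrow> 'a l2" where
  "scaleR_l2 r f = complex_of_real r *\<^sub>C f"

definition inner_l2 :: "'a l2 \<Rightarrow> 'a l2 \<Rightarrow> real" where
  "inner_l2 f g = Re (cinner f g)"

definition norm_l2 :: "'a l2 \<Rightarrow> real" where
  "norm_l2 f = sqrt (inner f f)"

definition dist_l2 :: "'a l2 \<Rightarrow> 'a l2 \<Rightarrow> real" where
  "dist_l2 f g = norm (f - g)"

definition sgn_l2 :: "'a l2 \<Rightarrow> 'a l2" where
  "sgn_l2 f = inverse (norm f) *\<^sub>R f"

definition uniformity_l2 :: "('a l2 \<times> 'a l2) filter" where
  "uniformity_l2 = (INF e\<in>{0<..}. principal {(f, g). dist f g < e})"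

definition open_l2 :: "'a l2 set \<Rightarrow> bool" where
  "open_l2 U \<longleftrightarrow> (\<forall>f\<in>U. eventually (\<lambda>(f', g). f' = f \<longrightarrow> g \<in> U) uniformity)"

instance
proof
  fix f g h :: "'a l2" and r s :: real and c d :: complex
  show add_assoc: "f + g + h = f + (g + h)"
    by transfer (auto simp: l2_eq_def algebra_simps intro!: square_integrable_add)
  show "f + g = g + f"
    by transfer (auto simp: l2_eq_def algebra_simps intro!: square_integrable_add)
  show "0 + f = f"
    by transfer (auto simp: l2_eq_def)
  show "- f + f = 0"
    unfolding uminus_l2_def by transfer (auto simp: l2_eq_def square_integrable_zero)
  show "f - g = f + - g"
    by (simp add: minus_l2_def)
  show scale_add: "c *\<^sub>C (f + g) = c *\<^sub>C f + c *\<^sub>C g" for c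
    by transfer
      (auto simp: l2_eq_def algebra_simps intro!: square_integrable_add square_integrable_scale)
  show add_scale: "(c + d) *\<^sub>C f = c *\<^sub>C f + d *\<^sub>C f" for c d
    by transfer
      (auto simp: l2_eq_def algebra_simps intro!: square_integrable_add square_integrable_scale)
  show scale_scale: "c *\<^sub>C d *\<^sub>C f = (c * d) *\<^sub>C f" for c d
    by transfer (auto simp: l2_eq_def algebra_simps intro!: square_integrable_scale)
  show "complex_of_real r *\<^sub>C f = r *\<^sub>R f"
    by (simp add: scaleR_l2_def)
  show "r *\<^sub>R (f + g) = r *\<^sub>R f + r *\<^sub>R g"
    by (simp add: scaleR_l2_def scale_add)
  show "(r + s) *\<^sub>R f = r *\<^sub>R f + s *\<^sub>R f"
    by (simp add: scaleR_l2_def add_scale)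
  show "r *\<^sub>R s *\<^sub>R f = (r * s) *\<^sub>R f"
    by (simp add: scaleR_l2_def scale_scale)
  show "1 *\<^sub>R f = f"
    unfolding scaleR_l2_def by transfer (auto simp: l2_eq_def)
  show cinner_comm: "cinner f g = cnj (cinner g f)" for f g :: "'a l2"
    by transfer (simp add: mult.commute flip: Bochner_Integration.integral_cnj)
  show cinner_add: "cinner (f + g) h = cinner f h + cinner g h"
    by transfer (auto simp: l2_eq_def algebra_simps integrable_mult_cnj
        intro!: Bochner_Integration.integral_add)
  show cinner_scale: "cinner (c *\<^sub>C f) g = c * cinner f g" for c
    by transfer (simp add: mult.assoc)
  show "inner f g = Re (cinner f g)"
    by (simp add: inner_l2_def)
  show "inner f g = inner g f"
    unfolding inner_l2_def by (subst cinner_comm) simp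
  show "inner (f + g) h = inner f h + inner g h"
    by (simp add: inner_l2_def cinner_add)
  show "inner (r *\<^sub>R f) g = r * inner f g"
    by (simp add: inner_l2_def scaleR_l2_def cinner_scale)
  have Re_cinner: "Re (LINT z|torus_measure. k z * cnj (k z)) = (LINT z|torus_measure. (norm (k z))\<^sup>2)"
    for k :: "('a \<Rightarrow> complex) \<Rightarrow> complex"
    by (simp add: complex_norm_square[symmetric] flip: of_real_power)
  show "0 \<le> inner f f"
    unfolding inner_l2_def by transfer (simp add: Re_cinner)
  show "inner f f = 0 \<longleftrightarrow> f = 0"
    unfolding inner_l2_def
  proof transfer
    fix k :: "('a \<Rightarrow> complex) \<Rightarrow> complex"
    assume "l2_eq k k"
    then have "square_integrable k" by (simp add: l2_eq_def)
    then show "Re (LINT z|torus_measure. k z * cnj (k z)) = 0 \<longleftrightarrow> l2_eq k (\<lambda>_. 0)"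
      unfolding Re_cinner
      by (subst integral_nonneg_eq_0_iff_AE)
        (auto simp: square_integrable_def l2_eq_def square_integrable_zero)
  qed
  show "norm f = sqrt (inner f f)"
    by (simp add: norm_l2_def)
  show "dist f g = norm (f - g)"
    by (simp add: dist_l2_def)
  show "sgn f = inverse (norm f) *\<^sub>R f"
    by (simp add: sgn_l2_def)
  show "(uniformity :: ('a l2 \<times> 'a l2) filter) = (INF e\<in>{0<..}. principal {(f, g). dist f g < e})"
    by (simp add: uniformity_l2_def)
  show "open U \<longleftrightarrow> (\<forall>f\<in>U. eventually (\<lambda>(f', g). f' = f \<longrightarrow> g \<in> U) uniformity)" for U :: "'a l2 set"
    by (simp add: open_l2_def)
qed

end

lift_definition mult_l2 :: "'n::finite linf \<Rightarrow> 'n l2 \<Rightarrow> 'n l2" is "\<lambda>\<phi> f z. \<phi> z * f z"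
  unfolding l2_eq_def linf_eq_def
  by (auto intro: square_integrable_bounded_mult elim: eventually_elim2)

definition torus_monomial :: "('n::finite \<Rightarrow> int) \<Rightarrow> ('n \<Rightarrow> complex) \<Rightarrow> complex" where
  "torus_monomial \<alpha> z = (\<Prod>j\<in>UNIV. z j powi \<alpha> j)"

lemma measurable_component_torus [measurable]:
  "(\<lambda>z. z j) \<in> borel_measurable (torus_measure :: ('n::finite \<Rightarrow> complex) measure)"
proof -
  have "(\<lambda>z. z j) \<in> measurable (torus_measure :: ('n \<Rightarrow> complex) measure) circle_measure"
    unfolding torus_measure_def by (rule measurable_component_singleton) simp
  moreover have "(\<lambda>w. w) \<in> borel_measurable circle_measure"
    by (simp add: circle_measure_def measurable_restrict_space1)
  ultimately show ?thesis by (rule measurable_compose)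
qed

lemma norm_torus: "z \<in> space (torus_measure :: ('n::finite \<Rightarrow> complex) measure) \<Longrightarrow> norm (z j) = 1"
  by (auto simp: torus_measure_def space_PiM PiE_iff circle_measure_def space_restrict_space)

lemma square_integrable_monomial: "square_integrable (torus_monomial \<alpha>)"
  unfolding square_integrable_def
proof
  interpret prob_space "torus_measure :: ('a \<Rightarrow> complex) measure" by (rule prob_space_torus)
  show "torus_monomial \<alpha> \<in> borel_measurable torus_measure"
    unfolding torus_monomial_def[abs_def] power_int_def by measurable
  have "integrable torus_measure (\<lambda>z. (norm (torus_monomial \<alpha> z))\<^sup>2)
      \<longleftrightarrow> integrable (torus_measure :: ('a \<Rightarrow> complex) measure) (\<lambda>z. 1::real)"
    by (intro Bochner_Integration.integrable_cong)
      (auto simp: torus_monomial_def prod_norm[symmetric] norm_power_int norm_torus)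
  then show "integrable torus_measure (\<lambda>z. (norm (torus_monomial \<alpha> z))\<^sup>2)" by simp
qed

lift_definition fourier_coeff :: "'n::finite l2 \<Rightarrow> ('n \<Rightarrow> int) \<Rightarrow> complex" is
  "\<lambda>f \<alpha>. LINT z|torus_measure. f z * cnj (torus_monomial \<alpha> z)"
proof
  fix f g :: "('n \<Rightarrow> complex) \<Rightarrow> complex" and \<alpha> :: "'n \<Rightarrow> int"
  assume "l2_eq f g"
  then have "square_integrable f" "square_integrable g"
    and ae: "AE z in torus_measure. f z = g z"
    by (auto simp: l2_eq_def)
  note [measurable] = this(1,2)[THEN square_integrable_measurable]
    square_integrable_monomial[of \<alpha>, THEN square_integrable_measurable]
  show "(LINT z|torus_measure. f z * cnj (torus_monomial \<alpha> z))
      = (LINT z|torus_measure. g z * cnj (torus_monomial \<alpha> z))"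
    using ae by (intro integral_cong_AE) auto
qed

lemma fourier_coeff_zero: "fourier_coeff 0 \<alpha> = 0"
  by transfer simp

lemma fourier_coeff_add: "fourier_coeff (f + g) \<alpha> = fourier_coeff f \<alpha> + fourier_coeff g \<alpha>"
  by transfer (auto simp: l2_eq_def algebra_simps integrable_mult_cnj square_integrable_monomial
      intro!: Bochner_Integration.integral_add)

lemma fourier_coeff_scaleC: "fourier_coeff (c *\<^sub>C f) \<alpha> = c * fourier_coeff f \<alpha>"
  by transfer (simp add: mult.assoc)


section \<open>The Hardy space\<close>

typedef 'n h2 = "{f :: 'n::finite l2. \<forall>\<alpha>. (\<exists>j. \<alpha> j < 0) \<longrightarrow> fourier_coeff f \<alpha> = 0}"
  morphisms l2_of_h2 h2_of_l2
  by (rule exI[of _ 0]) (simp add: fourier_coeff_zero)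

setup_lifting type_definition_h2

instantiation h2 :: (finite) complex_inner
begin

lift_definition zero_h2 :: "'a h2" is 0
  by (simp add: fourier_coeff_zero)

lift_definition plus_h2 :: "'a h2 \<Rightarrow> 'a h2 \<Rightarrow> 'a h2" is "(+)"
  by (simp add: fourier_coeff_add)

lift_definition scaleC_h2 :: "complex \<Rightarrow> 'a h2 \<Rightarrow> 'a h2" is "(*\<^sub>C)"
  by (simp add: fourier_coeff_scaleC)

lift_definition uminus_h2 :: "'a h2 \<Rightarrow> 'a h2" is uminus
  by (simp add: uminus_l2_def fourier_coeff_scaleC)

lift_definition minus_h2 :: "'a h2 \<Rightarrow> 'a h2 \<Rightarrow> 'a h2" is "(-)"
  by (simp add: minus_l2_def uminus_l2_def fourier_coeff_add fourier_coeff_scaleC)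

lift_definition scaleR_h2 :: "real \<Rightarrow> 'a h2 \<Rightarrow> 'a h2" is "(*\<^sub>R)"
  by (simp add: scaleR_l2_def fourier_coeff_scaleC)

lift_definition cinner_h2 :: "'a h2 \<Rightarrow> 'a h2 \<Rightarrow> complex" is cinner .

lift_definition inner_h2 :: "'a h2 \<Rightarrow> 'a h2 \<Rightarrow> real" is inner .

lift_definition norm_h2 :: "'a h2 \<Rightarrow> real" is norm .

lift_definition dist_h2 :: "'a h2 \<Rightarrow> 'a h2 \<Rightarrow> real" is dist .

definition sgn_h2 :: "'a h2 \<Rightarrow> 'a h2" where
  "sgn_h2 f = inverse (norm f) *\<^sub>R f"

definition uniformity_h2 :: "('a h2 \<times> 'a h2) filter" where
  "uniformity_h2 = (INF e\<in>{0<..}. principal {(f, g). dist f g < e})"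

definition open_h2 :: "'a h2 set \<Rightarrow> bool" where
  "open_h2 U \<longleftrightarrow> (\<forall>f\<in>U. eventually (\<lambda>(f', g). f' = f \<longrightarrow> g \<in> U) uniformity)"

instance
proof
  fix f g h :: "'a h2" and r s :: real and c d :: complex
  show "f + g + h = f + (g + h)" by transfer (rule add.assoc)
  show "f + g = g + f" by transfer (rule add.commute)
  show "0 + f = f" by transfer simp
  show "- f + f = 0" by transfer simp
  show "f - g = f + - g" by transfer simp
  show "r *\<^sub>R (f + g) = r *\<^sub>R f + r *\<^sub>R g" by transfer (rule scaleR_right_distrib)
  show "(r + s) *\<^sub>R f = r *\<^sub>R f + s *\<^sub>R f" by transfer (rule scaleR_left_distrib)
  show "r *\<^sub>R s *\<^sub>R f = (r * s) *\<^sub>R f" by transfer simp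
  show "1 *\<^sub>R f = f" by transfer simp
  show "inner f g = inner g f" by transfer (rule inner_commute)
  show "inner (f + g) h = inner f h + inner g h" by transfer (rule inner_add_left)
  show "inner (r *\<^sub>R f) g = r * inner f g" by transfer simp
  show "0 \<le> inner f f" by transfer simp
  show "inner f f = 0 \<longleftrightarrow> f = 0" by transfer simp
  show "norm f = sqrt (inner f f)" by transfer (rule norm_eq_sqrt_inner)
  show "dist f g = norm (f - g)" by transfer (rule dist_norm)
  show "sgn f = inverse (norm f) *\<^sub>R f" by (simp add: sgn_h2_def)
  show "(uniformity :: ('a h2 \<times> 'a h2) filter) = (INF e\<in>{0<..}. principal {(f, g). dist f g < e})"
    by (simp add: uniformity_h2_def)
  show "open U \<longleftrightarrow> (\<forall>f\<in>U. eventually (\<lambda>(f', g). f' = f \<longrightarrow> g \<in> U) uniformity)" for U :: "'a h2 set"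
    by (simp add: open_h2_def)
  show "c *\<^sub>C (f + g) = c *\<^sub>C f + c *\<^sub>C g" by transfer (rule scaleC_add_right)
  show "(c + d) *\<^sub>C f = c *\<^sub>C f + d *\<^sub>C f" by transfer (rule scaleC_add_left)
  show "c *\<^sub>C d *\<^sub>C f = (c * d) *\<^sub>C f" by transfer (rule scaleC_scaleC)
  show "complex_of_real r *\<^sub>C f = r *\<^sub>R f" by transfer (rule scaleC_of_real)
  show "cinner f g = cnj (cinner g f)" by transfer (rule cinner_commute)
  show "cinner (f + g) h = cinner f h + cinner g h" by transfer (rule cinner_add_left)
  show "cinner (c *\<^sub>C f) g = c * cinner f g" by transfer (rule cinner_scaleC_left)
  show "inner f g = Re (cinner f g)" by transfer (rule inner_eq_Re_cinner)
qed

end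

text \<open>The orthogonal projection onto the Hardy space.\<close>

definition proj_h2 :: "'n::finite l2 \<Rightarrow> 'n h2" where
  "proj_h2 f = (THE h. \<forall>g. cinner (f - l2_of_h2 h) (l2_of_h2 g) = 0)"

definition toeplitz :: "'n::finite linf \<Rightarrow> ('n h2 \<Rightarrow>\<^sub>L 'n h2)" where
  "toeplitz \<phi> = Blinfun (\<lambda>f. proj_h2 (mult_l2 \<phi> (l2_of_h2 f)))"

text \<open>The normalized reproducing kernel, meaningful for points of the open polydisc.\<close>

definition kernel :: "('n::finite \<Rightarrow> complex) \<Rightarrow> 'n h2" where
  "kernel \<xi> = h2_of_l2 (abs_l2 (\<lambda>z.
     \<Prod>j\<in>UNIV. complex_of_real (sqrt (1 - (norm (\<xi> j))\<^sup>2)) / (1 - cnj (\<xi> j) * z j)))"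

definition berezin :: "('n::finite h2 \<Rightarrow>\<^sub>L 'n h2) \<Rightarrow> ('n \<Rightarrow> complex) \<Rightarrow> complex" where
  "berezin T \<xi> = cinner (blinfun_apply T (kernel \<xi>)) (kernel \<xi>)"


section \<open>The algebra and its symbol map\<close>

definition B_zero :: "'n::finite linf \<Rightarrow> ('n h2 \<Rightarrow>\<^sub>L 'n h2) set" where
  "B_zero \<psi> = {A \<in> bounded_operators.
     radially_tendsto (\<lambda>\<xi>. norm (blinfun_apply A (blinfun_apply (toeplitz \<psi>) (kernel \<xi>)))) (\<lambda>_. 0) \<and>
     radially_tendsto
       (\<lambda>\<xi>. norm (blinfun_apply (adjoint_op A) (blinfun_apply (toeplitz \<psi>) (kernel \<xi>)))) (\<lambda>_. 0)}"

definition A_alg :: "'n::finite linf \<Rightarrow> ('n h2 \<Rightarrow>\<^sub>L 'n h2) set" where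
  "A_alg \<psi> = {toeplitz \<phi> + A | \<phi> A. A \<in> B_zero \<psi>}"

definition symbol :: "('n::finite h2 \<Rightarrow>\<^sub>L 'n h2) \<Rightarrow> 'n linf" where
  "symbol T = (THE \<phi>. radially_tendsto (berezin T) (rep_linf \<phi>))"

text \<open>A homomorphism of C*-algebras is a *-homomorphism of complex algebras; boundedness is
  automatic and is not part of the definition.  Scalars act on essentially bounded functions
  through multiplication by constant functions.\<close>

definition cstar_hom ::
    "('a::complex_inner \<Rightarrow>\<^sub>L 'a) set \<Rightarrow> (('a \<Rightarrow>\<^sub>L 'a) \<Rightarrow> 'n::finite linf) \<Rightarrow> bool" where
  "cstar_hom \<A> \<Sigma> \<longleftrightarrow>
     (\<forall>S\<in>\<A>. \<forall>T\<in>\<A>. \<Sigma> (S + T) = \<Sigma> S + \<Sigma> T) \<and>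
     (\<forall>c. \<forall>T\<in>\<A>. \<Sigma> (scale_op c T) = const_linf c * \<Sigma> T) \<and>
     (\<forall>S\<in>\<A>. \<forall>T\<in>\<A>. \<Sigma> (S o\<^sub>L T) = \<Sigma> S * \<Sigma> T) \<and>
     (\<forall>T\<in>\<A>. \<Sigma> (adjoint_op T) = cnj_linf (\<Sigma> T))"

end

theory Submission
  imports Defs
begin

text \<open>The theorem rests on one asymptotic fact: for every \<open>\<phi>\<close> in \<open>L\<^sup>\<infinity>\<close> and almost every \<open>\<zeta>\<close> on
  the torus, the normalized kernels \<open>k\<close> at \<open>r \<zeta>\<close> become eigenvectors of \<open>T\<^sub>\<phi>\<close> with eigenvalue
  \<open>\<phi> \<zeta>\<close>, in the sense that \<open>T\<^sub>\<phi> k - \<phi>(\<zeta>) k\<close> tends to zero in norm as \<open>r\<close> tends to one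
  (\<open>kernel_eigenvalue_toeplitz\<close>).  As \<open>|k|\<^sup>2\<close> is the Poisson kernel and the projection onto the Hardy
  space is a contraction, the square of this norm is at most the Poisson integral of
  \<open>|\<phi> - \<phi>(\<zeta>)|\<^sup>2\<close>, and that this vanishes in the limit is a form of Fatou's theorem
  (\<open>AE_poisson_oscillation_tendsto_0\<close>).

  Call \<open>\<phi>\<close> a symbol of a bounded operator \<open>T\<close> if \<open>T k - \<phi>(\<zeta>) k\<close> and \<open>T* k - cnj \<phi>(\<zeta>) k\<close> both
  tend to zero almost everywhere.  Asymptotic eigenvectors behave like common eigenvectors:
  sums, products and adjoints of operators with symbols have as symbols the sums, products and
  conjugates, and as \<open>\<parallel>k\<parallel> = 1\<close> the symbols of a norm convergent sequence of operators converge
  uniformly, so that operators with a symbol form a C*-algebra (\<open>closed_has_symbol\<close>).  The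
  Berezin transform \<open>\<langle>T k, k\<rangle>\<close> converges to the symbol, which is therefore unique and is the
  value of the symbol map.

  The function \<open>\<psi>\<close> disappears: as \<open>T\<^sub>\<psi> k\<close> is asymptotically \<open>\<psi>(\<zeta>) k\<close> with \<open>|\<psi>(\<zeta>)| = 1\<close>, the
  norms of \<open>A T\<^sub>\<psi> k\<close> and \<open>A k\<close> have the same limit behaviour.  Hence the operators in
  \<open>B_zero \<psi>\<close> are those with symbol zero, and the algebra consists of all operators that have
  a symbol (\<open>A_alg_eq\<close>).

  Fatou's theorem is derived for bounded functions only, which permits an argument without
  maximal functions.  At a point of density zero of a set, in the angular coordinates of the
  torus, the Poisson mass of the set vanishes radially: near the point the kernel is bounded by
  a multiple of the inverse volume of a ball (\<open>poisson_integral_le\<close>), and far from it the mass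
  is small.  Density points are provided by Vitali's covering theorem (\<open>AE_density_zero\<close>).\<close>

section \<open>Complex Hilbert spaces\<close>

lemma Im_cinner: "Im (cinner x y) = - inner (\<i> *\<^sub>C x) (y :: 'a::complex_inner)"
  by (simp add: inner_eq_Re_cinner cinner_scaleC_left)

text \<open>The complex inner product is determined by the real one, since
  \<open>Im \<langle>x, y\<rangle> = - Re \<langle>i x, y\<rangle>\<close>.  Real representation theorems therefore suffice for complex
  Hilbert spaces.\<close>

lemma cinner_eqI:
  fixes x y u v :: "'a::complex_inner"
  assumes "inner x y = inner u v" "inner (\<i> *\<^sub>C x) y = inner (\<i> *\<^sub>C u) v"
  shows "cinner x y = cinner u v"
  using assms by (intro complex_eqI) (simp_all add: Im_cinner inner_eq_Re_cinner)

lemma cinner_add_right: "cinner x (y + z) = cinner x y + cinner x (z :: 'a::complex_inner)"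
  by (metis cinner_commute cinner_add_left complex_cnj_add)

lemma cinner_scaleC_right: "cinner x (c *\<^sub>C y) = cnj c * cinner x (y :: 'a::complex_inner)"
  by (metis cinner_commute cinner_scaleC_left complex_cnj_mult)

lemma cinner_diff_left: "cinner (x - y) z = cinner x z - cinner y (z :: 'a::complex_inner)"
  using cinner_add_left[of "x - y" y z] by simp

lemma cinner_diff_right: "cinner z (x - y) = cinner z x - cinner z (y :: 'a::complex_inner)"
  using cinner_add_right[of z "x - y" y] by simp

lemma cinner_self: "cinner x x = complex_of_real ((norm (x :: 'a::complex_inner))\<^sup>2)"
proof (rule complex_eqI)
  show "Re (cinner x x) = Re (complex_of_real ((norm x)\<^sup>2))"
    by (simp add: inner_eq_Re_cinner[symmetric] power2_norm_eq_inner)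
  show "Im (cinner x x) = Im (complex_of_real ((norm x)\<^sup>2))"
    using arg_cong[OF cinner_commute[of x x], of Im] by simp
qed

lemma cinner_right_eqI:
  fixes y z :: "'a::complex_inner"
  assumes "\<And>x. cinner x y = cinner x z"
  shows "y = z"
proof -
  have "cinner (y - z) (y - z) = 0"
    by (simp add: cinner_diff_right assms)
  then show ?thesis by (simp add: cinner_self)
qed

lemma cinner_left_eqI:
  fixes y z :: "'a::complex_inner"
  assumes "\<And>x. cinner y x = cinner z x"
  shows "y = z"
  by (rule cinner_right_eqI) (metis assms cinner_commute)

lemma norm_scaleC: "norm (c *\<^sub>C x) = norm c * norm (x :: 'a::complex_inner)"
proof -
  have "complex_of_real ((norm (c *\<^sub>C x))\<^sup>2) = (c * cnj c) * cinner x x"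
    unfolding cinner_self[symmetric] by (simp add: cinner_scaleC_left cinner_scaleC_right)
  also have "\<dots> = complex_of_real ((norm c * norm x)\<^sup>2)"
    by (simp only: cinner_self complex_norm_square[symmetric] power_mult_distrib of_real_mult of_real_power)
  finally have "(norm (c *\<^sub>C x))\<^sup>2 = (norm c * norm x)\<^sup>2"
    by (simp only: of_real_eq_iff)
  then show ?thesis by (simp add: power2_eq_iff_nonneg)
qed

lemma scaleC_diff_right: "c *\<^sub>C (x - y) = c *\<^sub>C x - c *\<^sub>C (y :: 'a::complex_inner)"
  using scaleC_add_right[of c "x - y" y] by simp

lemma scaleC_diff_left: "(c - d) *\<^sub>C x = c *\<^sub>C x - d *\<^sub>C (x :: 'a::complex_inner)"
  using scaleC_add_left[of "c - d" d x] by simp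

lemma scaleC_one: "1 *\<^sub>C x = (x :: 'a::complex_inner)"
  using scaleC_of_real[of 1 x] by simp

lemma bounded_linear_scaleC: "bounded_linear (\<lambda>x. c *\<^sub>C (x :: 'a::complex_inner))"
proof (rule bounded_linear_intro)
  show "c *\<^sub>C (x + y) = c *\<^sub>C x + c *\<^sub>C y" for x y :: 'a by (rule scaleC_add_right)
  show "c *\<^sub>C r *\<^sub>R x = r *\<^sub>R c *\<^sub>C x" for r and x :: 'a
    by (simp add: scaleC_of_real[symmetric] scaleC_scaleC mult.commute)
  show "norm (c *\<^sub>C x) \<le> norm x * norm c" for x :: 'a by (simp add: norm_scaleC)
qed

lemma norm_cinner_le: "norm (cinner x y) \<le> norm x * norm (y :: 'a::complex_inner)"
proof (cases "cinner x y = 0")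
  case False
  let ?c = "cnj (sgn (cinner x y))"
  have "complex_of_real (norm (cinner x y)) = ?c * cinner x y"
    using False by (simp add: sgn_eq complex_norm_square[symmetric] mult.commute power2_eq_square)
  also have "\<dots> = cinner (?c *\<^sub>C x) y" by (simp add: cinner_scaleC_left)
  finally have "norm (cinner x y) = inner (?c *\<^sub>C x) y"
    by (metis Re_complex_of_real inner_eq_Re_cinner)
  also have "\<dots> \<le> norm (?c *\<^sub>C x) * norm y" by (rule norm_cauchy_schwarz)
  also have "\<dots> = norm x * norm y" using False by (simp add: norm_scaleC norm_sgn)
  finally show ?thesis .
qed simp

text \<open>The representing vector minimizes the functional \<open>\<parallel>x\<parallel>\<^sup>2 - 2 f x\<close>.  A minimizing sequence
  is Cauchy by the parallelogram law, and the first variation at the minimum vanishes.\<close>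

theorem riesz_representation:
  fixes f :: "'a::{real_inner, banach} \<Rightarrow> real"
  assumes "bounded_linear f"
  shows "\<exists>y. \<forall>x. f x = inner x y"
proof -
  interpret bounded_linear f by fact
  define J where "J x = (norm x)\<^sup>2 - 2 * f x" for x
  obtain K where K: "norm (f x) \<le> norm x * K" for x
    using bounded by blast
  have J_lower: "- K\<^sup>2 \<le> J x" for x
  proof -
    have "f x \<le> norm x * K" using K[of x] by simp
    moreover have "0 \<le> (norm x - K)\<^sup>2" by simp
    ultimately show ?thesis by (simp add: J_def power2_diff)
  qed
  then have bdd: "bdd_below (range J)" by (intro bdd_belowI[of _ "- K\<^sup>2"]) auto
  define m where "m = Inf (range J)"
  have m_le: "m \<le> J x" for x
    unfolding m_def by (rule cInf_lower[OF _ bdd]) simp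
  have "\<exists>x. J x < m + inverse (real (Suc n))" for n
    using cInf_lessD[of "range J" "m + inverse (real (Suc n))"] by (auto simp: m_def[symmetric])
  then obtain x where x: "J (x n) < m + inverse (real (Suc n))" for n by metis
  have parallelogram: "(norm (u - v))\<^sup>2 = 2 * (J u + J v - 2 * J ((1 / 2) *\<^sub>R (u + v)))" for u v
    unfolding J_def by (simp add: power2_norm_eq_inner inner_add inner_diff inner_commute
        scaleR add field_simps)
  have "Cauchy x"
  proof (rule metric_CauchyI)
    fix e :: real assume "0 < e"
    then obtain N where N: "inverse (real (Suc N)) < e\<^sup>2 / 4"
      using reals_Archimedean[of "e\<^sup>2 / 4"] by auto
    have "dist (x i) (x j) < e" if "i \<ge> N" "j \<ge> N" for i j
    proof -
      have small: "J (x k) < m + e\<^sup>2 / 4" if "k \<ge> N" for k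
      proof -
        have "inverse (real (Suc k)) \<le> inverse (real (Suc N))" using that by simp
        then show ?thesis using x[of k] N by linarith
      qed
      have "(norm (x i - x j))\<^sup>2 \<le> 2 * (J (x i) + J (x j) - 2 * m)"
        unfolding parallelogram using m_le by simp
      also have "\<dots> < e\<^sup>2" using small[OF that(1)] small[OF that(2)] by simp
      finally show ?thesis
        using \<open>0 < e\<close> by (simp add: dist_norm power_less_imp_less_base)
    qed
    then show "\<exists>N. \<forall>i\<ge>N. \<forall>j\<ge>N. dist (x i) (x j) < e" by blast
  qed
  then obtain y where y: "x \<longlonglongrightarrow> y" using Cauchy_convergent convergent_def by blast
  have "(\<lambda>n. J (x n)) \<longlonglongrightarrow> J y"
    unfolding J_def using y by (intro tendsto_intros tendsto)
  moreover have "(\<lambda>n. m + inverse (real (Suc n))) \<longlonglongrightarrow> m + 0"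
    by (intro tendsto_intros LIMSEQ_inverse_real_of_nat)
  ultimately have "J y \<le> m + 0"
    by (rule LIMSEQ_le) (use x in \<open>auto intro: less_imp_le\<close>)
  then have min: "J y \<le> J z" for z using m_le[of z] by simp
  have "f h = inner h y" for h
  proof (cases "h = 0")
    case False
    \<comment> \<open>The value of \<open>t\<close> that minimizes \<open>J (y + t *\<^sub>R h)\<close>.\<close>
    define t where "t = (f h - inner h y) / (norm h)\<^sup>2"
    have h: "(norm h)\<^sup>2 > 0" using False by simp
    have "J (y + t *\<^sub>R h) = J y + (t\<^sup>2 * (norm h)\<^sup>2 - 2 * t * (f h - inner h y))"
      unfolding J_def power2_norm_eq_inner
      by (simp add: inner_add inner_commute add scaleR power2_eq_square algebra_simps)
    also have "t\<^sup>2 * (norm h)\<^sup>2 - 2 * t * (f h - inner h y) = - ((f h - inner h y)\<^sup>2 / (norm h)\<^sup>2)"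
    proof -
      have "t * (norm h)\<^sup>2 = f h - inner h y" using h by (simp add: t_def)
      then have "t\<^sup>2 * (norm h)\<^sup>2 = t * (f h - inner h y)" by (simp add: power2_eq_square)
      then show ?thesis by (simp add: t_def power2_eq_square)
    qed
    finally have "(f h - inner h y)\<^sup>2 / (norm h)\<^sup>2 \<le> 0"
      using min[of "y + t *\<^sub>R h"] by simp
    then have "(f h - inner h y)\<^sup>2 \<le> 0"
      using h by (simp add: divide_le_0_iff)
    then show ?thesis by simp
  qed (simp add: zero)
  then show ?thesis by blast
qed

section \<open>Adjoints\<close>

lemma bounded_operators_scaleC:
  "T \<in> bounded_operators \<Longrightarrow> blinfun_apply T (c *\<^sub>C x) = c *\<^sub>C blinfun_apply T x"
  by (simp add: bounded_operators_def)

lemma scale_op_apply: "blinfun_apply (scale_op c T) x = c *\<^sub>C blinfun_apply T x"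
  unfolding scale_op_def
  by (simp add: bounded_linear_Blinfun_apply
      bounded_linear_compose[OF bounded_linear_scaleC blinfun.bounded_linear_right])

lemma bounded_operators_add:
  "S \<in> bounded_operators \<Longrightarrow> T \<in> bounded_operators \<Longrightarrow> S + T \<in> bounded_operators"
  by (simp add: bounded_operators_def blinfun.add_left scaleC_add_right)

lemma bounded_operators_diff:
  "S \<in> bounded_operators \<Longrightarrow> T \<in> bounded_operators \<Longrightarrow> S - T \<in> bounded_operators"
  by (simp add: bounded_operators_def blinfun.diff_left scaleC_diff_right)

lemma bounded_operators_scale_op:
  "T \<in> bounded_operators \<Longrightarrow> scale_op c T \<in> bounded_operators"
  by (simp add: bounded_operators_def scale_op_apply scaleC_scaleC mult.commute)

lemma bounded_operators_compose:
  "S \<in> bounded_operators \<Longrightarrow> T \<in> bounded_operators \<Longrightarrow> S o\<^sub>L T \<in> bounded_operators"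
  by (simp add: bounded_operators_def)

lemma closed_bounded_operators: "closed (bounded_operators :: ('a::complex_inner \<Rightarrow>\<^sub>L 'a) set)"
proof -
  have *: "bounded_operators = (\<Inter>c. \<Inter>x. {T :: 'a \<Rightarrow>\<^sub>L 'a. blinfun_apply T (c *\<^sub>C x) = c *\<^sub>C blinfun_apply T x})"
    by (auto simp: bounded_operators_def)
  have "closed {T :: 'a \<Rightarrow>\<^sub>L 'a. blinfun_apply T (c *\<^sub>C x) = c *\<^sub>C blinfun_apply T x}" for c x
    by (intro closed_Collect_eq continuous_intros
        bounded_linear.continuous_on[OF bounded_linear_scaleC])
  then show ?thesis unfolding * by (intro closed_INT ballI)
qed

lemma adjoint_op_unique:
  assumes "\<And>x y. cinner (blinfun_apply T x) y = cinner x (blinfun_apply S y)"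
  shows "adjoint_op T = S"
  unfolding adjoint_op_def
proof (rule the_equality)
  fix R assume R: "\<forall>x y. cinner (blinfun_apply T x) y = cinner x (blinfun_apply R y)"
  show "R = S"
    by (rule blinfun_eqI, rule cinner_right_eqI) (metis R assms)
qed (use assms in blast)

text \<open>The values of the adjoint represent the real functionals \<open>x \<mapsto> Re \<langle>T x, y\<rangle>\<close>.  They also
  represent the complex ones, because \<open>T\<close> commutes with multiplication by \<open>i\<close>.\<close>

lemma bounded_operators_adjoint_exists:
  fixes T :: "'a::{complex_inner, banach} \<Rightarrow>\<^sub>L 'a"
  assumes T: "T \<in> bounded_operators"
  shows "\<exists>S. \<forall>x y. cinner (blinfun_apply T x) y = cinner x (blinfun_apply S y)"
proof -
  have "\<exists>s. \<forall>x. inner (blinfun_apply T x) y = inner x s" for y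
    by (rule riesz_representation) (intro bounded_linear_intros)
  then obtain s where s: "inner (blinfun_apply T x) y = inner x (s y)" for x y by metis
  have cs: "cinner (blinfun_apply T x) y = cinner x (s y)" for x y
    by (rule cinner_eqI) (simp_all add: s bounded_operators_scaleC[OF T, symmetric])
  have "bounded_linear s"
  proof (rule bounded_linear_intro[where K = "norm T"])
    show "s (y + z) = s y + s z" for y z
      by (rule cinner_right_eqI) (simp add: cs[symmetric] cinner_add_right)
    show "s (r *\<^sub>R y) = r *\<^sub>R s y" for r y
      by (rule cinner_right_eqI)
        (simp add: cs[symmetric] cinner_scaleC_right scaleC_of_real[symmetric])
    show "norm (s y) \<le> norm y * norm T" for y
    proof (cases "s y = 0")
      case False
      have "(norm (s y))\<^sup>2 = inner (blinfun_apply T (s y)) y"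
        by (simp add: s power2_norm_eq_inner)
      also have "\<dots> \<le> norm (blinfun_apply T (s y)) * norm y" by (rule norm_cauchy_schwarz)
      also have "\<dots> \<le> (norm T * norm (s y)) * norm y"
        by (intro mult_right_mono norm_blinfun) simp
      finally have "norm (s y) * norm (s y) \<le> norm (s y) * (norm y * norm T)"
        by (simp add: power2_eq_square mult_ac)
      then show ?thesis using False by simp
    qed simp
  qed
  then show ?thesis
    by (intro exI[of _ "Blinfun s"]) (simp add: bounded_linear_Blinfun_apply cs)
qed

context
  fixes T :: "'a::{complex_inner, banach} \<Rightarrow>\<^sub>L 'a"
  assumes T: "T \<in> bounded_operators"
begin

lemma cinner_adjoint_op: "cinner (blinfun_apply T x) y = cinner x (blinfun_apply (adjoint_op T) y)"
  using bounded_operators_adjoint_exists[OF T] adjoint_op_unique[of T] by metis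

lemma cinner_adjoint_op': "cinner (blinfun_apply (adjoint_op T) x) y = cinner x (blinfun_apply T y)"
  by (metis cinner_commute cinner_adjoint_op)

lemma adjoint_op_adjoint_op: "adjoint_op (adjoint_op T) = T"
  by (rule adjoint_op_unique) (rule cinner_adjoint_op')

lemma bounded_operators_adjoint_op: "adjoint_op T \<in> bounded_operators"
  unfolding bounded_operators_def
proof (intro CollectI allI cinner_right_eqI)
  fix c x y
  show "cinner y (blinfun_apply (adjoint_op T) (c *\<^sub>C x)) = cinner y (c *\<^sub>C blinfun_apply (adjoint_op T) x)"
    by (simp only: cinner_adjoint_op[symmetric] cinner_scaleC_right)
qed

lemma norm_adjoint_op_le: "norm (adjoint_op T) \<le> norm T"
proof (rule norm_blinfun_bound)
  fix y
  let ?s = "blinfun_apply (adjoint_op T) y"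
  have "norm ?s * norm ?s = norm (cinner ?s ?s)"
    by (simp add: cinner_self norm_mult power2_eq_square)
  also have "\<dots> = norm (cinner (blinfun_apply T ?s) y)" by (simp add: cinner_adjoint_op)
  also have "\<dots> \<le> norm (blinfun_apply T ?s) * norm y" by (rule norm_cinner_le)
  also have "\<dots> \<le> (norm T * norm ?s) * norm y" by (intro mult_right_mono norm_blinfun) simp
  finally have "norm ?s * norm ?s \<le> norm ?s * (norm T * norm y)" by (simp add: mult_ac)
  then show "norm ?s \<le> norm T * norm y"
    by (cases "?s = 0") simp_all
qed simp

end

lemma adjoint_op_add:
  fixes S T :: "'a::{complex_inner, banach} \<Rightarrow>\<^sub>L 'a"
  assumes "S \<in> bounded_operators" "T \<in> bounded_operators"
  shows "adjoint_op (S + T) = adjoint_op S + adjoint_op T"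
  by (rule adjoint_op_unique)
    (simp add: blinfun.add_left cinner_add_left cinner_add_right cinner_adjoint_op assms)

lemma adjoint_op_diff:
  fixes S T :: "'a::{complex_inner, banach} \<Rightarrow>\<^sub>L 'a"
  assumes "S \<in> bounded_operators" "T \<in> bounded_operators"
  shows "adjoint_op (S - T) = adjoint_op S - adjoint_op T"
  by (rule adjoint_op_unique)
    (simp add: blinfun.diff_left cinner_diff_left cinner_diff_right cinner_adjoint_op assms)

lemma adjoint_op_scale_op:
  fixes T :: "'a::{complex_inner, banach} \<Rightarrow>\<^sub>L 'a"
  assumes "T \<in> bounded_operators"
  shows "adjoint_op (scale_op c T) = scale_op (cnj c) (adjoint_op T)"
  by (rule adjoint_op_unique)
    (simp add: scale_op_apply cinner_scaleC_left cinner_scaleC_right cinner_adjoint_op assms)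

lemma adjoint_op_compose:
  fixes S T :: "'a::{complex_inner, banach} \<Rightarrow>\<^sub>L 'a"
  assumes "S \<in> bounded_operators" "T \<in> bounded_operators"
  shows "adjoint_op (S o\<^sub>L T) = adjoint_op T o\<^sub>L adjoint_op S"
  by (rule adjoint_op_unique) (simp add: cinner_adjoint_op assms)

section \<open>Completeness of the Lebesgue and Hardy spaces\<close>

lemma square_integrable_rep_l2: "square_integrable (rep_l2 f)"
  using Quotient_rep_reflp[OF Quotient_l2, of f] by (simp add: l2_eq_def)

lemma abs_rep_l2: "abs_l2 (rep_l2 f) = f"
  by (rule Quotient_abs_rep[OF Quotient_l2])

lemma l2_eq_refl: "square_integrable f \<Longrightarrow> l2_eq f f"
  by (simp add: l2_eq_def)

lemma cinner_abs_l2: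
  assumes "square_integrable f" "square_integrable g"
  shows "cinner (abs_l2 f) (abs_l2 g) = (LINT z|torus_measure. f z * cnj (g z))"
  by (rule cinner_l2.abs_eq) (use assms in \<open>auto intro: l2_eq_refl\<close>)

lemma norm_abs_l2:
  assumes "square_integrable f"
  shows "(norm (abs_l2 f))\<^sup>2 = (LINT z|torus_measure. (norm (f z))\<^sup>2)"
proof -
  have "complex_of_real ((norm (abs_l2 f))\<^sup>2) = (LINT z|torus_measure. complex_of_real ((norm (f z))\<^sup>2))"
    unfolding cinner_self[symmetric] cinner_abs_l2[OF assms assms]
    by (simp add: complex_norm_square[symmetric])
  also have "\<dots> = complex_of_real (LINT z|torus_measure. (norm (f z))\<^sup>2)"
    by (rule integral_complex_of_real)
  finally show ?thesis by (simp only: of_real_eq_iff)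
qed

lemma square_integrable_diff:
  assumes "square_integrable f" "square_integrable g"
  shows "square_integrable (\<lambda>z. f z - g z)"
  using square_integrable_add[OF assms(1) square_integrable_scale[OF assms(2), of "- 1"]] by simp

lemma abs_l2_diff:
  assumes "square_integrable f" "square_integrable g"
  shows "abs_l2 f - abs_l2 g = abs_l2 (\<lambda>z. f z - g z)"
proof -
  have "square_integrable (\<lambda>z. - g z)"
    using square_integrable_scale[OF assms(2), of "- 1"] by simp
  then show ?thesis
    unfolding minus_l2_def uminus_l2_def
    by (simp add: scaleC_l2.abs_eq plus_l2.abs_eq l2_eq_refl assms)
qed

lemma norm_diff_l2:
  "(norm (f - g))\<^sup>2 = (LINT z|torus_measure. (norm (rep_l2 f z - rep_l2 g z))\<^sup>2)"
  using norm_abs_l2[OF square_integrable_diff[OF square_integrable_rep_l2[of f] square_integrable_rep_l2[of g]]]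
    abs_l2_diff[OF square_integrable_rep_l2[of f] square_integrable_rep_l2[of g]]
  by (simp add: abs_rep_l2)

text \<open>The Cauchy--Schwarz inequality against the constant function one, which has norm one on
  a probability space.\<close>

lemma L1_norm_le_L2_norm:
  fixes f g :: "'n::finite l2"
  shows "(LINT z|torus_measure. norm (rep_l2 f z - rep_l2 g z)) \<le> norm (f - g)" (is "?I \<le> _")
    and "integrable torus_measure (\<lambda>z. norm (rep_l2 f z - rep_l2 g z))"
proof -
  let ?h = "\<lambda>z. rep_l2 f z - rep_l2 g z"
  let ?d = "\<lambda>z. complex_of_real (norm (?h z))" and ?one = "\<lambda>_ :: 'n \<Rightarrow> complex. 1 :: complex"
  have h: "square_integrable ?h"
    by (intro square_integrable_diff square_integrable_rep_l2)
  note [measurable] = square_integrable_measurable[OF h]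
  have d: "square_integrable ?d"
    using h by (simp add: square_integrable_def borel_measurable_of_real borel_measurable_norm)
  interpret prob_space "torus_measure :: ('n \<Rightarrow> complex) measure" by (rule prob_space_torus)
  have one: "square_integrable ?one" by (simp add: square_integrable_def)
  show "integrable torus_measure (\<lambda>z. norm (?h z))"
    using integrable_norm[OF integrable_mult_cnj[OF d one]] by simp
  have norm_d: "norm (abs_l2 ?d) = norm (f - g)"
    by (rule power2_eq_imp_eq) (simp_all add: norm_diff_l2 norm_abs_l2[OF d])
  have norm_one: "norm (abs_l2 ?one) = 1"
    by (rule power2_eq_imp_eq) (simp_all add: norm_abs_l2[OF one] prob_space)
  have "cinner (abs_l2 ?d) (abs_l2 ?one) = complex_of_real ?I"
    by (simp add: cinner_abs_l2[OF d one])
  moreover have "?I \<ge> 0" by simp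
  ultimately show "?I \<le> norm (f - g)"
    using norm_cinner_le[of "abs_l2 ?d" "abs_l2 ?one"] by (simp add: norm_d norm_one)
qed

text \<open>The Riesz--Fischer argument: along a subsequence with geometrically decreasing steps the
  increments are absolutely summable almost everywhere, since their \<open>L\<^sup>1\<close> norms are summable;
  Fatou's lemma turns the pointwise limit into a limit in norm.\<close>

instance l2 :: (finite) banach
proof
  fix X :: "nat \<Rightarrow> 'a l2"
  assume X: "Cauchy X"
  let ?M = "torus_measure :: ('a \<Rightarrow> complex) measure"
  have "\<exists>s. strict_mono s \<and> (\<forall>k. norm (X (s (Suc k)) - X (s k)) < (1 / 2) ^ k)"
  proof -
    have "\<exists>N. \<forall>i\<ge>N. \<forall>j\<ge>N. norm (X i - X j) < (1 / 2) ^ k" for k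
      using X[unfolded Cauchy_def dist_norm] by simp
    then obtain N where N: "norm (X i - X j) < (1 / 2) ^ k" if "i \<ge> N k" "j \<ge> N k" for i j k
      by metis
    have "\<exists>s. \<forall>k. N k \<le> s k \<and> s k < s (Suc k)"
    proof (rule dependent_nat_choice)
      fix x k
      show "\<exists>y. N (Suc k) \<le> y \<and> x < y" by (rule exI[of _ "max (N (Suc k)) (Suc x)"]) auto
    qed auto
    then obtain s where s: "N k \<le> s k" "s k < s (Suc k)" for k by blast
    have "norm (X (s (Suc k)) - X (s k)) < (1 / 2) ^ k" for k
      using s[of k] by (intro N) auto
    then show ?thesis using s by (auto simp: strict_mono_Suc_iff)
  qed
  then obtain s where s: "strict_mono s" and step: "norm (X (s (Suc k)) - X (s k)) < (1 / 2) ^ k" for k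
    by blast
  define f where "f k = rep_l2 (X (s k))" for k
  have f: "square_integrable (f k)" for k by (simp add: f_def square_integrable_rep_l2)
  note [measurable] = f[THEN square_integrable_measurable]
  have norm_f: "(norm (X (s j) - X (s k)))\<^sup>2 = (LINT z|?M. (norm (f j z - f k z))\<^sup>2)" for j k
    by (simp add: f_def norm_diff_l2)
  have "AE z in ?M. (\<Sum>k. ennreal (norm (f (Suc k) z - f k z))) \<noteq> \<infinity>"
  proof (rule nn_integral_noteq_infinite)
    have "(\<integral>\<^sup>+z. (\<Sum>k. ennreal (norm (f (Suc k) z - f k z))) \<partial>?M)
        = (\<Sum>k. \<integral>\<^sup>+z. ennreal (norm (f (Suc k) z - f k z)) \<partial>?M)"
      by (intro nn_integral_suminf) auto
    also have "\<dots> \<le> (\<Sum>k. ennreal ((1 / 2) ^ k))"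
    proof (intro suminf_le)
      fix k
      have "(\<integral>\<^sup>+z. ennreal (norm (f (Suc k) z - f k z)) \<partial>?M)
          = ennreal (LINT z|?M. norm (f (Suc k) z - f k z))"
        unfolding f_def by (intro nn_integral_eq_integral L1_norm_le_L2_norm) auto
      also have "\<dots> \<le> ennreal ((1 / 2) ^ k)"
        unfolding f_def using L1_norm_le_L2_norm(1)[of "X (s (Suc k))" "X (s k)"] step[of k]
        by (intro ennreal_leI) linarith
      finally show "(\<integral>\<^sup>+z. ennreal (norm (f (Suc k) z - f k z)) \<partial>?M) \<le> ennreal ((1 / 2) ^ k)" .
    qed auto
    also have "\<dots> = ennreal (\<Sum>k. (1 / 2) ^ k)"
      by (rule suminf_ennreal2) (auto intro: summable_geometric)
    also have "\<dots> < \<infinity>" by simp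
    finally show "(\<integral>\<^sup>+z. (\<Sum>k. ennreal (norm (f (Suc k) z - f k z))) \<partial>?M) \<noteq> \<infinity>" by simp
  qed measurable
  then have conv: "AE z in ?M. (\<lambda>k. f k z) \<longlonglongrightarrow> lim (\<lambda>k. f k z)"
  proof eventually_elim
    case (elim z)
    have "summable (\<lambda>k. norm (f (Suc k) z - f k z))"
      by (rule summable_suminf_not_top) (use elim in auto)
    then have "summable (\<lambda>k. f (Suc k) z - f k z)" by (rule summable_norm_cancel)
    then have "convergent (\<lambda>n. \<Sum>k<n. f (Suc k) z - f k z)" by (simp add: summable_iff_convergent)
    then have "convergent (\<lambda>n. f n z - f 0 z)" by (simp add: sum_lessThan_telescope[of "\<lambda>n. f n z"])
    then have "convergent (\<lambda>n. f n z)" by (simp add: convergent_diff_const_right_iff)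
    then show ?case by (simp add: convergent_LIMSEQ_iff)
  qed
  define g where "g z = lim (\<lambda>k. f k z)" for z
  have g[measurable]: "g \<in> borel_measurable ?M" unfolding g_def by measurable
  \<comment> \<open>The measurability of \<open>g\<close> is known, its square integrability only follows from this bound;
     hence the formulation with extended nonnegative integrals.\<close>
  have fatou: "(\<integral>\<^sup>+z. ennreal ((norm (f k z - g z))\<^sup>2) \<partial>?M) \<le> ennreal (e\<^sup>2)"
    if "0 \<le> e" and le: "\<And>j. j \<ge> k \<Longrightarrow> norm (X (s k) - X (s j)) \<le> e" for k e
  proof -
    have "(\<integral>\<^sup>+z. ennreal ((norm (f k z - g z))\<^sup>2) \<partial>?M)
        = (\<integral>\<^sup>+z. liminf (\<lambda>j. ennreal ((norm (f k z - f j z))\<^sup>2)) \<partial>?M)"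
    proof (intro nn_integral_cong_AE, use conv in eventually_elim)
      case (elim z)
      have "(\<lambda>j. ennreal ((norm (f k z - f j z))\<^sup>2)) \<longlonglongrightarrow> ennreal ((norm (f k z - g z))\<^sup>2)"
        using elim unfolding g_def by (intro tendsto_intros)
      then show ?case by (rule lim_imp_Liminf[symmetric, rotated]) simp
    qed
    also have "\<dots> \<le> liminf (\<lambda>j. \<integral>\<^sup>+z. ennreal ((norm (f k z - f j z))\<^sup>2) \<partial>?M)"
      by (rule nn_integral_liminf) measurable
    also have "\<dots> \<le> limsup (\<lambda>j. \<integral>\<^sup>+z. ennreal ((norm (f k z - f j z))\<^sup>2) \<partial>?M)"
      by (rule Liminf_le_Limsup) simp
    also have "\<dots> \<le> ennreal (e\<^sup>2)"
    proof (rule Limsup_bounded, rule eventually_sequentiallyI[of k])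
      fix j assume "k \<le> j"
      have "integrable ?M (\<lambda>z. (norm (f k z - f j z))\<^sup>2)"
        using square_integrable_diff[OF f f] by (simp add: square_integrable_def)
      then have "(\<integral>\<^sup>+z. ennreal ((norm (f k z - f j z))\<^sup>2) \<partial>?M)
          = ennreal ((norm (X (s k) - X (s j)))\<^sup>2)"
        unfolding norm_f by (intro nn_integral_eq_integral) auto
      also have "\<dots> \<le> ennreal (e\<^sup>2)"
        using le[OF \<open>k \<le> j\<close>] by (intro ennreal_leI power_mono) auto
      finally show "(\<integral>\<^sup>+z. ennreal ((norm (f k z - f j z))\<^sup>2) \<partial>?M) \<le> ennreal (e\<^sup>2)" .
    qed
    finally show ?thesis .
  qed
  have tail: "\<exists>N. \<forall>k\<ge>N. \<forall>j\<ge>k. norm (X (s k) - X (s j)) \<le> e" if e: "e > 0" for e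
  proof -
    obtain N where "\<forall>i\<ge>N. \<forall>j\<ge>N. norm (X i - X j) < e"
      using X[unfolded Cauchy_def dist_norm, rule_format, OF e] by blast
    then have "norm (X (s k) - X (s j)) \<le> e" if "k \<ge> N" "j \<ge> k" for k j
      using that seq_suble[OF s, of k] seq_suble[OF s, of j] by (meson le_trans less_imp_le)
    then show ?thesis by blast
  qed
  have diff: "square_integrable (\<lambda>z. f k z - g z)"
    if "\<And>j. j \<ge> k \<Longrightarrow> norm (X (s k) - X (s j)) \<le> 1" for k
    unfolding square_integrable_def integrable_iff_bounded
    using le_less_trans[OF fatou[of 1 k, OF _ that]] by simp
  obtain K where K: "square_integrable (\<lambda>z. f K z - g z)"
    using tail[of 1] diff by force
  have sq: "square_integrable g"
    using square_integrable_diff[OF f[of K] K] by simp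
  have "(X \<circ> s) \<longlonglongrightarrow> abs_l2 g"
  proof (rule LIMSEQ_I)
    fix e :: real assume "0 < e"
    then obtain N where N: "norm (X (s k) - X (s j)) \<le> e / 2" if "N \<le> k" "k \<le> j" for k j
      using tail[of "e / 2"] by auto
    have "norm (X (s k) - abs_l2 g) < e" if "N \<le> k" for k
    proof -
      have "X (s k) - abs_l2 g = abs_l2 (\<lambda>z. f k z - g z)"
        using abs_l2_diff[OF f[of k] sq] by (simp add: f_def abs_rep_l2)
      then have "ennreal ((norm (X (s k) - abs_l2 g))\<^sup>2) = (\<integral>\<^sup>+z. ennreal ((norm (f k z - g z))\<^sup>2) \<partial>?M)"
        using square_integrable_diff[OF f[of k] sq]
        by (simp add: norm_abs_l2 nn_integral_eq_integral square_integrable_def)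
      also have "\<dots> \<le> ennreal ((e / 2)\<^sup>2)"
        using \<open>0 < e\<close> N that by (intro fatou) auto
      finally have "(norm (X (s k) - abs_l2 g))\<^sup>2 \<le> (e / 2)\<^sup>2" by simp
      then have "norm (X (s k) - abs_l2 g) \<le> e / 2"
        by (rule power2_le_imp_le) (use \<open>0 < e\<close> in simp)
      then show ?thesis using \<open>0 < e\<close> by simp
    qed
    then show "\<exists>N. \<forall>k\<ge>N. norm ((X \<circ> s) k - abs_l2 g) < e" by auto
  qed
  then have "X \<longlonglongrightarrow> abs_l2 g"
    using Cauchy_converges_subseq[OF X s] by simp
  then show "convergent X" by (rule convergentI)
qed

lemma fourier_coeff_eq_cinner: "fourier_coeff f \<alpha> = cinner f (abs_l2 (torus_monomial \<alpha>))"
  using cinner_abs_l2[OF square_integrable_rep_l2 square_integrable_monomial, of f \<alpha>]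
    fourier_coeff.abs_eq[OF l2_eq_refl[OF square_integrable_rep_l2[of f]]]
  by (simp add: abs_rep_l2)

lemma norm_l2_of_h2: "norm (l2_of_h2 f) = norm f"
  by (simp add: norm_h2.rep_eq)

text \<open>The Hardy space is closed: its defining conditions are orthogonality to monomials.\<close>

instance h2 :: (finite) banach
proof
  fix X :: "nat \<Rightarrow> 'a h2"
  assume "Cauchy X"
  then have "Cauchy (\<lambda>n. l2_of_h2 (X n))"
    by (simp add: Cauchy_def dist_h2.rep_eq)
  then obtain f where f: "(\<lambda>n. l2_of_h2 (X n)) \<longlonglongrightarrow> f"
    using Cauchy_convergent convergent_def by blast
  have "fourier_coeff f \<alpha> = 0" if "\<exists>j. \<alpha> j < 0" for \<alpha>
  proof -
    have "cinner (l2_of_h2 (X n)) (abs_l2 (torus_monomial \<alpha>)) = 0" for n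
      using l2_of_h2[of "X n"] that by (simp add: fourier_coeff_eq_cinner)
    then have "norm (cinner f (abs_l2 (torus_monomial \<alpha>)))
        \<le> norm (l2_of_h2 (X n) - f) * norm (abs_l2 (torus_monomial \<alpha>))" for n
      using norm_cinner_le[of "l2_of_h2 (X n) - f" "abs_l2 (torus_monomial \<alpha>)"]
      by (simp add: cinner_diff_left)
    moreover have "(\<lambda>n. norm (l2_of_h2 (X n) - f) * norm (abs_l2 (torus_monomial \<alpha>))) \<longlonglongrightarrow> 0"
      using f by (intro tendsto_mult_left_zero tendsto_norm_zero LIM_zero)
    ultimately have "norm (cinner f (abs_l2 (torus_monomial \<alpha>))) \<le> 0"
      by (intro LIMSEQ_le_const) auto
    then show ?thesis by (simp add: fourier_coeff_eq_cinner)
  qed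
  then have "l2_of_h2 (h2_of_l2 f) = f" by (intro h2_of_l2_inverse) auto
  then have "X \<longlonglongrightarrow> h2_of_l2 f"
    using f by (simp add: tendsto_iff dist_h2.rep_eq)
  then show "convergent X" by (rule convergentI)
qed

section \<open>Toeplitz operators\<close>

lemma essentially_bounded_rep_linf: "essentially_bounded (rep_linf \<phi>)"
  using Quotient_rep_reflp[OF Quotient_linf, of \<phi>] by (simp add: linf_eq_def)

lemma abs_rep_linf: "abs_linf (rep_linf \<phi>) = \<phi>"
  by (rule Quotient_abs_rep[OF Quotient_linf])

lemma linf_eq_refl: "essentially_bounded f \<Longrightarrow> linf_eq f f"
  by (simp add: linf_eq_def)

lemma rep_abs_linf_AE: "essentially_bounded f \<Longrightarrow> AE z in torus_measure. rep_linf (abs_linf f) z = f z"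
  using Quotient_rep_abs[OF Quotient_linf linf_eq_refl, of f] by (simp add: linf_eq_def)

lemma linf_eqI:
  assumes "AE z in torus_measure. rep_linf \<phi> z = rep_linf \<eta> z"
  shows "\<phi> = \<eta>"
  using assms Quotient_rel_rep[OF Quotient_linf, of \<phi> \<eta>]
  by (simp add: linf_eq_def essentially_bounded_rep_linf)

lemma rep_linf_measurable [measurable]: "rep_linf \<phi> \<in> borel_measurable torus_measure"
  using essentially_bounded_rep_linf[of \<phi>] by (simp add: essentially_bounded_def)

lemma rep_linf_add: "AE z in torus_measure. rep_linf (\<phi> + \<eta>) z = rep_linf \<phi> z + rep_linf \<eta> z"
  using rep_abs_linf_AE[OF essentially_bounded_add[OF essentially_bounded_rep_linf[of \<phi>] essentially_bounded_rep_linf[of \<eta>]]]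
    plus_linf.abs_eq[OF linf_eq_refl[OF essentially_bounded_rep_linf[of \<phi>]] linf_eq_refl[OF essentially_bounded_rep_linf[of \<eta>]]]
  by (simp add: abs_rep_linf)

lemma rep_linf_mult: "AE z in torus_measure. rep_linf (\<phi> * \<eta>) z = rep_linf \<phi> z * rep_linf \<eta> z"
  using rep_abs_linf_AE[OF essentially_bounded_mult[OF essentially_bounded_rep_linf[of \<phi>] essentially_bounded_rep_linf[of \<eta>]]]
    times_linf.abs_eq[OF linf_eq_refl[OF essentially_bounded_rep_linf[of \<phi>]] linf_eq_refl[OF essentially_bounded_rep_linf[of \<eta>]]]
  by (simp add: abs_rep_linf)

lemma rep_linf_cnj: "AE z in torus_measure. rep_linf (cnj_linf \<phi>) z = cnj (rep_linf \<phi> z)"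
  using rep_abs_linf_AE[OF essentially_bounded_cnj[OF essentially_bounded_rep_linf[of \<phi>]]]
    cnj_linf.abs_eq[OF linf_eq_refl[OF essentially_bounded_rep_linf[of \<phi>]]]
  by (simp add: abs_rep_linf)

lemma rep_linf_zero: "AE z in torus_measure. rep_linf 0 z = 0"
  using rep_abs_linf_AE[OF essentially_bounded_const[of 0]] by (simp add: zero_linf.abs_eq)

lemma rep_linf_uminus: "AE z in torus_measure. rep_linf (- \<phi>) z = - rep_linf \<phi> z"
  using rep_linf_add[of \<phi> "- \<phi>"] rep_linf_zero
  by eventually_elim (simp add: eq_neg_iff_add_eq_0 add.commute)

lemma rep_linf_const: "AE z in torus_measure. rep_linf (const_linf c) z = c"
  using rep_abs_linf_AE[OF essentially_bounded_const[of c]] by (simp add: const_linf.abs_eq)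

lemma mult_l2_eq:
  "mult_l2 \<phi> f = abs_l2 (\<lambda>z. rep_linf \<phi> z * rep_l2 f z)"
  using mult_l2.abs_eq[OF linf_eq_refl[OF essentially_bounded_rep_linf[of \<phi>]] l2_eq_refl[OF square_integrable_rep_l2[of f]]]
  by (simp add: abs_rep_linf abs_rep_l2)

lemma mult_l2_abs:
  assumes "square_integrable f"
  shows "mult_l2 \<phi> (abs_l2 f) = abs_l2 (\<lambda>z. rep_linf \<phi> z * f z)"
  using mult_l2.abs_eq[OF linf_eq_refl[OF essentially_bounded_rep_linf[of \<phi>]] l2_eq_refl[OF assms]]
  by (simp add: abs_rep_linf)

lemma cinner_mult_l2:
  "cinner (mult_l2 \<phi> f) g = (LINT z|torus_measure. rep_linf \<phi> z * rep_l2 f z * cnj (rep_l2 g z))"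
proof -
  have "cinner (mult_l2 \<phi> f) (abs_l2 (rep_l2 g))
      = (LINT z|torus_measure. rep_linf \<phi> z * rep_l2 f z * cnj (rep_l2 g z))"
    unfolding mult_l2_eq
    by (intro cinner_abs_l2 square_integrable_bounded_mult essentially_bounded_rep_linf
        square_integrable_rep_l2)
  then show ?thesis by (simp add: abs_rep_l2)
qed

lemma cinner_mult_l2_cnj: "cinner (mult_l2 \<phi> f) g = cinner f (mult_l2 (cnj_linf \<phi>) g)"
proof -
  note [measurable] = square_integrable_rep_l2[THEN square_integrable_measurable]
  have "cinner (mult_l2 (cnj_linf \<phi>) g) f
      = (LINT z|torus_measure. cnj (rep_linf \<phi> z) * rep_l2 g z * cnj (rep_l2 f z))"
    unfolding cinner_mult_l2
    by (intro integral_cong_AE) (use rep_linf_cnj[of \<phi>] in auto)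
  also have "\<dots> = cnj (cinner (mult_l2 \<phi> f) g)"
    unfolding cinner_mult_l2 by (simp add: mult_ac flip: Bochner_Integration.integral_cnj)
  finally show ?thesis by (metis cinner_commute complex_cnj_cnj)
qed

lemma mult_l2_add: "mult_l2 \<phi> (f + g) = mult_l2 \<phi> f + mult_l2 \<phi> g"
  by (rule cinner_left_eqI) (simp add: cinner_mult_l2_cnj cinner_add_left)

lemma mult_l2_scaleC: "mult_l2 \<phi> (c *\<^sub>C f) = c *\<^sub>C mult_l2 \<phi> f"
  by (rule cinner_left_eqI) (simp add: cinner_mult_l2_cnj cinner_scaleC_left)

lemma norm_mult_l2_le:
  assumes C: "AE z in torus_measure. norm (rep_linf \<phi> z) \<le> C" and "0 \<le> C"
  shows "norm (mult_l2 \<phi> f) \<le> C * norm f"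
proof (rule power2_le_imp_le)
  have f: "square_integrable (rep_l2 f)" by (rule square_integrable_rep_l2)
  have \<phi>f: "square_integrable (\<lambda>z. rep_linf \<phi> z * rep_l2 f z)"
    by (intro square_integrable_bounded_mult essentially_bounded_rep_linf f)
  have "(norm (mult_l2 \<phi> f))\<^sup>2 = (LINT z|torus_measure. (norm (rep_linf \<phi> z * rep_l2 f z))\<^sup>2)"
    unfolding mult_l2_eq by (rule norm_abs_l2[OF \<phi>f])
  also have "\<dots> \<le> (LINT z|torus_measure. C\<^sup>2 * (norm (rep_l2 f z))\<^sup>2)"
  proof (rule integral_mono_AE)
    show "AE z in torus_measure. (norm (rep_linf \<phi> z * rep_l2 f z))\<^sup>2 \<le> C\<^sup>2 * (norm (rep_l2 f z))\<^sup>2"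
      using C by eventually_elim
        (auto simp: norm_mult power_mult_distrib intro!: mult_right_mono power_mono)
  qed (use f \<phi>f in \<open>auto simp: square_integrable_def\<close>)
  also have "\<dots> = (C * norm f)\<^sup>2"
    using norm_abs_l2[OF f] by (simp add: abs_rep_l2 power_mult_distrib)
  finally show "(norm (mult_l2 \<phi> f))\<^sup>2 \<le> (C * norm f)\<^sup>2" .
qed (use \<open>0 \<le> C\<close> in simp)

lemma bounded_linear_l2_of_h2: "bounded_linear l2_of_h2"
  by (rule bounded_linear_intro[where K = 1])
    (simp_all add: plus_h2.rep_eq scaleR_h2.rep_eq norm_l2_of_h2)

lemma cinner_l2_of_h2: "cinner (l2_of_h2 f) (l2_of_h2 g) = cinner f g"
  by (simp add: cinner_h2.rep_eq)

text \<open>The projection of \<open>f\<close> is the vector of the Hardy space that represents the functional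
  \<open>g \<mapsto> \<langle>g, f\<rangle>\<close> there.\<close>

lemma cinner_proj_h2: "cinner (proj_h2 f) g = cinner f (l2_of_h2 g)"
proof -
  have "\<exists>h. \<forall>g. inner f (l2_of_h2 g) = inner g h"
    by (rule riesz_representation)
      (rule bounded_linear_compose[OF bounded_linear_inner_right bounded_linear_l2_of_h2])
  then obtain h where h: "inner f (l2_of_h2 g) = inner h g" for g
    by (auto simp: inner_commute)
  have "cinner f (l2_of_h2 g) = cinner h g" for g
  proof -
    have "cinner (l2_of_h2 g) f = cinner g h"
      by (rule complex_eqI) (simp_all add: h inner_commute Im_cinner inner_eq_Re_cinner[symmetric]
          scaleC_h2.rep_eq[symmetric])
    then show ?thesis by (metis cinner_commute)
  qed
  then have h: "\<forall>g. cinner (f - l2_of_h2 h) (l2_of_h2 g) = 0"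
    by (simp add: cinner_diff_left cinner_l2_of_h2)
  have "\<forall>g. cinner (f - l2_of_h2 (proj_h2 f)) (l2_of_h2 g) = 0"
    unfolding proj_h2_def
  proof (rule theI[where a = h])
    show "\<forall>g. cinner (f - l2_of_h2 h) (l2_of_h2 g) = 0" by (rule h)
    fix k assume k: "\<forall>g. cinner (f - l2_of_h2 k) (l2_of_h2 g) = 0"
    have "cinner k g = cinner h g" for g
      using h[rule_format, of g] k[rule_format, of g] by (simp add: cinner_diff_left cinner_l2_of_h2)
    then show "k = h" by (rule cinner_left_eqI)
  qed
  then show ?thesis by (simp add: cinner_diff_left cinner_l2_of_h2)
qed

lemma proj_h2_add: "proj_h2 (f + g) = proj_h2 f + proj_h2 g"
  by (rule cinner_left_eqI) (simp add: cinner_proj_h2 cinner_add_left)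

lemma proj_h2_diff: "proj_h2 (f - g) = proj_h2 f - proj_h2 g"
  by (rule cinner_left_eqI) (simp add: cinner_proj_h2 cinner_diff_left)

lemma proj_h2_scaleC: "proj_h2 (c *\<^sub>C f) = c *\<^sub>C proj_h2 f"
  by (rule cinner_left_eqI) (simp add: cinner_proj_h2 cinner_scaleC_left)

lemma proj_h2_l2_of_h2: "proj_h2 (l2_of_h2 f) = f"
  by (rule cinner_left_eqI) (simp add: cinner_proj_h2 cinner_l2_of_h2)

lemma norm_proj_h2_le: "norm (proj_h2 f) \<le> norm f"
proof -
  have "norm (proj_h2 f) * norm (proj_h2 f) = norm (cinner f (l2_of_h2 (proj_h2 f)))"
    by (simp add: cinner_proj_h2[symmetric] cinner_self norm_mult power2_eq_square)
  also have "\<dots> \<le> norm f * norm (proj_h2 f)"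
    using norm_cinner_le[of f "l2_of_h2 (proj_h2 f)"] by (simp add: norm_l2_of_h2)
  finally show ?thesis by (cases "proj_h2 f = 0") simp_all
qed

lemma toeplitz_apply: "blinfun_apply (toeplitz \<phi>) f = proj_h2 (mult_l2 \<phi> (l2_of_h2 f))"
proof -
  obtain C where C: "AE z in torus_measure. norm (rep_linf \<phi> z) \<le> C"
    using essentially_bounded_rep_linf[of \<phi>] by (auto simp: essentially_bounded_def)
  then have C': "AE z in torus_measure. norm (rep_linf \<phi> z) \<le> \<bar>C\<bar>" by eventually_elim simp
  have "bounded_linear (\<lambda>f. proj_h2 (mult_l2 \<phi> (l2_of_h2 f)))"
  proof (rule bounded_linear_intro)
    show "proj_h2 (mult_l2 \<phi> (l2_of_h2 (f + g)))
        = proj_h2 (mult_l2 \<phi> (l2_of_h2 f)) + proj_h2 (mult_l2 \<phi> (l2_of_h2 g))" for f g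
      by (simp add: plus_h2.rep_eq mult_l2_add proj_h2_add)
    show "proj_h2 (mult_l2 \<phi> (l2_of_h2 (r *\<^sub>R f))) = r *\<^sub>R proj_h2 (mult_l2 \<phi> (l2_of_h2 f))" for r f
      by (simp add: scaleC_of_real[symmetric] scaleC_h2.rep_eq mult_l2_scaleC proj_h2_scaleC)
    show "norm (proj_h2 (mult_l2 \<phi> (l2_of_h2 f))) \<le> norm f * \<bar>C\<bar>" for f
      using norm_proj_h2_le[of "mult_l2 \<phi> (l2_of_h2 f)"] norm_mult_l2_le[OF C', of "l2_of_h2 f"]
      by (simp add: norm_l2_of_h2 mult.commute)
  qed
  then show ?thesis by (simp add: toeplitz_def bounded_linear_Blinfun_apply)
qed

lemma bounded_operators_toeplitz: "toeplitz \<phi> \<in> bounded_operators"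
  by (simp add: bounded_operators_def toeplitz_apply scaleC_h2.rep_eq mult_l2_scaleC proj_h2_scaleC)

lemma adjoint_op_toeplitz: "adjoint_op (toeplitz \<phi>) = toeplitz (cnj_linf \<phi>)"
proof (rule adjoint_op_unique)
  fix f g :: "'a h2"
  have "cinner f (blinfun_apply (toeplitz (cnj_linf \<phi>)) g) = cinner (l2_of_h2 f) (mult_l2 (cnj_linf \<phi>) (l2_of_h2 g))"
    by (metis cinner_commute cinner_proj_h2 toeplitz_apply)
  then show "cinner (blinfun_apply (toeplitz \<phi>) f) g = cinner f (blinfun_apply (toeplitz (cnj_linf \<phi>)) g)"
    by (simp add: toeplitz_apply cinner_proj_h2 cinner_mult_l2_cnj)
qed

section \<open>Reproducing kernels and the Poisson kernel\<close>

lemma space_circle_measure: "space circle_measure = sphere 0 1"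
  by (simp add: circle_measure_def space_restrict_space)

lemma sets_circle_measure: "sets circle_measure = sets (restrict_space borel (sphere 0 1))"
  by (simp add: circle_measure_def)

lemma measurable_circle:
  "f \<in> borel_measurable borel \<Longrightarrow> f \<in> borel_measurable circle_measure"
  by (simp add: circle_measure_def measurable_restrict_space1)

lemma norm_circle: "w \<in> space circle_measure \<Longrightarrow> norm w = 1"
  by (simp add: space_circle_measure)

lemma measurable_cis_circle:
  "cis \<in> measurable (uniform_measure lborel {0..<2 * pi}) (restrict_space borel (sphere 0 1))"
proof (rule measurable_restrict_space2)
  have "cis \<in> borel_measurable borel"
    by (intro borel_measurable_continuous_onI continuous_on_cis continuous_on_id)
  then show "cis \<in> borel_measurable (uniform_measure lborel {0..<2 * pi})"
    by (simp add: uniform_measure_def)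
qed simp

lemma integrable_circle_bounded:
  fixes f :: "complex \<Rightarrow> 'b::{banach, second_countable_topology}"
  assumes "f \<in> borel_measurable borel" "\<And>w. norm w = 1 \<Longrightarrow> norm (f w) \<le> B"
  shows "integrable circle_measure f"
proof -
  interpret prob_space circle_measure by (rule prob_space_circle)
  show ?thesis
    using assms by (intro integrable_const_bound[where B = B] AE_I2) (auto simp: norm_circle measurable_circle)
qed

lemma circle_integral_power: "(LINT w|circle_measure. w ^ m) = (if m = 0 then 1 else 0)"
proof (cases "m = 0")
  case True
  then show ?thesis using prob_space.prob_space[OF prob_space_circle] by simp
next
  case False
  have uniform: "uniform_measure lborel {0..<2 * pi}
      = density lborel (\<lambda>x. ennreal (indicator {0..<2 * pi} x / (2 * pi)))"
    unfolding uniform_measure_def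
    by (rule arg_cong[where f = "density lborel"])
      (use divide_ennreal[of 1 "2 * pi"] in \<open>auto simp: fun_eq_iff indicator_def\<close>)
  have [measurable]: "cis \<in> borel_measurable borel"
    by (intro borel_measurable_continuous_onI continuous_on_cis continuous_on_id)
  define F where "F x = inverse (\<i> * of_nat m) * cis (real m * x)" for x
  have deriv: "(F has_vector_derivative cis x ^ m) (at x within {0..2 * pi})" for x
  proof -
    have "((\<lambda>x. cis (real m * x)) has_derivative (\<lambda>t. (real m * t) *\<^sub>R (\<i> * cis (real m * x))))
        (at x within {0..2 * pi})"
      by (auto intro!: derivative_eq_intros)
    then have "(F has_derivative (\<lambda>t. inverse (\<i> * of_nat m) * ((real m * t) *\<^sub>R (\<i> * cis (real m * x)))))
        (at x within {0..2 * pi})"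
      unfolding F_def by (rule has_derivative_mult_right)
    moreover have "inverse (\<i> * of_nat m) * ((real m * t) *\<^sub>R (\<i> * cis (real m * x))) = t *\<^sub>R (cis x ^ m)" for t
      using False by (simp add: scaleR_conv_of_real Complex.DeMoivre field_simps)
    ultimately show ?thesis by (simp add: has_vector_derivative_def)
  qed
  have "has_bochner_integral lborel (\<lambda>x. indicator {0..2 * pi} x *\<^sub>R cis x ^ m) (F (2 * pi) - F 0)"
    by (rule has_bochner_integral_FTC_Icc)
      (auto intro!: deriv continuous_intros)
  moreover have "F (2 * pi) - F 0 = 0"
    using cis_multiple_2pi[of "real m"] by (simp add: F_def mult_ac)
  ultimately have "(LINT x|lborel. indicator {0..2 * pi} x *\<^sub>R cis x ^ m) = 0"
    by (simp add: has_bochner_integral_integral_eq)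
  moreover have "(LINT x|lborel. indicator {0..2 * pi} x *\<^sub>R cis x ^ m)
      = (LINT x|lborel. indicator {0..<2 * pi} x *\<^sub>R cis x ^ m)"
  proof (rule integral_cong_AE)
    show "AE x in lborel. indicator {0..2 * pi} x *\<^sub>R cis x ^ m = indicator {0..<2 * pi} x *\<^sub>R cis x ^ m"
      using AE_lborel_singleton[of "2 * pi"] by eventually_elim (auto simp: indicator_def)
  qed measurable
  ultimately have zero: "(LINT x|lborel. indicator {0..<2 * pi} x *\<^sub>R cis x ^ m) = 0" by simp
  have "(LINT w|circle_measure. w ^ m) = (LINT x|uniform_measure lborel {0..<2 * pi}. cis x ^ m)"
    unfolding circle_measure_def
    by (rule integral_distr[OF measurable_cis_circle]) (simp add: measurable_restrict_space1)
  also have "\<dots> = (LINT x|lborel. (indicator {0..<2 * pi} x / (2 * pi)) *\<^sub>R cis x ^ m)"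
    unfolding uniform
    by (rule integral_density) auto
  also have "\<dots> = (LINT x|lborel. (1 / (2 * pi)) *\<^sub>R (indicator {0..<2 * pi} x *\<^sub>R cis x ^ m))"
    by simp
  also have "\<dots> = 0"
    using zero by (simp only: integral_scaleR_right scaleR_zero_right)
  finally show ?thesis using False by simp
qed

lemma norm_one_minus_mult_ge:
  fixes a w :: complex
  assumes "norm w = 1"
  shows "1 - norm a \<le> norm (1 - a * w)"
  using norm_triangle_ineq2[of 1 "a * w"] assms by (simp add: norm_mult)

text \<open>The moments satisfy \<open>J m = [m = 0] + a J (m + 1)\<close> because
  \<open>w\<^sup>m = w\<^sup>m / (1 - a w) - a w\<^sup>m\<^sup>+\<^sup>1 / (1 - a w)\<close>; iterating, \<open>J m = a\<^sup>N J (m + N)\<close>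
  for \<open>m > 0\<close>, and the moments are bounded.\<close>

lemma circle_integral_geometric:
  fixes a :: complex
  assumes "norm a < 1"
  shows "(LINT w|circle_measure. w ^ m / (1 - a * w)) = (if m = 0 then 1 else 0)"
proof -
  interpret prob_space circle_measure by (rule prob_space_circle)
  define J where "J m = (LINT w|circle_measure. w ^ m / (1 - a * w))" for m
  have pos: "0 < 1 - norm a" using assms by simp
  have bound: "norm (w ^ m / (1 - a * w)) \<le> 1 / (1 - norm a)" if "norm w = 1" for w m
    using norm_one_minus_mult_ge[OF that, of a] pos that
    by (simp add: norm_divide norm_power frac_le)
  have int: "integrable circle_measure (\<lambda>w. w ^ m / (1 - a * w))" for m
    by (rule integrable_circle_bounded[OF _ bound]) measurable
  have int_power: "integrable circle_measure (\<lambda>w. w ^ m)" for m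
    by (rule integrable_circle_bounded[where B = 1]) (auto simp: norm_power)
  have J_bound: "norm (J m) \<le> 1 / (1 - norm a)" for m
  proof -
    have "norm (J m) \<le> (LINT w|circle_measure. norm (w ^ m / (1 - a * w)))"
      unfolding J_def by (rule integral_norm_bound)
    also have "\<dots> \<le> (LINT w|circle_measure. 1 / (1 - norm a))"
      using int bound by (intro integral_mono) (auto simp: norm_circle)
    finally show ?thesis by (simp add: prob_space)
  qed
  have rec: "J m = (if m = 0 then 1 else 0) + a * J (Suc m)" for m
  proof -
    have "J m = (LINT w|circle_measure. w ^ m + a * (w ^ Suc m / (1 - a * w)))"
      unfolding J_def
    proof (rule Bochner_Integration.integral_cong)
      fix w assume "w \<in> space circle_measure"
      then have "1 - a * w \<noteq> 0"
        using norm_one_minus_mult_ge[of w a] pos by (auto simp: norm_circle)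
      then show "w ^ m / (1 - a * w) = w ^ m + a * (w ^ Suc m / (1 - a * w))"
        by (simp add: field_simps)
    qed simp
    also have "\<dots> = (LINT w|circle_measure. w ^ m) + a * J (Suc m)"
      unfolding J_def Bochner_Integration.integral_add[OF int_power integrable_mult_right[OF int]]
      by (simp only: integral_mult_right_zero)
    finally show ?thesis by (simp add: circle_integral_power)
  qed
  have zero: "J m = 0" if "m \<noteq> 0" for m
  proof -
    have iter: "J m = a ^ N * J (m + N)" for N
      by (induction N) (use that in \<open>simp_all add: rec[of "m + _"]\<close>)
    have "norm (J m) \<le> norm a ^ N * (1 / (1 - norm a))" for N
      unfolding iter[of N] by (simp only: norm_mult norm_power) (intro mult_left_mono J_bound, simp)
    moreover have "(\<lambda>N. norm a ^ N * (1 / (1 - norm a))) \<longlonglongrightarrow> 0"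
      using assms by (intro tendsto_mult_left_zero LIMSEQ_power_zero) simp
    ultimately have "norm (J m) \<le> 0" by (intro LIMSEQ_le_const) auto
    then show ?thesis by simp
  qed
  show ?thesis
    unfolding J_def[symmetric] using zero[of m] zero[of 1] rec[of 0] by (cases "m = 0") simp_all
qed

definition poisson1 :: "complex \<Rightarrow> complex \<Rightarrow> real" where
  "poisson1 a w = (1 - (norm a)\<^sup>2) / (norm (1 - cnj a * w))\<^sup>2"

definition poisson :: "('n::finite \<Rightarrow> complex) \<Rightarrow> ('n \<Rightarrow> complex) \<Rightarrow> real" where
  "poisson \<xi> z = (\<Prod>j\<in>UNIV. poisson1 (\<xi> j) (z j))"

lemma poisson1_measurable [measurable]: "poisson1 a \<in> borel_measurable borel"
  unfolding poisson1_def[abs_def] by measurable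

lemma poisson_measurable [measurable]: "poisson \<xi> \<in> borel_measurable torus_measure"
  unfolding poisson_def[abs_def] by measurable

lemma poisson1_nonneg: "norm a < 1 \<Longrightarrow> 0 \<le> poisson1 a w"
  by (simp add: poisson1_def power_le_one)

lemma poisson1_le:
  assumes "norm a < 1" "norm w = 1"
  shows "poisson1 a w \<le> 2 / (1 - norm a)"
proof -
  let ?d = "1 - norm a"
  have d: "0 < ?d" using assms by simp
  have "poisson1 a w \<le> (1 - (norm a)\<^sup>2) / ?d\<^sup>2"
    unfolding poisson1_def
    using norm_one_minus_mult_ge[OF assms(2), of "cnj a"] d
    by (intro divide_left_mono power_mono mult_pos_pos) (auto simp: power_le_one)
  also have "\<dots> = (1 + norm a) / ?d"
  proof -
    have "1 - (norm a)\<^sup>2 = (1 + norm a) * ?d" by (simp add: power2_eq_square algebra_simps)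
    then show ?thesis using d by (simp add: power2_eq_square)
  qed
  also have "\<dots> \<le> 2 / ?d"
    using d assms by (intro divide_right_mono) auto
  finally show ?thesis .
qed

lemma integrable_poisson1:
  assumes "norm a < 1"
  shows "integrable circle_measure (poisson1 a)"
  using poisson1_nonneg[OF assms] poisson1_le[OF assms]
  by (intro integrable_circle_bounded[where B = "2 / (1 - norm a)"]) auto

text \<open>On the circle the Poisson kernel equals \<open>2 Re (1 / (1 - cnj a w)) - 1\<close>, and the integral of
  \<open>1 / (1 - cnj a w)\<close> is one.\<close>

lemma circle_integral_poisson1:
  assumes "norm a < 1"
  shows "(LINT w|circle_measure. poisson1 a w) = 1"
proof -
  interpret prob_space circle_measure by (rule prob_space_circle)
  let ?b = "cnj a"
  have b: "norm ?b < 1" "0 < 1 - norm a" using assms by simp_all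
  have int: "integrable circle_measure (\<lambda>w. 1 / (1 - ?b * w))"
  proof (rule integrable_circle_bounded)
    fix w :: complex assume "norm w = 1"
    then show "norm (1 / (1 - ?b * w)) \<le> 1 / (1 - norm a)"
      using norm_one_minus_mult_ge[of w ?b] b by (simp add: norm_divide frac_le)
  qed measurable
  have "(LINT w|circle_measure. poisson1 a w) = (LINT w|circle_measure. 2 * Re (1 / (1 - ?b * w)) - 1)"
  proof (rule Bochner_Integration.integral_cong)
    fix w assume "w \<in> space circle_measure"
    then have w: "norm w = 1" by (rule norm_circle)
    let ?u = "1 - ?b * w"
    have "?u \<noteq> 0" using norm_one_minus_mult_ge[OF w, of ?b] b by auto
    then have u: "(norm ?u)\<^sup>2 \<noteq> 0" by simp
    have "(norm ?u)\<^sup>2 = 1 - 2 * Re (?b * w) + (norm (?b * w))\<^sup>2"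
      unfolding cmod_power2 by (simp add: power2_eq_square algebra_simps)
    then have "1 - (norm a)\<^sup>2 = 2 * Re ?u - (norm ?u)\<^sup>2"
      using w by (simp add: norm_mult)
    then have "poisson1 a w = (2 * Re ?u - (norm ?u)\<^sup>2) / (norm ?u)\<^sup>2"
      by (simp add: poisson1_def)
    also have "\<dots> = 2 * (Re ?u / (norm ?u)\<^sup>2) - 1"
      using u by (simp add: diff_divide_distrib)
    also have "Re ?u / (norm ?u)\<^sup>2 = Re (1 / ?u)"
      by (simp only: Re_divide cmod_power2) simp
    finally show "poisson1 a w = 2 * Re (1 / ?u) - 1" .
  qed simp
  also have "\<dots> = 2 * Re (LINT w|circle_measure. 1 / (1 - ?b * w)) - 1"
    using int by (simp add: prob_space integral_Re)
  also have "\<dots> = 1"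
    using circle_integral_geometric[OF b(1), of 0] by simp
  finally show ?thesis .
qed

lemma product_sigma_finite_circle: "product_sigma_finite (\<lambda>_::'n. circle_measure)"
  by (intro product_sigma_finite.intro prob_space_imp_sigma_finite prob_space_circle)

lemma torus_integral_prod:
  fixes f :: "'n::finite \<Rightarrow> complex \<Rightarrow> 'b::{real_normed_field, banach, second_countable_topology}"
  assumes "\<And>j. integrable circle_measure (f j)"
  shows "(LINT z|torus_measure. (\<Prod>j\<in>UNIV. f j (z j))) = (\<Prod>j\<in>UNIV. LINT w|circle_measure. f j w)"
  unfolding torus_measure_def
  by (rule product_sigma_finite.product_integral_prod[OF product_sigma_finite_circle])
    (use assms in auto)

lemma poisson_nonneg: "(\<And>j. norm (\<xi> j) < 1) \<Longrightarrow> 0 \<le> poisson \<xi> z"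
  unfolding poisson_def by (intro prod_nonneg ballI poisson1_nonneg)

lemma torus_integral_poisson:
  assumes "\<And>j. norm (\<xi> j) < 1"
  shows "(LINT z|torus_measure. poisson \<xi> z) = 1"
  unfolding poisson_def
  by (subst torus_integral_prod) (simp_all add: assms integrable_poisson1 circle_integral_poisson1)

text \<open>A function that is not integrable has integral zero, not one.\<close>

lemma integrable_poisson:
  assumes "\<And>j. norm (\<xi> j) < 1"
  shows "integrable torus_measure (poisson \<xi>)"
proof (rule ccontr)
  assume "\<not> ?thesis"
  then have "(LINT z|torus_measure. poisson \<xi> z) = 0" by (rule not_integrable_integral_eq)
  with torus_integral_poisson[of \<xi>] assms show False by simp
qed

text \<open>The function on the torus whose class is the normalized reproducing kernel.  Its squared
  modulus is the Poisson kernel of the polydisc.\<close>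

definition kernel_fun :: "('n::finite \<Rightarrow> complex) \<Rightarrow> ('n \<Rightarrow> complex) \<Rightarrow> complex" where
  "kernel_fun \<xi> z = (\<Prod>j\<in>UNIV. complex_of_real (sqrt (1 - (norm (\<xi> j))\<^sup>2)) / (1 - cnj (\<xi> j) * z j))"

context
  fixes \<xi> :: "'n::finite \<Rightarrow> complex"
  assumes \<xi>: "\<And>j. norm (\<xi> j) < 1"
begin

lemma norm_kernel_fun: "(norm (kernel_fun \<xi> z))\<^sup>2 = poisson \<xi> z"
proof -
  have "0 \<le> 1 - (norm (\<xi> j))\<^sup>2" for j by (simp add: power_le_one less_imp_le \<xi>)
  then show ?thesis
    by (simp add: kernel_fun_def poisson_def poisson1_def prod_norm[symmetric]
        prod_power_distrib norm_divide power_divide)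
qed

lemma square_integrable_kernel_fun: "square_integrable (kernel_fun \<xi>)"
proof -
  have "kernel_fun \<xi> \<in> borel_measurable torus_measure"
    unfolding kernel_fun_def[abs_def] by measurable
  then show ?thesis
    using integrable_poisson[OF \<xi>] by (simp add: square_integrable_def norm_kernel_fun)
qed

text \<open>The Fourier integral factors over the coordinates.  In the coordinate with the negative
  index the factor is a multiple of \<open>\<integral> w\<^sup>m / (1 - a w)\<close> with \<open>m > 0\<close>, which vanishes.\<close>

lemma fourier_coeff_kernel_fun:
  assumes "\<alpha> i < 0"
  shows "fourier_coeff (abs_l2 (kernel_fun \<xi>)) \<alpha> = 0"
proof -
  define c where "c j = complex_of_real (sqrt (1 - (norm (\<xi> j))\<^sup>2))" for j
  define f where "f j w = c j / (1 - cnj (\<xi> j) * w) * cnj (w powi \<alpha> j)" for j w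
  have "fourier_coeff (abs_l2 (kernel_fun \<xi>)) \<alpha>
      = (LINT z|torus_measure. kernel_fun \<xi> z * cnj (torus_monomial \<alpha> z))"
    using fourier_coeff.abs_eq[OF l2_eq_refl[OF square_integrable_kernel_fun]] by simp
  also have "\<dots> = (LINT z|torus_measure. (\<Prod>j\<in>UNIV. f j (z j)))"
    by (simp only: kernel_fun_def torus_monomial_def f_def c_def cnj_prod prod.distrib)
  also have "\<dots> = (\<Prod>j\<in>UNIV. LINT w|circle_measure. f j w)"
  proof (rule torus_integral_prod)
    fix j
    have "0 < 1 - norm (\<xi> j)" using \<xi>[of j] by simp
    moreover have "f j \<in> borel_measurable borel"
      unfolding f_def power_int_def by measurable
    ultimately show "integrable circle_measure (f j)"
      using norm_one_minus_mult_ge[of _ "cnj (\<xi> j)"]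
      by (intro integrable_circle_bounded[where B = "norm (c j) / (1 - norm (\<xi> j))"])
        (auto simp: f_def norm_mult norm_divide norm_power_int intro!: frac_le)
  qed
  also have "(LINT w|circle_measure. f i w) = 0"
  proof -
    have "(LINT w|circle_measure. f i w)
        = (LINT w|circle_measure. c i * (w ^ nat (- \<alpha> i) / (1 - cnj (\<xi> i) * w)))"
    proof (rule Bochner_Integration.integral_cong)
      fix w assume "w \<in> space circle_measure"
      then have "w * cnj w = 1" by (simp add: complex_norm_square[symmetric] norm_circle)
      then have "inverse (cnj w) = w" by (metis inverse_unique mult.commute)
      then have "cnj (w powi \<alpha> i) = w ^ nat (- \<alpha> i)"
        using assms by (simp add: power_int_def)
      then show "f i w = c i * (w ^ nat (- \<alpha> i) / (1 - cnj (\<xi> i) * w))" by (simp add: f_def)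
    qed simp
    also have "\<dots> = 0"
      unfolding integral_mult_right_zero
      using circle_integral_geometric[of "cnj (\<xi> i)" "nat (- \<alpha> i)"] \<xi>[of i] assms by simp
    finally show ?thesis .
  qed
  then have "(\<Prod>j\<in>UNIV. LINT w|circle_measure. f j w) = 0"
    by (intro prod_zero) auto
  finally show ?thesis .
qed

lemma l2_of_h2_kernel: "l2_of_h2 (kernel \<xi>) = abs_l2 (kernel_fun \<xi>)"
  unfolding kernel_def kernel_fun_def[symmetric, abs_def]
  by (rule h2_of_l2_inverse) (auto intro: fourier_coeff_kernel_fun)

lemma norm_kernel: "norm (kernel \<xi>) = 1"
proof -
  have "(norm (kernel \<xi>))\<^sup>2 = 1"
    unfolding norm_l2_of_h2[symmetric] l2_of_h2_kernel
    by (simp add: norm_abs_l2 square_integrable_kernel_fun norm_kernel_fun torus_integral_poisson \<xi>)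
  then show ?thesis by (simp add: power2_eq_1_iff) (smt (verit) norm_ge_zero)
qed

text \<open>Projecting \<open>(\<phi> - c) k\<close> onto the Hardy space can only decrease its norm.\<close>

lemma norm_toeplitz_kernel_le:
  "(norm (blinfun_apply (toeplitz \<phi>) (kernel \<xi>) - c *\<^sub>C kernel \<xi>))\<^sup>2
    \<le> (LINT z|torus_measure. (norm (rep_linf \<phi> z - c))\<^sup>2 * poisson \<xi> z)"
proof -
  let ?k = "kernel_fun \<xi>"
  note k = square_integrable_kernel_fun
  have \<phi>k: "square_integrable (\<lambda>z. rep_linf \<phi> z * ?k z)"
    by (intro square_integrable_bounded_mult essentially_bounded_rep_linf k)
  have d: "square_integrable (\<lambda>z. rep_linf \<phi> z * ?k z - c * ?k z)"
    by (intro square_integrable_diff square_integrable_scale \<phi>k k)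
  have "blinfun_apply (toeplitz \<phi>) (kernel \<xi>) - c *\<^sub>C kernel \<xi>
      = proj_h2 (mult_l2 \<phi> (abs_l2 ?k) - c *\<^sub>C abs_l2 ?k)"
    by (simp add: toeplitz_apply l2_of_h2_kernel[symmetric] proj_h2_diff proj_h2_scaleC proj_h2_l2_of_h2)
  also have "mult_l2 \<phi> (abs_l2 ?k) - c *\<^sub>C abs_l2 ?k = abs_l2 (\<lambda>z. rep_linf \<phi> z * ?k z - c * ?k z)"
    by (simp add: mult_l2_abs k scaleC_l2.abs_eq l2_eq_refl abs_l2_diff \<phi>k square_integrable_scale)
  finally have "(norm (blinfun_apply (toeplitz \<phi>) (kernel \<xi>) - c *\<^sub>C kernel \<xi>))\<^sup>2
      \<le> (norm (abs_l2 (\<lambda>z. rep_linf \<phi> z * ?k z - c * ?k z)))\<^sup>2"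
    by (simp add: norm_proj_h2_le power_mono)
  also have "\<dots> = (LINT z|torus_measure. (norm (rep_linf \<phi> z * ?k z - c * ?k z))\<^sup>2)"
    by (rule norm_abs_l2[OF d])
  also have "\<dots> = (LINT z|torus_measure. (norm (rep_linf \<phi> z - c))\<^sup>2 * poisson \<xi> z)"
    by (simp only: left_diff_distrib[symmetric] norm_mult power_mult_distrib norm_kernel_fun)
  finally show ?thesis .
qed

end

section \<open>Lebesgue density\<close>

lemma lmeasurable_cover_mod_negligible:
  assumes U: "U \<in> lmeasurable" "measure lebesgue U \<le> \<eta>" and N: "negligible (E - U)"
  shows "\<exists>T. E \<subseteq> T \<and> T \<in> lmeasurable \<and> measure lebesgue T \<le> \<eta>"
proof (intro exI conjI)
  have meas: "E - U \<in> lmeasurable" and null: "measure lebesgue (E - U) = 0"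
    using N by (simp_all add: negligible_imp_measurable negligible_imp_measure0)
  show "U \<union> (E - U) \<in> lmeasurable" using U(1) meas by (rule fmeasurable.Un)
  show "measure lebesgue (U \<union> (E - U)) \<le> \<eta>"
    using measure_Un_le[OF fmeasurableD[OF U(1)] fmeasurableD[OF meas]] null U(2) by linarith
qed blast

text \<open>Let \<open>E\<close> be the set of points outside \<open>S\<close> near which \<open>S\<close> has upper density larger than
  \<open>e\<close>.  Remove from \<open>S\<close> a closed set that carries all but a small part of its measure.  By
  Vitali's theorem \<open>E\<close> is covered, up to a null set, by disjoint balls that avoid this closed set
  and of which \<open>S\<close> occupies a share of at least \<open>e\<close>.  Their total measure is then controlled by
  the part of \<open>S\<close> that is left.\<close>

lemma negligible_positive_upper_density:
  fixes S :: "'a::euclidean_space set"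
  assumes S: "S \<in> sets borel" and e: "0 < e"
  shows "negligible {x. x \<notin> S \<and>
    (\<forall>d>0. \<exists>\<rho>>0. \<rho> < d \<and> e * measure lborel (ball x \<rho>) < measure lborel (S \<inter> ball x \<rho>))}"
    (is "negligible ?E")
  unfolding negligible_outer_le
proof (intro allI impI)
  fix \<eta> :: real assume \<eta>: "0 < \<eta>"
  have "S \<in> sets lebesgue" using S by simp
  then obtain F where F: "closed F" "F \<subseteq> S" and small: "emeasure lebesgue (S - F) < ennreal (e * \<eta>)"
    by (rule sets_lebesgue_inner_closed[where e = "e * \<eta>"]) (use e \<eta> in auto)
  have [measurable]: "S \<in> sets borel" "F \<in> sets borel" using S F by auto
  define K where "K = {(x, \<rho>). ball x \<rho> \<inter> F = {} \<and> 0 < \<rho> \<and>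
    e * measure lborel (ball x \<rho>) < measure lborel (S \<inter> ball x \<rho>)}"
  have "\<exists>i. i \<in> K \<and> x \<in> ball (fst i) (snd i) \<and> snd i < d" if x: "x \<in> ?E" and "0 < d" for x d
  proof -
    have "x \<in> - F" using x F by auto
    then obtain d' where d': "0 < d'" "ball x d' \<subseteq> - F"
      using F(1) open_contains_ball[of "- F"] by (meson open_Compl)
    obtain \<rho> where \<rho>: "0 < \<rho>" "\<rho> < min d d'"
      "e * measure lborel (ball x \<rho>) < measure lborel (S \<inter> ball x \<rho>)"
      using x \<open>0 < d\<close> \<open>0 < d'\<close> by (auto dest!: spec[of _ "min d d'"])
    then have "ball x \<rho> \<subseteq> - F" using d'(2) subset_ball[of \<rho> d' x] by auto
    then show ?thesis using \<rho> by (intro exI[of _ "(x, \<rho>)"]) (auto simp: K_def)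
  qed
  then obtain C where C: "countable C" "C \<subseteq> K"
      "pairwise (\<lambda>i j. disjnt (ball (fst i) (snd i)) (ball (fst j) (snd j))) C"
      and cover: "negligible (?E - (\<Union>i\<in>C. ball (fst i) (snd i)))"
    by (rule Vitali_covering_theorem_balls[of ?E K fst snd])
  let ?B = "\<lambda>i. ball (fst i) (snd i)"
  have disj: "disjoint_family_on ?B C"
    using C(3) by (auto simp: disjoint_family_on_def pairwise_def disjnt_def)
  have balls: "ennreal e * emeasure lborel (\<Union>i\<in>C. ?B i) \<le> emeasure lborel (S - F)"
  proof -
    have "ennreal e * emeasure lborel (\<Union>i\<in>C. ?B i)
        = (\<integral>\<^sup>+i. ennreal e * emeasure lborel (?B i) \<partial>count_space C)"
      using C disj by (simp add: emeasure_UN_countable nn_integral_cmult)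
    also have "\<dots> \<le> (\<integral>\<^sup>+i. emeasure lborel (S \<inter> ?B i) \<partial>count_space C)"
    proof (rule nn_integral_mono)
      fix i assume "i \<in> space (count_space C)"
      then have "i \<in> K" using C by auto
      then have "e * measure lborel (?B i) \<le> measure lborel (S \<inter> ?B i)"
        by (auto simp: K_def)
      moreover have "emeasure lborel (S \<inter> ?B i) < \<infinity>"
        by (rule le_less_trans[OF emeasure_mono emeasure_lborel_ball_finite]) auto
      moreover have "emeasure lborel (?B i) < \<infinity>" by (rule emeasure_lborel_ball_finite)
      ultimately show "ennreal e * emeasure lborel (?B i) \<le> emeasure lborel (S \<inter> ?B i)"
        using e by (simp add: emeasure_eq_ennreal_measure top_unique ennreal_mult[symmetric] less_top[symmetric])
    qed
    also have "\<dots> = emeasure lborel (\<Union>i\<in>C. S \<inter> ?B i)"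
    proof (rule emeasure_UN_countable[symmetric])
      show "disjoint_family_on (\<lambda>i. S \<inter> ?B i) C"
        using disj unfolding disjoint_family_on_def by blast
    qed (use C in auto)
    also have "\<dots> \<le> emeasure lborel (S - F)"
    proof (rule emeasure_mono)
      have "?B i \<inter> F = {}" if "i \<in> C" for i
        using subsetD[OF C(2) that] by (simp add: K_def case_prod_unfold)
      then show "(\<Union>i\<in>C. S \<inter> ?B i) \<subseteq> S - F" by blast
    qed simp
    finally show ?thesis .
  qed
  have "emeasure lborel (\<Union>i\<in>C. ?B i) \<le> ennreal \<eta>"
  proof -
    have "emeasure lborel (S - F) < ennreal (e * \<eta>)"
      using small by (simp add: emeasure_completion)
    then have "ennreal e * emeasure lborel (\<Union>i\<in>C. ?B i) \<le> ennreal e * ennreal \<eta>"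
      using balls e \<eta> by (simp add: ennreal_mult[symmetric] order.trans less_imp_le)
    then show ?thesis
      using e by (subst (asm) ennreal_mult_le_mult_iff) auto
  qed
  moreover have B: "(\<Union>i\<in>C. ?B i) \<in> sets borel" by (intro borel_open open_UN ballI open_ball)
  ultimately have U: "emeasure lebesgue (\<Union>i\<in>C. ?B i) \<le> ennreal \<eta>"
    by (simp add: emeasure_completion)
  have "(\<Union>i\<in>C. ?B i) \<in> lmeasurable"
  proof (rule fmeasurableI)
    show "(\<Union>i\<in>C. ?B i) \<in> sets lebesgue" using B by (simp add: sets_completionI_sets)
    show "emeasure lebesgue (\<Union>i\<in>C. ?B i) < \<infinity>" using U by (rule le_less_trans) simp
  qed
  moreover have "measure lebesgue (\<Union>i\<in>C. ?B i) \<le> \<eta>"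
    using U \<eta> by (simp add: measure_def enn2real_leI)
  moreover note cover
  ultimately show "\<exists>T. ?E \<subseteq> T \<and> T \<in> lmeasurable \<and> measure lebesgue T \<le> \<eta>"
    by (rule lmeasurable_cover_mod_negligible)
qed

text \<open>The exceptional set is the union of the sets of positive upper density for the
  thresholds \<open>1 / (m + 1)\<close>.\<close>

lemma AE_density_zero:
  fixes S :: "'a::euclidean_space set"
  assumes S: "S \<in> sets borel"
  shows "AE x in lborel. x \<notin> S \<longrightarrow>
    (\<forall>e>0. \<exists>d>0. \<forall>\<rho>>0. \<rho> < d \<longrightarrow> measure lborel (S \<inter> ball x \<rho>) \<le> e * measure lborel (ball x \<rho>))"
proof -
  let ?E = "\<lambda>e. {x. x \<notin> S \<and>
    (\<forall>d>0. \<exists>\<rho>>0. \<rho> < d \<and> e * measure lborel (ball x \<rho>) < measure lborel (S \<inter> ball x \<rho>))}"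
  have "AE x in lebesgue. x \<notin> ?E (inverse (real (Suc m)))" for m
    using negligible_positive_upper_density[OF S, of "inverse (real (Suc m))"]
    by (intro AE_not_in) (simp add: negligible_iff_null_sets)
  then have "AE x in lborel. \<forall>m. x \<notin> ?E (inverse (real (Suc m)))"
    by (simp only: AE_completion_iff AE_all_countable) blast
  then show ?thesis
  proof eventually_elim
    case (elim x)
    show ?case
    proof (intro impI allI)
      fix e :: real assume x: "x \<notin> S" and "0 < e"
      then obtain m where m: "inverse (real (Suc m)) < e" using reals_Archimedean by blast
      obtain d where d: "0 < d" and le: "\<And>\<rho>. 0 < \<rho> \<Longrightarrow> \<rho> < d \<Longrightarrow>
          measure lborel (S \<inter> ball x \<rho>) \<le> inverse (real (Suc m)) * measure lborel (ball x \<rho>)"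
        using elim[rule_format, of m] x by (force simp: not_less)
      have "measure lborel (S \<inter> ball x \<rho>) \<le> e * measure lborel (ball x \<rho>)" if "0 < \<rho>" "\<rho> < d" for \<rho>
        using le[OF that] mult_right_mono[OF less_imp_le[OF m], of "measure lborel (ball x \<rho>)"] by simp
      then show "\<exists>d>0. \<forall>\<rho>>0. \<rho> < d \<longrightarrow> measure lborel (S \<inter> ball x \<rho>) \<le> e * measure lborel (ball x \<rho>)"
        using d by blast
    qed
  qed
qed

section \<open>Angular coordinates on the torus\<close>

definition angle_box :: "(real ^ 'n::finite) set" where
  "angle_box = {x. \<forall>j. x $ j \<in> {0..<2 * pi}}"

definition torus_point :: "real ^ 'n::finite \<Rightarrow> 'n \<Rightarrow> complex" where
  "torus_point x = (\<lambda>j. cis (x $ j))"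

definition torus_angle :: "('n::finite \<Rightarrow> complex) \<Rightarrow> real ^ 'n" where
  "torus_angle z = (\<chi> j. Arg2pi (z j))"

lemma measurable_vec_lambda_PiM:
  "vec_lambda \<in> measurable (PiM UNIV (\<lambda>_::'n::finite. borel :: real measure)) (borel :: (real ^ 'n) measure)"
proof (subst borel_measurable_euclidean_space, intro ballI)
  fix b :: "real ^ 'n" assume "b \<in> Basis"
  then obtain i where "b = axis i 1" by (auto simp: Basis_vec_def)
  then show "(\<lambda>x. vec_lambda x \<bullet> b) \<in> borel_measurable (PiM UNIV (\<lambda>_::'n. borel :: real measure))"
    by (simp add: inner_axis)
qed

lemma lborel_vec_eq:
  "(lborel :: (real ^ 'n::finite) measure) = distr (PiM UNIV (\<lambda>_. lborel)) borel vec_lambda"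
proof (rule lborel_eqI)
  interpret product_sigma_finite "\<lambda>_::'n. lborel :: real measure" ..
  have [measurable]: "vec_lambda \<in> measurable (PiM UNIV (\<lambda>_::'n. lborel)) (borel :: (real ^ 'n) measure)"
    using measurable_vec_lambda_PiM by (simp cong: measurable_cong_sets sets_PiM_cong)
  fix l u :: "real ^ 'n"
  assume le: "\<And>b. b \<in> Basis \<Longrightarrow> l \<bullet> b \<le> u \<bullet> b"
  have le': "l $ j \<le> u $ j" for j
    using le[of "axis j 1"] by (simp add: inner_axis axis_in_Basis_iff)
  have "vec_lambda -` box l u \<inter> space (PiM UNIV (\<lambda>_::'n. lborel)) = Pi\<^sub>E UNIV (\<lambda>j. {l $ j<..<u $ j})"
    by (auto simp: space_PiM PiE_iff mem_box_cart)
  then have "emeasure (distr (PiM UNIV (\<lambda>_. lborel)) borel vec_lambda) (box l u)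
      = emeasure (PiM UNIV (\<lambda>_. lborel)) (Pi\<^sub>E UNIV (\<lambda>j. {l $ j<..<u $ j}))"
    by (simp add: emeasure_distr)
  also have "\<dots> = (\<Prod>j\<in>UNIV. ennreal ((u - l) $ j))"
    by (simp add: emeasure_PiM le')
  also have "\<dots> = ennreal (\<Prod>j\<in>UNIV. (u - l) $ j)"
    by (rule prod_ennreal) (simp add: le')
  also have "(\<Prod>j\<in>UNIV. (u - l) $ j) = (\<Prod>b\<in>Basis. (u - l) \<bullet> b)"
  proof -
    have Basis: "Basis = range (\<lambda>j::'n. axis j (1::real))" by (auto simp: Basis_vec_def)
    have inj: "inj (\<lambda>j::'n. axis j (1::real))" by (auto intro: injI simp: axis_eq_axis)
    show ?thesis unfolding Basis prod.reindex[OF inj] by (simp add: inner_axis)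
  qed
  finally show "emeasure (distr (PiM UNIV (\<lambda>_. lborel)) borel vec_lambda) (box l u)
      = (\<Prod>b\<in>Basis. (u - l) \<bullet> b)" .
qed simp

lemma borel_vec_prod:
  fixes X :: "'n::finite \<Rightarrow> real set"
  assumes X: "\<And>j. X j \<in> sets borel"
  shows "{x :: real ^ 'n. \<forall>j. x $ j \<in> X j} \<in> sets borel"
proof -
  have "{x :: real ^ 'n. \<forall>j. x $ j \<in> X j} = (\<Inter>j. (\<lambda>x. x $ j) -` X j)" by auto
  also have "\<dots> \<in> sets borel"
    by (intro sets.finite_INT measurable_sets_borel[OF _ X] borel_measurable_continuous_onI continuous_intros) auto
  finally show ?thesis .
qed

lemma emeasure_lborel_vec_prod:
  fixes X :: "'n::finite \<Rightarrow> real set"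
  assumes X: "\<And>j. X j \<in> sets borel"
  shows "emeasure lborel {x :: real ^ 'n. \<forall>j. x $ j \<in> X j} = (\<Prod>j\<in>UNIV. emeasure lborel (X j))"
proof -
  interpret product_sigma_finite "\<lambda>_::'n. lborel :: real measure" ..
  have [measurable]: "vec_lambda \<in> measurable (PiM UNIV (\<lambda>_::'n. lborel)) (borel :: (real ^ 'n) measure)"
    using measurable_vec_lambda_PiM by (simp cong: measurable_cong_sets sets_PiM_cong)
  note [measurable] = X
  have "vec_lambda -` {x. \<forall>j. x $ j \<in> X j} \<inter> space (PiM UNIV (\<lambda>_::'n. lborel)) = Pi\<^sub>E UNIV X"
    by (auto simp: space_PiM PiE_iff)
  then show ?thesis
    using X borel_vec_prod[of X] by (subst lborel_vec_eq) (simp add: emeasure_distr emeasure_PiM)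
qed

lemma emeasure_angle_box: "emeasure lborel (angle_box :: (real ^ 'n::finite) set) = ennreal ((2 * pi) ^ CARD('n))"
  unfolding angle_box_def
  by (subst emeasure_lborel_vec_prod) (simp_all add: ennreal_power)

lemma angle_box_borel [measurable]: "angle_box \<in> sets borel"
  unfolding angle_box_def by (rule borel_vec_prod) simp

lemma measurable_cis_borel [measurable]: "cis \<in> borel_measurable borel"
  by (intro borel_measurable_continuous_onI continuous_on_cis continuous_on_id)

lemma torus_point_measurable: "torus_point \<in> measurable borel (torus_measure :: ('n::finite \<Rightarrow> complex) measure)"
  unfolding torus_measure_def torus_point_def[abs_def]
proof (rule measurable_PiM_single')
  fix j
  have "(\<lambda>x :: real ^ 'n. x $ j) \<in> borel_measurable borel"
    by (intro borel_measurable_continuous_onI continuous_intros)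
  then have "(\<lambda>x :: real ^ 'n. cis (x $ j)) \<in> borel_measurable borel" by measurable
  then have "(\<lambda>x :: real ^ 'n. cis (x $ j)) \<in> measurable borel (restrict_space borel (sphere 0 1))"
    by (intro measurable_restrict_space2) auto
  then show "(\<lambda>x :: real ^ 'n. cis (x $ j)) \<in> measurable borel circle_measure"
    by (simp cong: measurable_cong_sets add: sets_circle_measure)
qed (auto simp: space_circle_measure)

text \<open>Both measures have the same values on products of Borel sets of the circle.\<close>

lemma torus_measure_eq_distr:
  "(torus_measure :: ('n::finite \<Rightarrow> complex) measure)
    = distr (uniform_measure lborel angle_box) torus_measure torus_point"
proof -
  interpret product_sigma_finite "\<lambda>_::'n. circle_measure" by (rule product_sigma_finite_circle)
  have tp: "torus_point \<in> measurable (uniform_measure lborel angle_box) (torus_measure :: ('n \<Rightarrow> complex) measure)"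
    using torus_point_measurable by (simp cong: measurable_cong_sets)
  have "distr (uniform_measure lborel angle_box) torus_measure torus_point = PiM UNIV (\<lambda>_::'n. circle_measure)"
  proof (rule PiM_eqI)
    fix A :: "'n \<Rightarrow> complex set"
    assume A: "\<And>j. j \<in> UNIV \<Longrightarrow> A j \<in> sets circle_measure"
    define X where "X j = {0..<2 * pi} \<inter> cis -` A j" for j
    have cis_A: "cis -` A j \<in> sets borel" for j
    proof -
      have "cis \<in> measurable borel circle_measure"
        using measurable_restrict_space2[of cis borel "sphere 0 1" borel]
        by (simp cong: measurable_cong_sets add: sets_circle_measure)
      then show ?thesis using measurable_sets[of cis borel circle_measure "A j"] A by simp
    qed
    then have X: "X j \<in> sets borel" for j by (simp add: X_def)
    have circle: "emeasure circle_measure (A j) = emeasure lborel (X j) / ennreal (2 * pi)" for j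
    proof -
      have "emeasure circle_measure (A j) = emeasure (uniform_measure lborel {0..<2 * pi}) (cis -` A j)"
        using A[of j] unfolding circle_measure_def sets_circle_measure
        by (subst emeasure_distr[OF measurable_cis_circle]) (simp_all add: sets_circle_measure[unfolded circle_measure_def])
      also have "\<dots> = emeasure lborel (X j) / ennreal (2 * pi)"
        using cis_A[of j] by (simp add: X_def)
      finally show ?thesis .
    qed
    have PA: "Pi\<^sub>E UNIV A \<in> sets torus_measure"
      unfolding torus_measure_def using A by (intro sets_PiM_I_finite) auto
    have "emeasure (distr (uniform_measure lborel angle_box) torus_measure torus_point) (Pi\<^sub>E UNIV A)
        = emeasure (uniform_measure lborel angle_box) (torus_point -` Pi\<^sub>E UNIV A)"
      by (subst emeasure_distr[OF tp PA]) simp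
    also have "\<dots> = emeasure lborel (angle_box \<inter> torus_point -` Pi\<^sub>E UNIV A) / emeasure lborel (angle_box :: (real ^ 'n) set)"
      using measurable_sets[OF torus_point_measurable PA] by (intro emeasure_uniform_measure) auto
    also have "angle_box \<inter> torus_point -` Pi\<^sub>E UNIV A = {x. \<forall>j. x $ j \<in> X j}"
      by (auto simp: angle_box_def torus_point_def X_def PiE_iff)
    also have "emeasure lborel {x :: real ^ 'n. \<forall>j. x $ j \<in> X j} / emeasure lborel (angle_box :: (real ^ 'n) set)
        = (\<Prod>j\<in>UNIV. emeasure circle_measure (A j))"
    proof -
      have fin: "emeasure lborel (X j) \<noteq> \<top>" for j
      proof -
        have "emeasure lborel (X j) \<le> emeasure lborel {0..<2 * pi}"
          by (rule emeasure_mono) (auto simp: X_def)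
        then show ?thesis by (rule neq_top_trans[rotated]) simp
      qed
      show ?thesis
        unfolding emeasure_lborel_vec_prod[OF X] emeasure_angle_box circle
        by (simp add: fin emeasure_eq_ennreal_measure divide_ennreal prod_ennreal prod_nonneg prod_dividef)
    qed
    finally show "emeasure (distr (uniform_measure lborel angle_box) torus_measure torus_point) (Pi\<^sub>E UNIV A)
        = (\<Prod>j\<in>UNIV. emeasure circle_measure (A j))" .
  qed (simp_all add: torus_measure_def)
  then show ?thesis by (simp add: torus_measure_def)
qed

lemma measurable_Arg2pi: "Arg2pi \<in> borel_measurable borel"
proof -
  have "Arg2pi = (\<lambda>z. indicator (- \<real>\<^sub>\<ge>\<^sub>0) z *\<^sub>R Arg2pi z)"
    by (rule ext) (auto simp: indicator_def Arg2pi_eq_0 complex_nonneg_Reals_iff complex_is_Real_iff)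
  moreover have "(\<lambda>z. indicator (- \<real>\<^sub>\<ge>\<^sub>0) z *\<^sub>R Arg2pi z) \<in> borel_measurable borel"
    by (intro borel_measurable_continuous_on_indicator continuous_at_imp_continuous_on ballI
        continuous_at_Arg2pi) (auto simp: closed_nonneg_Reals_complex)
  ultimately show ?thesis by simp
qed

lemma torus_angle_measurable: "torus_angle \<in> borel_measurable (torus_measure :: ('n::finite \<Rightarrow> complex) measure)"
proof -
  note [measurable] = measurable_Arg2pi
  have "(\<lambda>z j. Arg2pi (z j)) \<in> measurable (torus_measure :: ('n \<Rightarrow> complex) measure) (PiM UNIV (\<lambda>_. borel))"
    by (rule measurable_PiM_single') auto
  from measurable_compose[OF this measurable_vec_lambda_PiM]
  show ?thesis by (simp add: torus_angle_def[abs_def])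
qed

lemma torus_point_angle:
  assumes "\<And>j. norm (z j) = 1"
  shows "torus_point (torus_angle z) = z"
proof
  fix j
  have "z j = of_real (norm (z j)) * exp (\<i> * of_real (Arg2pi (z j)))" by (rule Arg2pi_eq)
  then show "torus_point (torus_angle z) j = z j"
    by (simp add: torus_point_def torus_angle_def cis_conv_exp assms)
qed

lemma torus_angle_point:
  assumes "x \<in> angle_box"
  shows "torus_angle (torus_point x) = x"
proof -
  have "Arg2pi (cis (x $ j)) = x $ j" for j
    by (rule Arg2pi_unique[of 1]) (use assms in \<open>auto simp: angle_box_def cis_conv_exp\<close>)
  then show ?thesis by (simp add: vec_eq_iff torus_angle_def torus_point_def)
qed

text \<open>An exceptional null set in the box of angles pulls back to a null set of the torus under
  the measurable inverse \<open>torus_angle\<close>.\<close>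

lemma AE_torusI:
  fixes P :: "('n::finite \<Rightarrow> complex) \<Rightarrow> bool"
  assumes "AE x in lborel. x \<in> angle_box \<longrightarrow> P (torus_point x)"
  shows "AE z in torus_measure. P z"
proof -
  let ?U = "uniform_measure lborel (angle_box :: (real ^ 'n) set)"
  have tp: "torus_point \<in> measurable ?U torus_measure"
    using torus_point_measurable by (simp cong: measurable_cong_sets)
  have "AE x in ?U. P (torus_point x)"
    using assms emeasure_angle_box[where 'n = 'n] by (intro AE_uniform_measureI) auto
  moreover have "AE x in ?U. x \<in> angle_box"
    using emeasure_angle_box[where 'n = 'n] by (intro AE_uniform_measureI) auto
  ultimately have "AE x in ?U. P (torus_point x) \<and> x \<in> angle_box" by eventually_elim simp
  then obtain N where N: "N \<in> null_sets ?U" and "\<And>x. x \<in> space ?U - N \<Longrightarrow> P (torus_point x) \<and> x \<in> angle_box"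
    by (rule AE_E3) blast
  then have sub: "P (torus_point x) \<and> x \<in> angle_box" if "x \<notin> N" for x
    using that by simp
  have "torus_angle -` N \<inter> space torus_measure \<in> null_sets torus_measure"
  proof (rule null_setsI)
    have Nb: "N \<in> sets borel" using N by auto
    show meas: "torus_angle -` N \<inter> space torus_measure \<in> sets torus_measure"
      using measurable_sets[OF torus_angle_measurable Nb] .
    have "emeasure torus_measure (torus_angle -` N \<inter> space torus_measure)
        = emeasure ?U (torus_point -` (torus_angle -` N \<inter> space torus_measure) \<inter> space ?U)"
      by (subst torus_measure_eq_distr) (rule emeasure_distr[OF tp meas])
    also have "\<dots> \<le> emeasure ?U N"
    proof (rule emeasure_mono)
      show "torus_point -` (torus_angle -` N \<inter> space torus_measure) \<inter> space ?U \<subseteq> N"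
        using sub torus_angle_point by fastforce
    qed (use Nb in simp)
    also have "\<dots> = 0" using N by auto
    finally show "emeasure torus_measure (torus_angle -` N \<inter> space torus_measure) = 0" by simp
  qed
  then have "AE z in torus_measure. z \<notin> torus_angle -` N \<inter> space torus_measure"
    by (rule AE_not_in)
  then show ?thesis
  proof (rule AE_mp, intro AE_I2 impI)
    fix z assume z: "z \<in> space torus_measure" "z \<notin> torus_angle -` N \<inter> space torus_measure"
    then have "P (torus_point (torus_angle z))" using sub by auto
    then show "P z" using z by (simp add: torus_point_angle norm_torus)
  qed
qed

section \<open>Radial limits of Poisson integrals\<close>

text \<open>Outside an arc of radius \<open>t\<close> about \<open>\<zeta>\<close>, the Poisson kernel of \<open>r \<zeta>\<close> is small compared to
  the one of \<open>(1 - t) \<zeta>\<close>, whose integral is one as well.  This gives the decay of the Poisson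
  mass away from \<open>\<zeta>\<close> directly from the normalization.  The reason is that \<open>|1 - r cnj \<zeta> w|\<close> is at
  least \<open>|w - \<zeta>| / 2\<close>, whereas \<open>|1 - (1 - t) cnj \<zeta> w|\<close> is at most \<open>2 |w - \<zeta>|\<close> if \<open>t < |w - \<zeta>|\<close>.\<close>

lemma poisson1_tail_le:
  assumes \<zeta>: "norm \<zeta> = 1" and w: "norm w = 1" and r: "0 \<le> r" "r < 1" and t: "0 < t" "t < 1"
    and far: "t < norm (w - \<zeta>)"
  shows "poisson1 (of_real r * \<zeta>) w \<le> 32 * (1 - r) / t * poisson1 (of_real (1 - t) * \<zeta>) w"
proof -
  let ?u = "cnj \<zeta> * w"
  have u: "norm ?u = 1" using \<zeta> w by (simp add: norm_mult)
  have "w - \<zeta> = \<zeta> * (?u - 1)"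
  proof -
    have "\<zeta> * cnj \<zeta> = 1" using \<zeta> by (simp add: complex_norm_square[symmetric])
    moreover have "\<zeta> * (?u - 1) = (\<zeta> * cnj \<zeta>) * w - \<zeta>" by (simp add: algebra_simps)
    ultimately show ?thesis by simp
  qed
  then have dist: "norm (w - \<zeta>) = norm (1 - ?u)"
    using \<zeta> by (simp add: norm_mult norm_minus_commute)
  have shrink: "norm (1 - of_real s * ?u - (1 - ?u)) = 1 - s" if "0 \<le> s" "s \<le> 1" for s
  proof -
    have "1 - of_real s * ?u - (1 - ?u) = of_real (1 - s) * ?u" by (simp add: algebra_simps)
    also have "norm \<dots> = \<bar>1 - s\<bar> * norm ?u" by (simp only: norm_mult norm_of_real)
    finally show ?thesis using that unfolding u by simp
  qed
  have "1 - r \<le> norm (1 - of_real r * ?u)"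
    using norm_one_minus_mult_ge[OF u, of "of_real r"] r by simp
  then have lower: "norm (1 - ?u) \<le> 2 * norm (1 - of_real r * ?u)"
    using shrink[of r] r norm_triangle_sub[of "1 - ?u" "1 - of_real r * ?u"]
    by (simp add: norm_minus_commute)
  have upper: "norm (1 - of_real (1 - t) * ?u) \<le> 2 * norm (1 - ?u)"
    using shrink[of "1 - t"] t far dist norm_triangle_sub[of "1 - of_real (1 - t) * ?u" "1 - ?u"] by simp
  let ?a = "norm (1 - of_real r * ?u)" and ?b = "norm (1 - of_real (1 - t) * ?u)"
  have "1 - \<bar>1 - t\<bar> \<le> ?b"
    using norm_one_minus_mult_ge[OF u, of "of_real (1 - t)"] by (simp only: norm_of_real)
  then have b: "0 < ?b" using t by linarith
  have ba: "?b \<le> 4 * ?a" using lower upper by simp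
  have "t * (1 - r\<^sup>2) * ?b\<^sup>2 \<le> t * (2 * (1 - r)) * (4 * ?a)\<^sup>2"
  proof (intro mult_mono power_mono ba)
    show "1 - r\<^sup>2 \<le> 2 * (1 - r)" using zero_le_power2[of "1 - r"] by (simp add: power2_diff)
  qed (use t r b in \<open>auto simp: power_le_one\<close>)
  also have "\<dots> = 32 * (1 - r) * t * ?a\<^sup>2" by (simp add: power_mult_distrib)
  also have "\<dots> \<le> 32 * (1 - r) * (1 - (1 - t)\<^sup>2) * ?a\<^sup>2"
  proof -
    have "t \<le> 1 - (1 - t)\<^sup>2" using t by (simp add: power2_eq_square algebra_simps)
    then show ?thesis using r by (intro mult_right_mono mult_left_mono) auto
  qed
  finally have key: "t * (1 - r\<^sup>2) * ?b\<^sup>2 \<le> 32 * (1 - r) * (1 - (1 - t)\<^sup>2) * ?a\<^sup>2" .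
  have a: "0 < ?a" using ba b by linarith
  have "poisson1 (of_real r * \<zeta>) w = (1 - r\<^sup>2) / ?a\<^sup>2"
    using \<zeta> r by (simp add: poisson1_def norm_mult mult.assoc)
  also have "\<dots> \<le> 32 * (1 - r) * (1 - (1 - t)\<^sup>2) / (t * ?b\<^sup>2)"
    using key a b t by (simp add: divide_simps mult_ac)
  also have "\<dots> = 32 * (1 - r) / t * poisson1 (of_real (1 - t) * \<zeta>) w"
    using \<zeta> t norm_of_real[of "1 - t", where 'a = complex]
    by (simp add: poisson1_def norm_mult mult.assoc)
  finally show ?thesis .
qed

lemma poisson_tail_le:
  fixes \<zeta> :: "'n::finite \<Rightarrow> complex"
  assumes \<zeta>: "\<And>j. norm (\<zeta> j) = 1" and z: "\<And>j. norm (z j) = 1"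
    and r: "0 \<le> r" "r < 1" and t: "0 < t" "t < 1" and far: "t < norm (z i - \<zeta> i)"
  shows "poisson (\<lambda>j. of_real r * \<zeta> j) z
    \<le> 32 * (1 - r) / t * poisson (\<lambda>j. of_real (if j = i then 1 - t else r) * \<zeta> j) z"
proof -
  have split: "poisson \<xi> z = poisson1 (\<xi> i) (z i) * (\<Prod>j\<in>UNIV - {i}. poisson1 (\<xi> j) (z j))" for \<xi>
    unfolding poisson_def by (rule prod.remove) auto
  have "poisson (\<lambda>j. of_real r * \<zeta> j) z
      \<le> 32 * (1 - r) / t * poisson1 (of_real (1 - t) * \<zeta> i) (z i) *
        (\<Prod>j\<in>UNIV - {i}. poisson1 (of_real r * \<zeta> j) (z j))"
    unfolding split using \<zeta> r
    by (intro mult_right_mono poisson1_tail_le \<zeta> z r t far prod_nonneg ballI poisson1_nonneg)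
      (simp add: norm_mult)
  also have "(\<Prod>j\<in>UNIV - {i}. poisson1 (of_real r * \<zeta> j) (z j))
      = (\<Prod>j\<in>UNIV - {i}. poisson1 (of_real (if j = i then 1 - t else r) * \<zeta> j) (z j))"
    by (intro prod.cong) auto
  finally show ?thesis by (simp add: split mult.assoc)
qed

lemma poisson_le:
  fixes \<xi> :: "'n::finite \<Rightarrow> complex"
  assumes "\<And>j. norm (\<xi> j) = r" "r < 1" "\<And>j. norm (z j) = 1"
  shows "poisson \<xi> z \<le> (2 / (1 - r)) ^ CARD('n)"
proof -
  have "poisson \<xi> z \<le> (\<Prod>j\<in>(UNIV :: 'n set). 2 / (1 - r))"
    unfolding poisson_def
    by (intro prod_mono) (use assms poisson1_nonneg poisson1_le[of "\<xi> _"] in auto)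
  then show ?thesis by simp
qed

lemma norm_cis_diff: "norm (cis x - cis y) = 2 * \<bar>sin ((x - y) / 2)\<bar>"
proof -
  have "cis x - cis y = cis y * (cis (x - y) - 1)"
    by (simp add: right_diff_distrib cis_mult)
  then have "norm (cis x - cis y) = norm (cis (x - y) - 1)" by (simp add: norm_mult)
  then show ?thesis using dist_exp_i_1[of "x - y"] by (simp add: cis_conv_exp)
qed

text \<open>For angles in \<open>[0, 2 \<pi>]\<close> and \<open>\<theta>\<close> in the interior, half the difference of the angles stays
  in a compact part of \<open>(-\<pi>, \<pi>)\<close>, on which \<open>sin y / y\<close> is bounded away from zero.  Since \<open>\<theta>\<close> is not an
  end point, chords are comparable to differences of angles, with no identification modulo \<open>2 \<pi>\<close>.\<close>

lemma norm_cis_diff_ge: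
  assumes \<theta>: "0 < \<theta>" "\<theta> < 2 * pi"
  shows "\<exists>c>0. \<forall>x\<in>{0..2 * pi}. c * \<bar>x - \<theta>\<bar> \<le> norm (cis x - cis \<theta>)"
proof -
  let ?g = "\<lambda>x. \<bar>sinc ((x - \<theta>) / 2)\<bar>"
  have "continuous_on {0..2 * pi} ?g"
    by (intro continuous_intros) auto
  then obtain x0 where x0: "x0 \<in> {0..2 * pi}" and min: "\<And>x. x \<in> {0..2 * pi} \<Longrightarrow> ?g x0 \<le> ?g x"
    using continuous_attains_inf[of "{0..2 * pi}" ?g] by auto
  have "?g x0 > 0"
  proof (cases "x0 = \<theta>")
    case False
    let ?y = "\<bar>(x0 - \<theta>) / 2\<bar>"
    have "\<bar>x0 - \<theta>\<bar> < 2 * pi" using x0 \<theta> by (auto simp: abs_if)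
    then have "0 < ?y" "?y < pi" using False by simp_all
    then have "sin ?y > 0" by (rule sin_gt_zero)
    then have "0 < sin ?y / ?y" using \<open>0 < ?y\<close> by (rule divide_pos_pos)
    also have "sin ?y / ?y = sinc ((x0 - \<theta>) / 2)" using False by (simp add: abs_if)
    finally show ?thesis by linarith
  qed simp
  moreover have "?g x0 * \<bar>x - \<theta>\<bar> \<le> norm (cis x - cis \<theta>)" if "x \<in> {0..2 * pi}" for x
  proof -
    have "?g x0 * \<bar>x - \<theta>\<bar> \<le> ?g x * \<bar>x - \<theta>\<bar>"
      using min[OF that] by (rule mult_right_mono) simp
    also have "\<dots> = norm (cis x - cis \<theta>)"
    proof (cases "x = \<theta>")
      case False
      define y where "y = (x - \<theta>) / 2"
      have y: "y \<noteq> 0" "\<bar>x - \<theta>\<bar> = 2 * \<bar>y\<bar>" using False by (simp_all add: y_def)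
      then show ?thesis by (simp add: norm_cis_diff y_def[symmetric] abs_divide)
    qed simp
    finally show ?thesis .
  qed
  ultimately show ?thesis by blast
qed

lemma measure_torus_eq:
  fixes A :: "('n::finite \<Rightarrow> complex) set"
  assumes A: "A \<in> sets torus_measure"
  shows "measure torus_measure A = measure lborel (angle_box \<inter> torus_point -` A) / (2 * pi) ^ CARD('n)"
proof -
  have tp: "torus_point \<in> measurable (uniform_measure lborel angle_box) (torus_measure :: ('n \<Rightarrow> complex) measure)"
    using torus_point_measurable by (simp cong: measurable_cong_sets)
  have meas: "torus_point -` A \<in> sets borel"
    using measurable_sets[OF torus_point_measurable A] by simp
  have "emeasure torus_measure A = emeasure (uniform_measure lborel angle_box) (torus_point -` A)"
    by (subst torus_measure_eq_distr, subst emeasure_distr[OF tp A]) simp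
  also have "\<dots> = emeasure lborel (angle_box \<inter> torus_point -` A) / emeasure lborel (angle_box :: (real ^ 'n) set)"
    by (rule emeasure_uniform_measure) (use meas in auto)
  finally have eq: "emeasure torus_measure A
    = emeasure lborel (angle_box \<inter> torus_point -` A) / ennreal ((2 * pi) ^ CARD('n))"
    by (simp add: emeasure_angle_box)
  have "emeasure lborel (angle_box \<inter> torus_point -` A) \<le> emeasure lborel (angle_box :: (real ^ 'n) set)"
    by (rule emeasure_mono) auto
  then have "emeasure lborel (angle_box \<inter> torus_point -` A) \<noteq> \<top>"
    by (rule neq_top_trans[rotated]) (simp add: emeasure_angle_box)
  then have "emeasure torus_measure A
      = ennreal (measure lborel (angle_box \<inter> torus_point -` A) / (2 * pi) ^ CARD('n))"
    unfolding eq by (simp add: emeasure_eq_ennreal_measure divide_ennreal)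
  then show ?thesis by (rule measure_eq_emeasure_eq_ennreal[rotated]) simp
qed

text \<open>Near \<open>\<zeta>\<close> the Poisson kernel is at most \<open>(2 / (1 - r))\<^sup>n\<close>; far from \<open>\<zeta>\<close> in some
  coordinate it has small mass.\<close>

lemma poisson_integral_le:
  fixes \<zeta> :: "'n::finite \<Rightarrow> complex"
  assumes A: "A \<in> sets torus_measure" and \<zeta>: "\<And>j. norm (\<zeta> j) = 1"
    and r: "0 \<le> r" "r < 1" and t: "0 < t" "t < 1"
  shows "(LINT z|torus_measure. indicator A z * poisson (\<lambda>j. of_real r * \<zeta> j) z)
    \<le> (2 / (1 - r)) ^ CARD('n) * measure torus_measure (A \<inter> {z. \<forall>j. norm (z j - \<zeta> j) \<le> t})
      + real CARD('n) * (32 * (1 - r) / t)"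
proof -
  interpret prob_space "torus_measure :: ('n \<Rightarrow> complex) measure" by (rule prob_space_torus)
  let ?P = "poisson (\<lambda>j. of_real r * \<zeta> j)"
  let ?Q = "\<lambda>i. poisson (\<lambda>j. of_real (if j = i then 1 - t else r) * \<zeta> j)"
  let ?D = "{z. \<forall>j. norm (z j - \<zeta> j) \<le> t}"
  let ?c = "(2 / (1 - r)) ^ CARD('n)" and ?d = "32 * (1 - r) / t"
  note [measurable] = A
  have lt: "norm (of_real r * \<zeta> j) < 1" "norm (of_real (if j = i then 1 - t else r) * \<zeta> j) < 1" for i j
    using \<zeta> r t by (auto simp: norm_mult simp del: of_real_diff)
  have "A \<inter> ?D = A \<inter> {z\<in>space torus_measure. \<forall>j\<in>UNIV. norm (z j - \<zeta> j) \<le> t}"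
    using sets.sets_into_space[OF A] by auto
  also have "\<dots> \<in> sets torus_measure" by measurable
  finally have [measurable]: "A \<inter> ?D \<in> sets torus_measure" .
  have int_D: "integrable torus_measure (\<lambda>z. ?c * indicator (A \<inter> ?D) z)"
    by (intro integrable_mult_right integrable_real_indicator) (auto simp: emeasure_eq_measure)
  have int_Q: "integrable torus_measure (\<lambda>z. ?d * ?Q i z)" for i
    by (intro integrable_mult_right integrable_poisson lt)
  have "(LINT z|torus_measure. indicator A z * ?P z)
      \<le> (LINT z|torus_measure. ?c * indicator (A \<inter> ?D) z + (\<Sum>i\<in>UNIV. ?d * ?Q i z))"
  proof (rule integral_mono)
    show "integrable torus_measure (\<lambda>z. indicator A z * ?P z)"
      using integrable_real_mult_indicator[OF A integrable_poisson[OF lt(1)]]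
      by (simp only: mult.commute)
    show "integrable torus_measure (\<lambda>z. ?c * indicator (A \<inter> ?D) z + (\<Sum>i\<in>UNIV. ?d * ?Q i z))"
      by (intro Bochner_Integration.integrable_add Bochner_Integration.integrable_sum int_D int_Q)
    fix z :: "'n \<Rightarrow> complex" assume "z \<in> space torus_measure"
    then have z: "norm (z j) = 1" for j by (rule norm_torus)
    have P: "0 \<le> ?P z" and Q: "0 \<le> ?Q i z" for i using lt by (auto intro: poisson_nonneg)
    have sum: "0 \<le> (\<Sum>i\<in>UNIV. ?d * ?Q i z)" using Q r t by (intro sum_nonneg) simp
    consider "z \<notin> A" | "z \<in> A" "z \<in> ?D" | i where "z \<in> A" "t < norm (z i - \<zeta> i)"
      using linorder_not_le by blast
    then show "indicator A z * ?P z \<le> ?c * indicator (A \<inter> ?D) z + (\<Sum>i\<in>UNIV. ?d * ?Q i z)"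
    proof cases
      case 1
      then show ?thesis using sum by simp
    next
      case 2
      have "?P z \<le> ?c" using \<zeta> r z by (intro poisson_le) (simp_all add: norm_mult)
      then show ?thesis using 2 sum by simp
    next
      case 3
      have "?P z \<le> ?d * ?Q i z" using \<zeta> z r t 3 by (intro poisson_tail_le) auto
      also have "\<dots> \<le> (\<Sum>i\<in>UNIV. ?d * ?Q i z)"
        using Q r t by (intro member_le_sum) auto
      finally have "?P z \<le> (\<Sum>i\<in>UNIV. ?d * ?Q i z)" .
      moreover have "0 \<le> ?c * indicator (A \<inter> ?D) z" using r by simp
      moreover have "indicator A z * ?P z = ?P z" using 3 by simp
      ultimately show ?thesis by linarith
    qed
  qed
  also have "\<dots> = (LINT z|torus_measure. ?c * indicator (A \<inter> ?D) z) + (\<Sum>i\<in>UNIV. LINT z|torus_measure. ?d * ?Q i z)"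
    unfolding Bochner_Integration.integral_sum[OF int_Q, symmetric]
    by (intro Bochner_Integration.integral_add int_D Bochner_Integration.integrable_sum int_Q)
  also have "(LINT z|torus_measure. ?c * indicator (A \<inter> ?D) z) = ?c * measure torus_measure (A \<inter> ?D)"
    by simp
  also have "(\<Sum>i\<in>UNIV. LINT z|torus_measure. ?d * ?Q i z) = real CARD('n) * ?d"
    unfolding integral_mult_right_zero by (subst torus_integral_poisson[OF lt(2)]) simp
  finally show ?thesis .
qed

lemma torus_point_near:
  fixes \<theta> :: "real ^ 'n::finite"
  assumes c: "0 < c" "\<And>j x. x \<in> {0..2 * pi} \<Longrightarrow> c * \<bar>x - \<theta> $ j\<bar> \<le> norm (cis x - cis (\<theta> $ j))"
    and x: "x \<in> angle_box" "\<And>j. norm (torus_point x j - torus_point \<theta> j) \<le> t" and t: "0 < t"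
  shows "x \<in> ball \<theta> ((real CARD('n) + 1) * t / c)"
proof -
  have "\<bar>(x - \<theta>) $ j\<bar> \<le> t / c" for j
    using c(2)[of "x $ j" j] x(1) x(2)[of j] c(1)
    by (auto simp: angle_box_def torus_point_def pos_le_divide_eq mult.commute intro: order.trans less_imp_le)
  then have "(\<Sum>j\<in>UNIV. \<bar>(x - \<theta>) $ j\<bar>) \<le> real CARD('n) * (t / c)"
    using sum_bounded_above[of UNIV "\<lambda>j. \<bar>(x - \<theta>) $ j\<bar>" "t / c"] by simp
  then have "norm (x - \<theta>) \<le> real CARD('n) * (t / c)"
    using norm_le_l1_cart[of "x - \<theta>"] by linarith
  also have "\<dots> < (real CARD('n) + 1) * t / c"
    using c(1) t by (simp add: field_simps)
  finally show ?thesis by (simp add: dist_norm norm_minus_commute)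
qed

text \<open>Split at the distance \<open>t = K (1 - r)\<close> from \<open>\<zeta>\<close>.  The far part is of order \<open>1 / K\<close>, uniformly in
  \<open>r\<close>.  For fixed \<open>K\<close> the near part is at most a constant times the density of the set in a ball of
  radius proportional to \<open>1 - r\<close>.\<close>

lemma poisson_integral_tendsto_0:
  fixes \<theta> :: "real ^ 'n::finite"
  assumes A: "A \<in> sets torus_measure" and \<theta>: "\<And>j. 0 < \<theta> $ j" "\<And>j. \<theta> $ j < 2 * pi"
    and density: "\<And>e. 0 < e \<Longrightarrow> \<exists>d>0. \<forall>\<rho>>0. \<rho> < d \<longrightarrow>
      measure lborel ((angle_box \<inter> torus_point -` A) \<inter> ball \<theta> \<rho>) \<le> e * measure lborel (ball \<theta> \<rho>)"
  shows "((\<lambda>r. LINT z|torus_measure. indicator A z * poisson (\<lambda>j. of_real r * torus_point \<theta> j) z) \<longlongrightarrow> 0)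
    (at_left 1)"
proof (rule tendstoI)
  fix \<epsilon> :: real assume \<epsilon>: "0 < \<epsilon>"
  let ?n = "CARD('n)" and ?S = "angle_box \<inter> torus_point -` A" and ?\<zeta> = "torus_point \<theta>"
  have \<zeta>: "norm (?\<zeta> j) = 1" for j by (simp add: torus_point_def)
  have "\<exists>c>0. \<forall>x\<in>{0..2 * pi}. c * \<bar>x - \<theta> $ j\<bar> \<le> norm (cis x - cis (\<theta> $ j))" for j
    by (rule norm_cis_diff_ge) (use \<theta> in auto)
  then obtain c' where c': "0 < c' j" "x \<in> {0..2 * pi} \<Longrightarrow> c' j * \<bar>x - \<theta> $ j\<bar> \<le> norm (cis x - cis (\<theta> $ j))" for j x
    by metis
  define c where "c = Min (range c')"
  have c: "0 < c" "c \<le> c' j" for j using c'(1) by (auto simp: c_def)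
  have chord: "c * \<bar>x - \<theta> $ j\<bar> \<le> norm (cis x - cis (\<theta> $ j))" if "x \<in> {0..2 * pi}" for j x
    using mult_right_mono[OF c(2)[of j], of "\<bar>x - \<theta> $ j\<bar>"] c'(2)[OF that, of j] by simp
  \<comment> \<open>The constant \<open>K\<close> makes the mass far from \<open>\<zeta>\<close> less than \<open>\<epsilon> / 2\<close>, at any radius.\<close>
  define K where "K = 64 * real ?n / \<epsilon> + 1"
  have K: "0 < K" "32 * real ?n < \<epsilon> / 2 * K"
    using \<epsilon> by (auto simp: K_def field_simps add_pos_nonneg)
  define R where "R = (real ?n + 1) * K / c"
  have R: "0 < R" using K c by (simp add: R_def)
  define W where "W = measure lborel (ball (0 :: real ^ 'n) 1) * (R / pi) ^ ?n"
  have W: "0 \<le> W" using R by (simp add: W_def)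
  define e where "e = \<epsilon> / (2 * (W + 1))"
  have e: "0 < e" "e * W \<le> \<epsilon> / 2" using \<epsilon> W by (auto simp: e_def field_simps)
  obtain d where d: "0 < d" "\<And>\<rho>. 0 < \<rho> \<Longrightarrow> \<rho> < d \<Longrightarrow>
      measure lborel (?S \<inter> ball \<theta> \<rho>) \<le> e * measure lborel (ball \<theta> \<rho>)"
    using density[OF e(1)] by blast
  have bound: "(LINT z|torus_measure. indicator A z * poisson (\<lambda>j. of_real r * ?\<zeta> j) z) < \<epsilon>"
    if r: "0 \<le> r" "r < 1" and small: "K * (1 - r) < 1" "R * (1 - r) < d" for r
  proof -
    let ?t = "K * (1 - r)" and ?\<rho> = "R * (1 - r)" and ?D = "{z. \<forall>j. norm (z j - ?\<zeta> j) \<le> K * (1 - r)}"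
    have t: "0 < ?t" and \<rho>: "0 < ?\<rho>" using K R r by auto
    have AD: "A \<inter> ?D \<in> sets torus_measure"
    proof -
      note [measurable] = A
      have "A \<inter> ?D = A \<inter> {z\<in>space torus_measure. \<forall>j\<in>UNIV. norm (z j - ?\<zeta> j) \<le> ?t}"
        using sets.sets_into_space[OF A] by auto
      also have "\<dots> \<in> sets torus_measure" by measurable
      finally show ?thesis .
    qed
    have "measure lborel (angle_box \<inter> torus_point -` (A \<inter> ?D)) \<le> measure lborel (?S \<inter> ball \<theta> ?\<rho>)"
    proof (rule measure_mono_fmeasurable)
      show "angle_box \<inter> torus_point -` (A \<inter> ?D) \<subseteq> ?S \<inter> ball \<theta> ?\<rho>"
        using torus_point_near[OF c(1) chord _ _ t] by (auto simp: R_def mult_ac)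
      show "angle_box \<inter> torus_point -` (A \<inter> ?D) \<in> sets lborel"
        using measurable_sets[OF torus_point_measurable AD] by auto
      have "?S \<inter> ball \<theta> ?\<rho> \<in> sets lborel"
        using measurable_sets[OF torus_point_measurable A] by auto
      moreover have "emeasure lborel (?S \<inter> ball \<theta> ?\<rho>) < \<infinity>"
        by (rule le_less_trans[OF emeasure_mono emeasure_lborel_ball_finite]) auto
      ultimately show "?S \<inter> ball \<theta> ?\<rho> \<in> fmeasurable lborel" by (rule fmeasurableI)
    qed
    also have "\<dots> \<le> e * measure lborel (ball \<theta> ?\<rho>)" using \<rho> small(2) by (rule d(2))
    also have "measure lborel (ball \<theta> ?\<rho>) = ?\<rho> ^ ?n * measure lborel (ball (0 :: real ^ 'n) 1)"
      using content_ball_conv_unit_ball[of ?\<rho> \<theta>] \<rho> by simp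
    finally have vol: "measure torus_measure (A \<inter> ?D)
        \<le> e * (?\<rho> ^ ?n * measure lborel (ball (0 :: real ^ 'n) 1)) / (2 * pi) ^ ?n"
      unfolding measure_torus_eq[OF AD] by (rule divide_right_mono) simp
    have "(2 / (1 - r)) ^ ?n * measure torus_measure (A \<inter> ?D)
        \<le> (2 / (1 - r)) ^ ?n * (e * (?\<rho> ^ ?n * measure lborel (ball (0 :: real ^ 'n) 1)) / (2 * pi) ^ ?n)"
      by (rule mult_left_mono[OF vol]) (use r in simp)
    also have "\<dots> = e * W"
      using r by (simp add: W_def power_mult_distrib power_divide)
    also have "\<dots> \<le> \<epsilon> / 2" by (rule e(2))
    finally have near: "(2 / (1 - r)) ^ ?n * measure torus_measure (A \<inter> ?D) \<le> \<epsilon> / 2" .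
    have "32 * (1 - r) / ?t = 32 / K" using r by (intro nonzero_mult_divide_mult_cancel_right) simp
    then have "real ?n * (32 * (1 - r) / ?t) = 32 * real ?n / K" by simp
    also have "\<dots> < \<epsilon> / 2" using K by (simp add: pos_divide_less_eq)
    finally have far: "real ?n * (32 * (1 - r) / ?t) < \<epsilon> / 2" .
    show ?thesis using poisson_integral_le[OF A, of ?\<zeta>, OF \<zeta> r t small(1)] near far by linarith
  qed
  have "\<forall>\<^sub>F r in at_left (1::real). 0 \<le> r \<and> r < 1 \<and> K * (1 - r) < 1 \<and> R * (1 - r) < d"
    unfolding eventually_at_left_field
  proof (intro exI conjI allI impI)
    let ?b = "1 - Min {1, 1 / K, d / R}"
    show "?b < 1" using K R d by simp
    fix y assume y: "?b < y" "y < 1"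
    then have "1 - y < 1" "1 - y < 1 / K" "1 - y < d / R" by auto
    then show "0 \<le> y" "K * (1 - y) < 1" "R * (1 - y) < d"
      using K R by (auto simp: pos_less_divide_eq mult.commute)
    show "y < 1" by (rule y)
  qed
  then show "\<forall>\<^sub>F r in at_left 1.
      dist (LINT z|torus_measure. indicator A z * poisson (\<lambda>j. of_real r * ?\<zeta> j) z) 0 < \<epsilon>"
  proof eventually_elim
    case (elim r)
    have "0 \<le> (LINT z|torus_measure. indicator A z * poisson (\<lambda>j. of_real r * ?\<zeta> j) z)"
      using elim \<zeta> by (intro integral_nonneg_AE AE_I2 mult_nonneg_nonneg poisson_nonneg) (auto simp: norm_mult)
    then show ?case using bound[of r] elim by simp
  qed
qed

lemma AE_poisson_integral_tendsto_0:
  assumes A: "A \<in> sets (torus_measure :: ('n::finite \<Rightarrow> complex) measure)"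
  shows "AE \<zeta> in torus_measure. \<zeta> \<notin> A \<longrightarrow>
    ((\<lambda>r. LINT z|torus_measure. indicator A z * poisson (\<lambda>j. of_real r * \<zeta> j) z) \<longlongrightarrow> 0) (at_left 1)"
proof (rule AE_torusI)
  let ?S = "angle_box \<inter> torus_point -` A"
  have "?S \<in> sets borel"
    using measurable_sets[OF torus_point_measurable A] by auto
  then have dens: "AE x in lborel. x \<notin> ?S \<longrightarrow> (\<forall>e>0. \<exists>d>0. \<forall>\<rho>>0. \<rho> < d \<longrightarrow>
      measure lborel (?S \<inter> ball x \<rho>) \<le> e * measure lborel (ball x \<rho>))"
    by (rule AE_density_zero)
  have "AE x in lebesgue. x \<notin> {x :: real ^ 'n. x $ j = 0}" for j
    by (intro AE_not_in) (simp add: negligible_iff_null_sets[symmetric] negligible_standard_hyperplane_cart)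
  then have "AE x in lborel. \<forall>j. (x :: real ^ 'n) $ j \<noteq> 0"
    by (simp add: AE_completion_iff AE_all_countable)
  with dens show "AE x in lborel. x \<in> angle_box \<longrightarrow> torus_point x \<notin> A \<longrightarrow>
    ((\<lambda>r. LINT z|torus_measure. indicator A z * poisson (\<lambda>j. of_real r * torus_point x j) z) \<longlongrightarrow> 0) (at_left 1)"
  proof eventually_elim
    case (elim x)
    show ?case
    proof (intro impI poisson_integral_tendsto_0[OF A])
      assume x: "x \<in> angle_box" "torus_point x \<notin> A"
      then have ge: "0 \<le> x $ j" and lt: "x $ j < 2 * pi" for j by (auto simp: angle_box_def)
      show "x $ j < 2 * pi" for j by (rule lt)
      show "0 < x $ j" for j using ge[of j] elim(2) by (simp add: order_less_le)
      have "x \<notin> ?S" using x by simp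
      then show "\<exists>d>0. \<forall>\<rho>>0. \<rho> < d \<longrightarrow> measure lborel (?S \<inter> ball x \<rho>) \<le> e * measure lborel (ball x \<rho>)" if "0 < e" for e
        using elim(1) that by blast
    qed
  qed
qed

text \<open>The sets on which \<open>\<phi>\<close> leaves a ball with centre in a countable dense set have, at almost
  every point where \<open>\<phi>\<close> is in the ball, vanishing Poisson mass.  On the rest \<open>\<phi>\<close> differs from
  its value at that point by at most the diameter of the ball.\<close>

theorem AE_poisson_oscillation_tendsto_0:
  fixes \<phi> :: "('n::finite \<Rightarrow> complex) \<Rightarrow> complex"
  assumes \<phi>: "essentially_bounded \<phi>"
  shows "AE \<zeta> in torus_measure.
    ((\<lambda>r. LINT z|torus_measure. (norm (\<phi> z - \<phi> \<zeta>))\<^sup>2 * poisson (\<lambda>j. of_real r * \<zeta> j) z) \<longlongrightarrow> 0) (at_left 1)"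
proof -
  have [measurable]: "\<phi> \<in> borel_measurable torus_measure"
    using \<phi> by (simp add: essentially_bounded_def)
  obtain C where C: "AE z in torus_measure. norm (\<phi> z) \<le> C"
    using \<phi> by (auto simp: essentially_bounded_def)
  obtain Q :: "complex set" where Q: "countable Q" "\<And>X. open X \<Longrightarrow> X \<noteq> {} \<Longrightarrow> \<exists>q\<in>Q. q \<in> X"
    by (rule countable_dense_setE) blast
  define A where "A q m = {z \<in> space torus_measure. inverse (real (Suc m)) \<le> dist (\<phi> z) q}" for q m
  have A[measurable]: "A q m \<in> sets torus_measure" for q m
    unfolding A_def by measurable
  have "AE \<zeta> in torus_measure. \<forall>q\<in>Q. \<forall>m. \<zeta> \<notin> A q m \<longrightarrow>
    ((\<lambda>r. LINT z|torus_measure. indicator (A q m) z * poisson (\<lambda>j. of_real r * \<zeta> j) z) \<longlongrightarrow> 0) (at_left 1)"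
    using AE_poisson_integral_tendsto_0[OF A] Q(1) by (simp add: AE_ball_countable AE_all_countable)
  then show ?thesis
  proof (rule AE_mp, intro AE_I2 impI)
    fix \<zeta> :: "'n \<Rightarrow> complex"
    assume space: "\<zeta> \<in> space torus_measure"
    assume lim: "\<forall>q\<in>Q. \<forall>m. \<zeta> \<notin> A q m \<longrightarrow>
      ((\<lambda>r. LINT z|torus_measure. indicator (A q m) z * poisson (\<lambda>j. of_real r * \<zeta> j) z) \<longlongrightarrow> 0) (at_left 1)"
    have \<zeta>: "norm (\<zeta> j) = 1" for j using space by (rule norm_torus)
    define B where "B = (\<bar>C\<bar> + norm (\<phi> \<zeta>))\<^sup>2"
    let ?I = "\<lambda>r. LINT z|torus_measure. (norm (\<phi> z - \<phi> \<zeta>))\<^sup>2 * poisson (\<lambda>j. of_real r * \<zeta> j) z"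
    show "(?I \<longlongrightarrow> 0) (at_left 1)"
    proof (rule tendstoI)
      fix e :: real assume e: "0 < e"
      obtain m where m: "inverse (real (Suc m)) < sqrt (e / 2) / 2"
        using reals_Archimedean[of "sqrt (e / 2) / 2"] e by auto
      let ?s = "inverse (real (Suc m))"
      have s: "(2 * ?s)\<^sup>2 < e / 2"
      proof -
        have "(2 * ?s)\<^sup>2 < (sqrt (e / 2))\<^sup>2" using m by (intro power_strict_mono) auto
        then show ?thesis using e by simp
      qed
      obtain q where q: "q \<in> Q" "dist (\<phi> \<zeta>) q < ?s"
        using Q(2)[of "ball (\<phi> \<zeta>) ?s"] by (auto simp del: of_nat_Suc)
      then have "\<zeta> \<notin> A q m" by (auto simp: A_def)
      let ?J = "\<lambda>r. LINT z|torus_measure. indicator (A q m) z * poisson (\<lambda>j. of_real r * \<zeta> j) z"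
      have "((\<lambda>r. B * ?J r) \<longlongrightarrow> 0) (at_left 1)"
        using lim q \<open>\<zeta> \<notin> A q m\<close> by (intro tendsto_mult_right_zero) auto
      then have "\<forall>\<^sub>F r in at_left 1. B * ?J r < e / 2"
        by (rule order_tendstoD) (use e in simp)
      moreover have "\<forall>\<^sub>F r in at_left (1::real). 0 < r \<and> r < 1"
        using eventually_at_left_real[of 0 1] by (auto elim: eventually_mono)
      ultimately show "\<forall>\<^sub>F r in at_left 1. dist (?I r) 0 < e"
      proof eventually_elim
        case (elim r)
        let ?P = "poisson (\<lambda>j. of_real r * \<zeta> j)"
        have lt: "norm (of_real r * \<zeta> j) < 1" for j using elim \<zeta> by (simp add: norm_mult)
        have P: "0 \<le> ?P z" for z using lt by (rule poisson_nonneg)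
        have ae: "AE z in torus_measure. (norm (\<phi> z - \<phi> \<zeta>))\<^sup>2 * ?P z
            \<le> (2 * ?s)\<^sup>2 * ?P z + B * (indicator (A q m) z * ?P z)"
          using C
        proof (rule AE_mp, intro AE_I2 impI)
          fix z :: "'n \<Rightarrow> complex" assume z: "z \<in> space torus_measure" "norm (\<phi> z) \<le> C"
          have "(norm (\<phi> z - \<phi> \<zeta>))\<^sup>2 \<le> (2 * ?s)\<^sup>2 + B * indicator (A q m) z"
          proof (cases "z \<in> A q m")
            case True
            have "norm (\<phi> z - \<phi> \<zeta>) \<le> \<bar>C\<bar> + norm (\<phi> \<zeta>)"
              using norm_triangle_ineq4[of "\<phi> z" "\<phi> \<zeta>"] z by linarith
            then have "(norm (\<phi> z - \<phi> \<zeta>))\<^sup>2 \<le> B" unfolding B_def by (intro power_mono) auto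
            then show ?thesis using True by (simp add: add_increasing)
          next
            case False
            then have "dist (\<phi> z) q < ?s" using z by (auto simp: A_def)
            then have "dist (\<phi> z) (\<phi> \<zeta>) \<le> 2 * ?s"
              using q(2) dist_triangle2[of "\<phi> z" "\<phi> \<zeta>" q] by linarith
            then have "(norm (\<phi> z - \<phi> \<zeta>))\<^sup>2 \<le> (2 * ?s)\<^sup>2"
              unfolding dist_norm by (intro power_mono) auto
            then show ?thesis using False by simp
          qed
          then have "(norm (\<phi> z - \<phi> \<zeta>))\<^sup>2 * ?P z \<le> ((2 * ?s)\<^sup>2 + B * indicator (A q m) z) * ?P z"
            by (rule mult_right_mono) (rule P)
          then show "(norm (\<phi> z - \<phi> \<zeta>))\<^sup>2 * ?P z
              \<le> (2 * ?s)\<^sup>2 * ?P z + B * (indicator (A q m) z * ?P z)"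
            by (simp only: distrib_right mult.assoc)
        qed
        have int: "integrable torus_measure ?P" using lt by (rule integrable_poisson)
        have int_A: "integrable torus_measure (\<lambda>z. indicator (A q m) z * ?P z)"
          using integrable_real_mult_indicator[OF A int, of q m] by (simp only: mult.commute)
        have "?I r \<le> (LINT z|torus_measure. (2 * ?s)\<^sup>2 * ?P z + B * (indicator (A q m) z * ?P z))"
        proof (rule integral_mono_AE)
          show rhs: "integrable torus_measure (\<lambda>z. (2 * ?s)\<^sup>2 * ?P z + B * (indicator (A q m) z * ?P z))"
            using int int_A by (intro Bochner_Integration.integrable_add integrable_mult_right)
          show "integrable torus_measure (\<lambda>z. (norm (\<phi> z - \<phi> \<zeta>))\<^sup>2 * ?P z)"
            using ae by (intro Bochner_Integration.integrable_bound[OF rhs])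
              (auto elim!: eventually_mono simp: P intro: order.trans[OF _ abs_ge_self])
        qed (rule ae)
        also have "\<dots> = (2 * ?s)\<^sup>2 * (LINT z|torus_measure. ?P z) + B * ?J r"
          using int int_A by (subst Bochner_Integration.integral_add) (auto simp only: integrable_mult_right integral_mult_right_zero)
        also have "(LINT z|torus_measure. ?P z) = 1" using lt by (rule torus_integral_poisson)
        finally have "?I r < e" using s elim by simp
        moreover have "0 \<le> ?I r" using P by (intro integral_nonneg_AE AE_I2) simp
        ultimately show ?case by simp
      qed
    qed
  qed
qed

section \<open>Operators with asymptotic eigenvalues on the kernels\<close>

definition radial_kernel :: "('n::finite \<Rightarrow> complex) \<Rightarrow> real \<Rightarrow> 'n h2" where
  "radial_kernel \<zeta> r = kernel (\<lambda>j. complex_of_real r * \<zeta> j)"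

text \<open>The eigenvalue depends on the limit point \<open>\<zeta>\<close> and not on \<open>r \<zeta>\<close>, so this is not an instance of
  \<open>radially_tendsto\<close>.\<close>

definition kernel_eigenvalue :: "('n::finite h2 \<Rightarrow>\<^sub>L 'n h2) \<Rightarrow> (('n \<Rightarrow> complex) \<Rightarrow> complex) \<Rightarrow> bool" where
  "kernel_eigenvalue T f \<longleftrightarrow> (AE \<zeta> in torus_measure.
     ((\<lambda>r. blinfun_apply T (radial_kernel \<zeta> r) - f \<zeta> *\<^sub>C radial_kernel \<zeta> r) \<longlongrightarrow> 0) (at_left 1))"

text \<open>The condition on the adjoint does not follow from the one on \<open>T\<close>, and it makes the
  notion stable under adjoints.\<close>

definition has_symbol :: "('n::finite h2 \<Rightarrow>\<^sub>L 'n h2) \<Rightarrow> 'n linf \<Rightarrow> bool" where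
  "has_symbol T \<phi> \<longleftrightarrow> T \<in> bounded_operators \<and> kernel_eigenvalue T (rep_linf \<phi>) \<and>
     kernel_eigenvalue (adjoint_op T) (\<lambda>\<zeta>. cnj (rep_linf \<phi> \<zeta>))"

lemma eventually_unit_at_left: "\<forall>\<^sub>F r in at_left (1::real). 0 < r \<and> r < 1"
  using eventually_at_left_real[of 0 1] by (auto elim: eventually_mono)

lemma norm_radial_lt_1:
  assumes "\<zeta> \<in> space torus_measure" "0 < r" "r < 1"
  shows "norm (complex_of_real r * \<zeta> j) < 1"
  using assms by (simp add: norm_mult norm_torus)

lemma eventually_norm_radial_kernel:
  assumes "\<zeta> \<in> space torus_measure"
  shows "\<forall>\<^sub>F r in at_left 1. norm (radial_kernel \<zeta> r) = 1"
  using eventually_unit_at_left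
  by eventually_elim (auto simp: radial_kernel_def intro!: norm_kernel norm_radial_lt_1[OF assms])

lemma tendsto_scaleC_zero:
  "(f \<longlongrightarrow> 0) F \<Longrightarrow> ((\<lambda>x. c *\<^sub>C (f x :: 'a::complex_inner)) \<longlongrightarrow> 0) F"
  by (rule bounded_linear.tendsto_zero[OF bounded_linear_scaleC])

lemma tendsto_blinfun_zero:
  "(f \<longlongrightarrow> 0) F \<Longrightarrow> ((\<lambda>x. blinfun_apply T (f x)) \<longlongrightarrow> 0) F"
  by (rule bounded_linear.tendsto_zero[OF blinfun.bounded_linear_right])

lemma kernel_eigenvalue_cong:
  assumes "kernel_eigenvalue T f" "AE \<zeta> in torus_measure. g \<zeta> = f \<zeta>"
  shows "kernel_eigenvalue T g"
  using assms unfolding kernel_eigenvalue_def by eventually_elim simp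

lemma kernel_eigenvalue_add:
  assumes "kernel_eigenvalue S f" "kernel_eigenvalue T g"
  shows "kernel_eigenvalue (S + T) (\<lambda>\<zeta>. f \<zeta> + g \<zeta>)"
  using assms unfolding kernel_eigenvalue_def
proof eventually_elim
  case (elim \<zeta>)
  from tendsto_add[OF this] show ?case
    by (simp add: blinfun.add_left scaleC_add_left algebra_simps)
qed

lemma kernel_eigenvalue_diff:
  assumes "kernel_eigenvalue S f" "kernel_eigenvalue T g"
  shows "kernel_eigenvalue (S - T) (\<lambda>\<zeta>. f \<zeta> - g \<zeta>)"
  using assms unfolding kernel_eigenvalue_def
proof eventually_elim
  case (elim \<zeta>)
  from tendsto_diff[OF this] show ?case
    by (simp add: blinfun.diff_left scaleC_diff_left algebra_simps)
qed

lemma kernel_eigenvalue_scale: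
  assumes "kernel_eigenvalue T f"
  shows "kernel_eigenvalue (scale_op c T) (\<lambda>\<zeta>. c * f \<zeta>)"
  using assms unfolding kernel_eigenvalue_def
proof eventually_elim
  case (elim \<zeta>)
  from tendsto_scaleC_zero[OF this, of c] show ?case
    by (simp add: scale_op_apply scaleC_diff_right scaleC_scaleC)
qed

text \<open>As for common eigenvectors: \<open>S T k - f g k = S (T k - g k) + g (S k - f k)\<close>.\<close>

lemma kernel_eigenvalue_compose:
  assumes S: "S \<in> bounded_operators" and "kernel_eigenvalue S f" "kernel_eigenvalue T g"
  shows "kernel_eigenvalue (S o\<^sub>L T) (\<lambda>\<zeta>. f \<zeta> * g \<zeta>)"
  using assms(2,3) unfolding kernel_eigenvalue_def
proof eventually_elim
  case (elim \<zeta>)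
  from tendsto_add[OF tendsto_blinfun_zero[OF elim(2), of S] tendsto_scaleC_zero[OF elim(1), of "g \<zeta>"]]
  show ?case
    by (simp add: blinfun.diff_right bounded_operators_scaleC[OF S] scaleC_diff_right scaleC_scaleC
        mult.commute)
qed

text \<open>Fatou's theorem for the Poisson integrals of \<open>|\<phi> - \<phi>(\<zeta>)|\<^sup>2\<close>, read as a statement on norms.\<close>

lemma kernel_eigenvalue_toeplitz: "kernel_eigenvalue (toeplitz \<phi>) (rep_linf \<phi>)"
  unfolding kernel_eigenvalue_def
  using AE_poisson_oscillation_tendsto_0[OF essentially_bounded_rep_linf[of \<phi>]] AE_space
proof eventually_elim
  case (elim \<zeta>)
  let ?I = "\<lambda>r. LINT z|torus_measure. (norm (rep_linf \<phi> z - rep_linf \<phi> \<zeta>))\<^sup>2 * poisson (\<lambda>j. of_real r * \<zeta> j) z"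
  let ?D = "\<lambda>r. blinfun_apply (toeplitz \<phi>) (radial_kernel \<zeta> r) - rep_linf \<phi> \<zeta> *\<^sub>C radial_kernel \<zeta> r"
  have "((\<lambda>r. sqrt (?I r)) \<longlongrightarrow> sqrt 0) (at_left 1)"
    using elim(1) by (rule tendsto_real_sqrt)
  moreover have "\<forall>\<^sub>F r in at_left 1. norm (?D r) \<le> sqrt (?I r)"
    using eventually_unit_at_left
  proof eventually_elim
    case (elim r)
    have "(norm (?D r))\<^sup>2 \<le> ?I r"
      unfolding radial_kernel_def
      by (rule norm_toeplitz_kernel_le) (use \<open>\<zeta> \<in> space torus_measure\<close> elim in \<open>auto intro: norm_radial_lt_1\<close>)
    then show ?case by (rule real_le_rsqrt)
  qed
  ultimately show ?case by (auto intro: Lim_null_comparison)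
qed

lemma kernel_eigenvalue_berezin:
  assumes "kernel_eigenvalue T f"
  shows "radially_tendsto (berezin T) f"
  using assms AE_space unfolding kernel_eigenvalue_def radially_tendsto_def
proof eventually_elim
  case (elim \<zeta>)
  let ?k = "radial_kernel \<zeta>"
  let ?D = "\<lambda>r. blinfun_apply T (?k r) - f \<zeta> *\<^sub>C ?k r"
  have "((\<lambda>r. berezin T (\<lambda>j. complex_of_real r * \<zeta> j) - f \<zeta>) \<longlongrightarrow> 0) (at_left 1)"
  proof (rule Lim_null_comparison)
    show "((\<lambda>r. norm (?D r)) \<longlongrightarrow> 0) (at_left 1)"
      using elim(1) by (rule tendsto_norm_zero)
    show "\<forall>\<^sub>F r in at_left 1. norm (berezin T (\<lambda>j. complex_of_real r * \<zeta> j) - f \<zeta>) \<le> norm (?D r)"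
      using eventually_norm_radial_kernel[OF elim(2)]
    proof eventually_elim
      case (elim r)
      have "berezin T (\<lambda>j. complex_of_real r * \<zeta> j) - f \<zeta> = cinner (?D r) (?k r)"
        using elim by (simp add: berezin_def radial_kernel_def cinner_diff_left cinner_scaleC_left cinner_self)
      also have "norm \<dots> \<le> norm (?D r) * norm (?k r)" by (rule norm_cinner_le)
      finally show ?case using elim by simp
    qed
  qed
  then show ?case by (rule LIM_zero_cancel)
qed

lemma kernel_eigenvalue_limit:
  assumes eig: "\<And>m. kernel_eigenvalue (X m) (f m)"
    and X: "X \<longlonglongrightarrow> T" and f: "AE \<zeta> in torus_measure. (\<lambda>m. f m \<zeta>) \<longlonglongrightarrow> g \<zeta>"
  shows "kernel_eigenvalue T g"
proof -
  have "AE \<zeta> in torus_measure. \<forall>m.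
      ((\<lambda>r. blinfun_apply (X m) (radial_kernel \<zeta> r) - f m \<zeta> *\<^sub>C radial_kernel \<zeta> r) \<longlongrightarrow> 0) (at_left 1)"
    using eig by (simp add: kernel_eigenvalue_def AE_all_countable)
  with f AE_space show ?thesis
    unfolding kernel_eigenvalue_def
  proof eventually_elim
    case (elim \<zeta>)
    let ?k = "radial_kernel \<zeta>"
    show ?case
    proof (rule tendstoI)
      fix e :: real assume "0 < e"
      then have "\<forall>\<^sub>F m in sequentially. dist (X m) T < e / 3 \<and> dist (f m \<zeta>) (g \<zeta>) < e / 3"
        using X elim(1) by (intro eventually_conj) (auto dest: tendstoD[of _ _ _ "e / 3"])
      then obtain m where m: "norm (T - X m) < e / 3" "norm (f m \<zeta> - g \<zeta>) < e / 3"
        by (auto simp: dist_norm norm_minus_commute dest: eventually_happens)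
      have "\<forall>\<^sub>F r in at_left 1. norm (blinfun_apply (X m) (?k r) - f m \<zeta> *\<^sub>C ?k r) < e / 3"
        using tendstoD[OF elim(3)[rule_format, of m], of "e / 3"] \<open>0 < e\<close> by simp
      then show "\<forall>\<^sub>F r in at_left 1. dist (blinfun_apply T (?k r) - g \<zeta> *\<^sub>C ?k r) 0 < e"
        using eventually_norm_radial_kernel[OF elim(2)]
      proof eventually_elim
        case (elim r)
        have "blinfun_apply T (?k r) - g \<zeta> *\<^sub>C ?k r
            = blinfun_apply (T - X m) (?k r) + (blinfun_apply (X m) (?k r) - f m \<zeta> *\<^sub>C ?k r)
              + (f m \<zeta> - g \<zeta>) *\<^sub>C ?k r"
          by (simp add: blinfun.diff_left scaleC_diff_left)
        also have "norm \<dots> \<le> norm (blinfun_apply (T - X m) (?k r))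
            + norm (blinfun_apply (X m) (?k r) - f m \<zeta> *\<^sub>C ?k r) + norm ((f m \<zeta> - g \<zeta>) *\<^sub>C ?k r)"
          by (intro norm_triangle_mono order_refl)
        also have "\<dots> < e / 3 + e / 3 + e / 3"
          using norm_blinfun[of "T - X m" "?k r"] m elim by (simp add: norm_scaleC)
        finally show ?case by simp
      qed
    qed
  qed
qed

text \<open>\<open>(f(\<zeta>) - g(\<zeta>)) k\<close> is asymptotically \<open>(S - T) k\<close>, and \<open>k\<close> is a unit vector.\<close>

lemma kernel_eigenvalue_dist_le:
  assumes S: "kernel_eigenvalue S f" and T: "kernel_eigenvalue T g"
  shows "AE \<zeta> in torus_measure. norm (f \<zeta> - g \<zeta>) \<le> norm (S - T)"
  using kernel_eigenvalue_diff[OF S T] AE_space unfolding kernel_eigenvalue_def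
proof eventually_elim
  case (elim \<zeta>)
  let ?k = "radial_kernel \<zeta>"
  let ?D = "\<lambda>r. blinfun_apply (S - T) (?k r) - (f \<zeta> - g \<zeta>) *\<^sub>C ?k r"
  have "((\<lambda>r. norm (S - T) + norm (?D r)) \<longlongrightarrow> norm (S - T) + 0) (at_left 1)"
    using elim(1) by (intro tendsto_intros tendsto_norm_zero)
  moreover have "\<forall>\<^sub>F r in at_left 1. norm (f \<zeta> - g \<zeta>) \<le> norm (S - T) + norm (?D r)"
    using eventually_norm_radial_kernel[OF elim(2)]
  proof eventually_elim
    case (elim r)
    then have "norm (f \<zeta> - g \<zeta>) = norm (blinfun_apply (S - T) (?k r) - ?D r)"
      by (simp add: norm_scaleC)
    also have "\<dots> \<le> norm (blinfun_apply (S - T) (?k r)) + norm (?D r)" by (rule norm_triangle_ineq4)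
    also have "\<dots> \<le> norm (S - T) + norm (?D r)"
      using norm_blinfun[of "S - T" "?k r"] elim by simp
    finally show ?case .
  qed
  ultimately show ?case
    by (intro tendsto_lowerbound[where F = "at_left (1::real)"]) auto
qed

lemma has_symbol_toeplitz: "has_symbol (toeplitz \<phi>) \<phi>"
  unfolding has_symbol_def adjoint_op_toeplitz
proof (intro conjI bounded_operators_toeplitz kernel_eigenvalue_toeplitz)
  show "kernel_eigenvalue (toeplitz (cnj_linf \<phi>)) (\<lambda>\<zeta>. cnj (rep_linf \<phi> \<zeta>))"
    using kernel_eigenvalue_toeplitz
    by (rule kernel_eigenvalue_cong) (use rep_linf_cnj[of \<phi>] in \<open>auto elim: eventually_mono\<close>)
qed

lemma has_symbol_add:
  assumes "has_symbol S \<phi>" "has_symbol T \<eta>"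
  shows "has_symbol (S + T) (\<phi> + \<eta>)"
  unfolding has_symbol_def
proof (intro conjI)
  show "S + T \<in> bounded_operators" using assms by (simp add: has_symbol_def bounded_operators_add)
  have S: "kernel_eigenvalue S (rep_linf \<phi>)" "kernel_eigenvalue (adjoint_op S) (\<lambda>\<zeta>. cnj (rep_linf \<phi> \<zeta>))"
    and T: "kernel_eigenvalue T (rep_linf \<eta>)" "kernel_eigenvalue (adjoint_op T) (\<lambda>\<zeta>. cnj (rep_linf \<eta> \<zeta>))"
    using assms by (simp_all add: has_symbol_def)
  show "kernel_eigenvalue (S + T) (rep_linf (\<phi> + \<eta>))"
    using kernel_eigenvalue_add[OF S(1) T(1)] rep_linf_add by (rule kernel_eigenvalue_cong)
  have "kernel_eigenvalue (adjoint_op S + adjoint_op T) (\<lambda>\<zeta>. cnj (rep_linf (\<phi> + \<eta>) \<zeta>))"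
    using kernel_eigenvalue_add[OF S(2) T(2)]
    by (rule kernel_eigenvalue_cong) (use rep_linf_add[of \<phi> \<eta>] in \<open>auto elim: eventually_mono\<close>)
  then show "kernel_eigenvalue (adjoint_op (S + T)) (\<lambda>\<zeta>. cnj (rep_linf (\<phi> + \<eta>) \<zeta>))"
    using assms by (simp add: has_symbol_def adjoint_op_add)
qed

lemma has_symbol_scale:
  assumes "has_symbol T \<phi>"
  shows "has_symbol (scale_op c T) (const_linf c * \<phi>)"
  unfolding has_symbol_def
proof (intro conjI)
  show "scale_op c T \<in> bounded_operators" using assms by (simp add: has_symbol_def bounded_operators_scale_op)
  have T: "kernel_eigenvalue T (rep_linf \<phi>)" "kernel_eigenvalue (adjoint_op T) (\<lambda>\<zeta>. cnj (rep_linf \<phi> \<zeta>))"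
    using assms by (simp_all add: has_symbol_def)
  have eq: "AE \<zeta> in torus_measure. rep_linf (const_linf c * \<phi>) \<zeta> = c * rep_linf \<phi> \<zeta>"
    using rep_linf_mult[of "const_linf c" \<phi>] rep_linf_const[of c] by eventually_elim simp
  show "kernel_eigenvalue (scale_op c T) (rep_linf (const_linf c * \<phi>))"
    using kernel_eigenvalue_scale[OF T(1)] eq by (rule kernel_eigenvalue_cong)
  have "kernel_eigenvalue (scale_op (cnj c) (adjoint_op T)) (\<lambda>\<zeta>. cnj (rep_linf (const_linf c * \<phi>) \<zeta>))"
    using kernel_eigenvalue_scale[OF T(2)]
    by (rule kernel_eigenvalue_cong) (use eq in \<open>auto elim: eventually_mono\<close>)
  then show "kernel_eigenvalue (adjoint_op (scale_op c T)) (\<lambda>\<zeta>. cnj (rep_linf (const_linf c * \<phi>) \<zeta>))"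
    using assms by (simp add: has_symbol_def adjoint_op_scale_op)
qed

lemma has_symbol_compose:
  assumes "has_symbol S \<phi>" "has_symbol T \<eta>"
  shows "has_symbol (S o\<^sub>L T) (\<phi> * \<eta>)"
  unfolding has_symbol_def
proof (intro conjI)
  have bdd: "S \<in> bounded_operators" "T \<in> bounded_operators"
    using assms by (simp_all add: has_symbol_def)
  then show "S o\<^sub>L T \<in> bounded_operators" by (rule bounded_operators_compose)
  have S: "kernel_eigenvalue S (rep_linf \<phi>)" "kernel_eigenvalue (adjoint_op S) (\<lambda>\<zeta>. cnj (rep_linf \<phi> \<zeta>))"
    and T: "kernel_eigenvalue T (rep_linf \<eta>)" "kernel_eigenvalue (adjoint_op T) (\<lambda>\<zeta>. cnj (rep_linf \<eta> \<zeta>))"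
    using assms by (simp_all add: has_symbol_def)
  show "kernel_eigenvalue (S o\<^sub>L T) (rep_linf (\<phi> * \<eta>))"
    using kernel_eigenvalue_compose[OF bdd(1) S(1) T(1)] rep_linf_mult by (rule kernel_eigenvalue_cong)
  have "kernel_eigenvalue (adjoint_op T o\<^sub>L adjoint_op S) (\<lambda>\<zeta>. cnj (rep_linf (\<phi> * \<eta>) \<zeta>))"
    using kernel_eigenvalue_compose[OF bounded_operators_adjoint_op[OF bdd(2)] T(2) S(2)]
    by (rule kernel_eigenvalue_cong) (use rep_linf_mult[of \<phi> \<eta>] in \<open>auto elim: eventually_mono\<close>)
  then show "kernel_eigenvalue (adjoint_op (S o\<^sub>L T)) (\<lambda>\<zeta>. cnj (rep_linf (\<phi> * \<eta>) \<zeta>))"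
    using bdd by (simp add: adjoint_op_compose)
qed

lemma has_symbol_adjoint:
  assumes "has_symbol T \<phi>"
  shows "has_symbol (adjoint_op T) (cnj_linf \<phi>)"
proof -
  have T: "T \<in> bounded_operators" "kernel_eigenvalue T (rep_linf \<phi>)"
    "kernel_eigenvalue (adjoint_op T) (\<lambda>\<zeta>. cnj (rep_linf \<phi> \<zeta>))"
    using assms by (simp_all add: has_symbol_def)
  have "kernel_eigenvalue T (\<lambda>\<zeta>. cnj (rep_linf (cnj_linf \<phi>) \<zeta>))"
    using T(2) by (rule kernel_eigenvalue_cong) (use rep_linf_cnj[of \<phi>] in \<open>auto elim: eventually_mono\<close>)
  then show ?thesis
    using T kernel_eigenvalue_cong[OF T(3) rep_linf_cnj]
    by (simp add: has_symbol_def bounded_operators_adjoint_op adjoint_op_adjoint_op)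
qed

lemma has_symbol_berezin: "has_symbol T \<phi> \<Longrightarrow> radially_tendsto (berezin T) (rep_linf \<phi>)"
  by (simp add: has_symbol_def kernel_eigenvalue_berezin)

lemma symbol_eqI:
  assumes "has_symbol T \<phi>"
  shows "symbol T = \<phi>"
  unfolding symbol_def
proof (rule the_equality)
  show "radially_tendsto (berezin T) (rep_linf \<phi>)" using assms by (rule has_symbol_berezin)
  fix \<eta> assume "radially_tendsto (berezin T) (rep_linf \<eta>)"
  with has_symbol_berezin[OF assms] have "AE \<zeta> in torus_measure. rep_linf \<eta> \<zeta> = rep_linf \<phi> \<zeta>"
    unfolding radially_tendsto_def
    by eventually_elim (rule tendsto_unique[OF trivial_limit_at_left_real])
  then show "\<eta> = \<phi>" by (rule linf_eqI)
qed

text \<open>The symbols of a convergent sequence of operators are uniformly Cauchy almost everywhere,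
  because differences of symbols are dominated by operator norms.  Their pointwise limit is the
  symbol of the limit.\<close>

lemma closed_has_symbol: "closed {T :: 'n::finite h2 \<Rightarrow>\<^sub>L 'n h2. \<exists>\<phi>. has_symbol T \<phi>}"
  unfolding closed_sequential_limits
proof (intro allI impI, elim conjE)
  fix X and T :: "'n h2 \<Rightarrow>\<^sub>L 'n h2"
  assume X: "\<forall>m. X m \<in> {T. \<exists>\<phi>. has_symbol T \<phi>}" and lim: "X \<longlonglongrightarrow> T"
  then have "\<forall>m. \<exists>\<phi>. has_symbol (X m) \<phi>" by simp
  then obtain \<phi> where \<phi>: "has_symbol (X m) (\<phi> m)" for m by metis
  then have bdd: "X m \<in> bounded_operators" and eig: "kernel_eigenvalue (X m) (rep_linf (\<phi> m))"
    and adj: "kernel_eigenvalue (adjoint_op (X m)) (\<lambda>\<zeta>. cnj (rep_linf (\<phi> m) \<zeta>))" for m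
    by (simp_all add: has_symbol_def)
  have T: "T \<in> bounded_operators"
    using closed_sequentially[OF closed_bounded_operators _ lim] bdd by blast
  have "AE \<zeta> in torus_measure. \<forall>m l. norm (rep_linf (\<phi> m) \<zeta> - rep_linf (\<phi> l) \<zeta>) \<le> norm (X m - X l)"
    by (simp add: AE_all_countable kernel_eigenvalue_dist_le[OF eig eig])
  then have conv: "AE \<zeta> in torus_measure. (\<lambda>m. rep_linf (\<phi> m) \<zeta>) \<longlonglongrightarrow> lim (\<lambda>m. rep_linf (\<phi> m) \<zeta>)"
  proof eventually_elim
    case (elim \<zeta>)
    have "Cauchy (\<lambda>m. rep_linf (\<phi> m) \<zeta>)"
      using LIMSEQ_imp_Cauchy[OF lim] elim
      unfolding Cauchy_def dist_norm by (meson le_less_trans)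
    then show ?case by (simp add: Cauchy_convergent_iff convergent_LIMSEQ_iff)
  qed
  define g where "g \<zeta> = lim (\<lambda>m. rep_linf (\<phi> m) \<zeta>)" for \<zeta>
  have zero: "kernel_eigenvalue (0 :: 'n h2 \<Rightarrow>\<^sub>L 'n h2) (\<lambda>_. 0)"
    using kernel_eigenvalue_diff[OF eig[of 0] eig[of 0]] by simp
  have "AE \<zeta> in torus_measure. \<forall>m. norm (rep_linf (\<phi> m) \<zeta>) \<le> norm (X m)"
    using kernel_eigenvalue_dist_le[OF eig zero] by (simp add: AE_all_countable)
  with conv have bound: "AE \<zeta> in torus_measure. norm (g \<zeta>) \<le> norm T"
    unfolding g_def
    by eventually_elim (rule LIMSEQ_le[OF tendsto_norm tendsto_norm[OF lim]], auto)
  have g: "essentially_bounded g"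
    unfolding essentially_bounded_def
  proof
    show "g \<in> borel_measurable torus_measure" unfolding g_def[abs_def] by measurable
  qed (use bound in blast)
  have rep_g: "AE \<zeta> in torus_measure. rep_linf (abs_linf g) \<zeta> = g \<zeta>" using g by (rule rep_abs_linf_AE)
  have "has_symbol T (abs_linf g)"
    unfolding has_symbol_def
  proof (intro conjI T)
    show "kernel_eigenvalue T (rep_linf (abs_linf g))"
      using eig lim
      by (rule kernel_eigenvalue_limit) (use conv rep_g in \<open>eventually_elim, simp add: g_def\<close>)
    have "(\<lambda>m. adjoint_op (X m)) \<longlonglongrightarrow> adjoint_op T"
    proof (rule LIM_zero_cancel, rule Lim_null_comparison)
      show "(\<lambda>m. norm (X m - T)) \<longlonglongrightarrow> 0" using lim by (intro tendsto_norm_zero LIM_zero)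
      show "\<forall>\<^sub>F m in sequentially. norm (adjoint_op (X m) - adjoint_op T) \<le> norm (X m - T)"
        using norm_adjoint_op_le[OF bounded_operators_diff[OF bdd T]]
        by (simp add: adjoint_op_diff bdd T)
    qed
    with adj show "kernel_eigenvalue (adjoint_op T) (\<lambda>\<zeta>. cnj (rep_linf (abs_linf g) \<zeta>))"
      by (rule kernel_eigenvalue_limit)
        (use conv rep_g in \<open>eventually_elim, auto simp: g_def intro: tendsto_cnj\<close>)
  qed
  then show "T \<in> {T. \<exists>\<phi>. has_symbol T \<phi>}" by blast
qed

section \<open>The algebra and its symbol map\<close>

text \<open>\<open>A T\<^sub>\<psi> k\<close> differs from \<open>\<psi>(\<zeta>) A k\<close> by a term that tends to zero, and \<open>\<psi>(\<zeta>)\<close> has modulus one.\<close>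

lemma kernel_eigenvalue_zero_iff:
  assumes A: "A \<in> bounded_operators" and \<psi>: "AE z in torus_measure. norm (rep_linf \<psi> z) = 1"
  shows "kernel_eigenvalue A (\<lambda>_. 0) \<longleftrightarrow>
    radially_tendsto (\<lambda>\<xi>. norm (blinfun_apply A (blinfun_apply (toeplitz \<psi>) (kernel \<xi>)))) (\<lambda>_. 0)"
proof -
  have "AE \<zeta> in torus_measure.
    ((\<lambda>r. blinfun_apply A (radial_kernel \<zeta> r)) \<longlongrightarrow> 0) (at_left 1) \<longleftrightarrow>
    ((\<lambda>r. blinfun_apply A (blinfun_apply (toeplitz \<psi>) (radial_kernel \<zeta> r))) \<longlongrightarrow> 0) (at_left 1)"
    using \<psi> kernel_eigenvalue_toeplitz[of \<psi>, unfolded kernel_eigenvalue_def]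
  proof eventually_elim
    case (elim \<zeta>)
    let ?c = "rep_linf \<psi> \<zeta>"
    let ?Ak = "\<lambda>r. blinfun_apply A (radial_kernel \<zeta> r)"
    let ?ATk = "\<lambda>r. blinfun_apply A (blinfun_apply (toeplitz \<psi>) (radial_kernel \<zeta> r))"
    have diff: "((\<lambda>r. ?ATk r - ?c *\<^sub>C ?Ak r) \<longlongrightarrow> 0) (at_left 1)"
      using tendsto_blinfun_zero[OF elim(2), of A]
      by (simp add: blinfun.diff_right bounded_operators_scaleC[OF A])
    have "?c \<noteq> 0" using elim(1) by auto
    then have inv: "?Ak = (\<lambda>r. inverse ?c *\<^sub>C (?c *\<^sub>C ?Ak r))"
      by (simp add: scaleC_scaleC scaleC_one)
    show ?case
    proof
      assume "(?Ak \<longlongrightarrow> 0) (at_left 1)"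
      from tendsto_add[OF diff tendsto_scaleC_zero[OF this, of ?c]]
      show "(?ATk \<longlongrightarrow> 0) (at_left 1)" by simp
    next
      assume "(?ATk \<longlongrightarrow> 0) (at_left 1)"
      from tendsto_diff[OF this diff] have "((\<lambda>r. ?c *\<^sub>C ?Ak r) \<longlongrightarrow> 0) (at_left 1)" by simp
      then show "(?Ak \<longlongrightarrow> 0) (at_left 1)" by (subst inv) (rule tendsto_scaleC_zero)
    qed
  qed
  moreover have "c *\<^sub>C x = 0" if "c = 0" for c and x :: "'a h2"
    using that scaleC_of_real[of 0 x] by simp
  ultimately show ?thesis
    unfolding kernel_eigenvalue_def radially_tendsto_def radial_kernel_def[symmetric] tendsto_norm_zero_iff
    by (auto elim: eventually_elim2)
qed

lemma B_zero_eq: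
  assumes "AE z in torus_measure. norm (rep_linf \<psi> z) = 1"
  shows "B_zero \<psi> = {A. has_symbol A 0}"
proof -
  have zero: "kernel_eigenvalue A (rep_linf 0) \<longleftrightarrow> kernel_eigenvalue A (\<lambda>_. 0)"
    "kernel_eigenvalue A (\<lambda>\<zeta>. cnj (rep_linf 0 \<zeta>)) \<longleftrightarrow> kernel_eigenvalue A (\<lambda>_. 0)" for A :: "'a h2 \<Rightarrow>\<^sub>L 'a h2"
    using rep_linf_zero by (auto elim!: kernel_eigenvalue_cong eventually_mono)
  show ?thesis
    unfolding B_zero_def has_symbol_def zero
    using kernel_eigenvalue_zero_iff[OF _ assms] bounded_operators_adjoint_op by blast
qed

text \<open>If \<open>T\<close> has the symbol \<open>\<phi>\<close>, then \<open>T - T\<^sub>\<phi>\<close> has the symbol zero.\<close>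

lemma A_alg_eq:
  assumes "AE z in torus_measure. norm (rep_linf \<psi> z) = 1"
  shows "A_alg \<psi> = {T. \<exists>\<phi>. has_symbol T \<phi>}"
proof (intro set_eqI iffI)
  fix T :: "'a h2 \<Rightarrow>\<^sub>L 'a h2" assume "T \<in> A_alg \<psi>"
  then obtain \<phi> A where "T = toeplitz \<phi> + A" "has_symbol A 0"
    by (auto simp: A_alg_def B_zero_eq[OF assms])
  then show "T \<in> {T. \<exists>\<phi>. has_symbol T \<phi>}"
    using has_symbol_add[OF has_symbol_toeplitz[of \<phi>]] by blast
next
  fix T :: "'a h2 \<Rightarrow>\<^sub>L 'a h2" assume "T \<in> {T. \<exists>\<phi>. has_symbol T \<phi>}"
  then obtain \<phi> where T: "has_symbol T \<phi>" by blast
  have "scale_op (- 1) (toeplitz \<phi>) = - toeplitz \<phi>"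
    by (rule blinfun_eqI) (use scaleC_of_real[of "- 1"] in \<open>simp add: scale_op_apply blinfun.minus_left\<close>)
  moreover have "const_linf (- 1) * \<phi> = - \<phi>"
  proof (rule linf_eqI)
    show "AE z in torus_measure. rep_linf (const_linf (- 1) * \<phi>) z = rep_linf (- \<phi>) z"
      using rep_linf_mult[of "const_linf (- 1)" \<phi>] rep_linf_const[of "- 1"] rep_linf_uminus[of \<phi>]
      by eventually_elim simp
  qed
  ultimately have "has_symbol (T - toeplitz \<phi>) 0"
    using has_symbol_add[OF T has_symbol_scale[OF has_symbol_toeplitz[of \<phi>], of "- 1"]] by simp
  then have "T - toeplitz \<phi> \<in> B_zero \<psi>" by (simp add: B_zero_eq[OF assms])
  then show "T \<in> A_alg \<psi>"
    unfolding A_alg_def by (intro CollectI exI[of _ \<phi>] exI[of _ "T - toeplitz \<phi>"]) simp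
qed

theorem theorem5p8:
  fixes \<psi> :: "'n::finite linf"
  assumes "AE z in torus_measure. norm (rep_linf \<psi> z) = 1"
  shows "(\<forall>T\<in>A_alg \<psi>. \<exists>\<phi>. radially_tendsto (berezin T) (rep_linf \<phi>))
    \<and> operator_cstar_algebra (A_alg \<psi>)
    \<and> cstar_hom (A_alg \<psi>) symbol
    \<and> symbol ` A_alg \<psi> = UNIV
    \<and> (\<forall>\<phi>. symbol (toeplitz \<phi> :: 'n h2 \<Rightarrow>\<^sub>L 'n h2) = \<phi>)"
proof (intro conjI)
  note A_alg = A_alg_eq[OF assms]
  show "\<forall>T\<in>A_alg \<psi>. \<exists>\<phi>. radially_tendsto (berezin T) (rep_linf \<phi>)"
    by (auto simp: A_alg intro: has_symbol_berezin)
  have "scale_op 0 (toeplitz \<psi>) = 0"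
    by (rule blinfun_eqI) (use scaleC_of_real[of 0] in \<open>simp add: scale_op_apply\<close>)
  then have "\<exists>\<phi>. has_symbol (0 :: 'n h2 \<Rightarrow>\<^sub>L 'n h2) \<phi>"
    using has_symbol_scale[OF has_symbol_toeplitz[of \<psi>], of 0] by auto
  then show "operator_cstar_algebra (A_alg \<psi>)"
    unfolding operator_cstar_algebra_def A_alg
    by (intro conjI closed_has_symbol)
      (auto intro: has_symbol_add has_symbol_scale has_symbol_compose has_symbol_adjoint,
        auto simp: has_symbol_def)
  show "cstar_hom (A_alg \<psi>) symbol"
    unfolding cstar_hom_def A_alg
    by (auto simp: symbol_eqI intro!: symbol_eqI
        intro: has_symbol_add has_symbol_scale has_symbol_compose has_symbol_adjoint)
  show symbol_toeplitz: "\<forall>\<phi>. symbol (toeplitz \<phi> :: 'n h2 \<Rightarrow>\<^sub>L 'n h2) = \<phi>"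
    by (simp add: symbol_eqI has_symbol_toeplitz)
  have "toeplitz \<phi> \<in> A_alg \<psi>" for \<phi> using has_symbol_toeplitz by (auto simp: A_alg)
  then show "symbol ` A_alg \<psi> = UNIV"
    using symbol_toeplitz by (auto intro!: rev_image_eqI)
qed

end
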